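(* Every complete $n$-vertex simple topological graph contains $\Omega(n^{1/3})$ pairwise disjoint edges. That is, there exist an absolute constant $c>0$ and an integer $n_0$ such that for every $n\ge n_0$, every complete simple topological graph with $n$ vertices contains at least $c\,n^{1/3}$ edges that are pairwise disjoint.
   Context: A topological graph is a graph drawn in the plane such that its vertices are represented by (distinct) points and its edges are represented by non-self-intersecting arcs connecting the corresponding points. The arcs may intersect each other, but they may not pass through vertices except for their own endpoints. Furthermore, no three edges have a common interior point, and no two edges are tangent, i.e., if two edges share an interior point, then they properly cross at that point. A topological graph is simple if every pair of its edges intersects at most once (a common endpoint counts as an intersection point). It is complete if every pair of vertices is joined by exactly one edge. Two edges cross if their interiors share a point, and they are disjoint if they neither share a common vertex nor cross. *)

theory Defs
  imports "HOL-Analysis.Analysis"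
begin

text \<open>
  The plane is \<^typ>\<open>complex\<close>. A graph drawn in the plane is given by its set \<open>V\<close> of vertices, which
  are points, and its set \<open>E\<close> of edges, which are parametrised arcs on the unit interval.
  Parametrisation and orientation are irrelevant: two members of \<open>E\<close> with the same image would be
  different edges with infinitely many common interior points, none of them a proper crossing,
  so each edge of a topological graph occurs in \<open>E\<close> with exactly one parametrisation.
\<close>

definition edge_ends :: "(real \<Rightarrow> complex) \<Rightarrow> complex set" where
  "edge_ends e = {pathstart e, pathfinish e}"

definition edge_interior :: "(real \<Rightarrow> complex) \<Rightarrow> complex set" where
  "edge_interior e = path_image e - edge_ends e"

text \<open>
  Edges are merely continuous arcs, so a proper crossing is understood topologically: up to a
  homeomorphism of a neighbourhood of \<open>p\<close>, the two edges are two perpendicular diameters of a disc.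
  In particular each edge passes from one side of the other to the opposite side at \<open>p\<close>.
\<close>

definition properly_cross_at :: "(real \<Rightarrow> complex) \<Rightarrow> (real \<Rightarrow> complex) \<Rightarrow> complex \<Rightarrow> bool" where
  "properly_cross_at e f p \<longleftrightarrow>
     (\<exists>U \<phi> \<psi>. open U \<and> p \<in> U \<and> homeomorphism U (ball 0 1) \<phi> \<psi> \<and> \<phi> p = 0 \<and>
        \<phi> ` (path_image e \<inter> U) = {z \<in> ball 0 1. Im z = 0} \<and>
        \<phi> ` (path_image f \<inter> U) = {z \<in> ball 0 1. Re z = 0})"

locale topological_graph =
  fixes V :: "complex set" and E :: "(real \<Rightarrow> complex) set"
  assumes finite_vertices: "finite V"
    and finite_edges: "finite E"
    and edge_arc: "e \<in> E \<Longrightarrow> arc e"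
    and edge_ends_in_V: "e \<in> E \<Longrightarrow> edge_ends e \<subseteq> V"
    and edge_avoids_vertices: "e \<in> E \<Longrightarrow> edge_interior e \<inter> V = {}"
    and no_triple_point: "\<lbrakk>e \<in> E; f \<in> E; g \<in> E; e \<noteq> f; e \<noteq> g; f \<noteq> g\<rbrakk>
      \<Longrightarrow> edge_interior e \<inter> edge_interior f \<inter> edge_interior g = {}"
    and proper_crossings: "\<lbrakk>e \<in> E; f \<in> E; e \<noteq> f; p \<in> edge_interior e \<inter> edge_interior f\<rbrakk>
      \<Longrightarrow> properly_cross_at e f p"

locale simple_topological_graph = topological_graph +
  assumes intersect_at_most_once: "\<lbrakk>e \<in> E; f \<in> E; e \<noteq> f;
      p \<in> path_image e \<inter> path_image f; q \<in> path_image e \<inter> path_image f\<rbrakk> \<Longrightarrow> p = q"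

locale complete_topological_graph = topological_graph +
  assumes joined_by_unique_edge: "\<lbrakk>u \<in> V; v \<in> V; u \<noteq> v\<rbrakk> \<Longrightarrow> \<exists>!e. e \<in> E \<and> edge_ends e = {u, v}"

locale complete_simple_topological_graph =
  complete_topological_graph + simple_topological_graph

definition edges_cross :: "(real \<Rightarrow> complex) \<Rightarrow> (real \<Rightarrow> complex) \<Rightarrow> bool" where
  "edges_cross e f \<longleftrightarrow> edge_interior e \<inter> edge_interior f \<noteq> {}"

definition disjoint_edges :: "(real \<Rightarrow> complex) \<Rightarrow> (real \<Rightarrow> complex) \<Rightarrow> bool" where
  "disjoint_edges e f \<longleftrightarrow> edge_ends e \<inter> edge_ends f = {} \<and> \<not> edges_cross e f"

end

theory Submission
  imports Defs
begin

text \<open>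
  Write \<open>X(ab, cd)\<close> if the edges \<open>ab\<close> and \<open>cd\<close> cross. The
  proof fixes a vertex \<open>c\<close> and replaces the drawing by the relation \<open>X\<close>
  together with the rotation at \<open>c\<close>, that is, the cyclic order in which the edges leave
  \<open>c\<close>. The planar topology is used only to derive a handful of rules for
  \<open>X\<close>; the rest is combinatorics.

  Topology. A proper crossing changes the side of a Jordan curve, so an edge joins vertices on the
  same side iff it meets the curve an even number of times (\<open>side_parity\<close>). Applied to
  triangles this gives a formula for \<open>X(ij, kl)\<close> in terms of the rotation and of
  crossings with edges at \<open>c\<close> (\<open>cross_formula\<close>). The sides at
  \<open>c\<close> are related to the rotation by Janiszewski's theorem
  (\<open>germs_same_side_iff\<close>), without any normal form for arcs. If \<open>ab\<close> and
  \<open>cd\<close> cross at \<open>p\<close>, the pieces \<open>ap\<close> and \<open>pd\<close>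
  and the edge \<open>ad\<close> form a Jordan curve with \<open>b\<close> and \<open>c\<close> on
  the same side (\<open>corner\<close>). Parity arguments for such curves show that four vertices
  span at most one crossing, and yield the other rules.

  Combinatorics. Call an edge uncrossed if no edge at \<open>c\<close> crosses it. For every vertex
  \<open>v\<close> and every plane set \<open>M\<close> of uncrossed edges there is an uncrossed
  edge at \<open>v\<close> that crosses no edge of \<open>M\<close>
  (\<open>good_neighbour_exists\<close>). Consequently a largest plane matching of uncrossed edges
  either has \<open>m\<close> edges, or all other vertices send uncrossed edges to its fewer than
  \<open>2m\<close> ends; with \<open>12m\<^sup>3\<close> vertices some \<open>u\<close> has a set
  \<open>Q\<close> of \<open>4m\<^sup>2\<close> uncrossed neighbours. The edges from
  \<open>c\<close> and \<open>u\<close> to \<open>Q\<close> form a plane complete bipartite graph.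
  Order \<open>Q\<close> by the rotation, beginning at \<open>u\<close>. The relation that
  \<open>cu\<close> crosses \<open>ij\<close>, for \<open>i\<close> before \<open>j\<close>, is a
  partial order on \<open>Q\<close>, so \<open>Q\<close> contains a chain or an antichain
  \<open>q\<^sub>1, \<dots>, q\<^sub>2\<^sub>m\<close>. In an antichain the edges
  \<open>q\<^sub>1q\<^sub>2, q\<^sub>3q\<^sub>4, \<dots>\<close> are pairwise disjoint, in a chain
  the edges \<open>q\<^sub>iq\<^sub>i\<^sub>+\<^sub>m\<close> are
  (\<open>disjoint_pairs_in_star\<close>). Hence more than \<open>12m\<^sup>3\<close> vertices force
  \<open>m\<close> disjoint edges.
\<close>

section \<open>Paths crossing a Jordan curve\<close>

definition jordan_curve :: "complex set \<Rightarrow> bool" where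
  "jordan_curve \<Gamma> \<longleftrightarrow> (\<exists>c. simple_path c \<and> pathfinish c = pathstart c \<and> path_image c = \<Gamma>)"

lemma jordan_curve_frontiers:
  assumes "jordan_curve \<Gamma>"
  shows "frontier (inside \<Gamma>) = \<Gamma>" "frontier (outside \<Gamma>) = \<Gamma>"
  using assms Jordan_inside_outside unfolding jordan_curve_def by metis+

lemma connected_off_curve_one_side:
  assumes "connected S" "S \<inter> \<Gamma> = {}" "x \<in> S" "y \<in> S"
  shows "x \<in> inside \<Gamma> \<longleftrightarrow> y \<in> inside \<Gamma>"
proof -
  have "connected_component (- \<Gamma>) x y"
    unfolding connected_component_def using assms by blast
  then show ?thesis
    by (meson connected_component_sym inside_same_component)
qed

lemma same_side_connected_component:
  assumes "jordan_curve \<Gamma>" "x \<notin> \<Gamma>" "y \<notin> \<Gamma>" "x \<in> inside \<Gamma> \<longleftrightarrow> y \<in> inside \<Gamma>"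
  shows "connected_component (- \<Gamma>) x y"
proof -
  obtain c where c: "simple_path c" "pathfinish c = pathstart c" "path_image c = \<Gamma>"
    using assms(1) unfolding jordan_curve_def by blast
  have con: "connected (inside \<Gamma>)" "connected (outside \<Gamma>)" and un: "inside \<Gamma> \<union> outside \<Gamma> = - \<Gamma>"
    using Jordan_inside_outside[OF c(1,2)] c(3) by auto
  show ?thesis
  proof (cases "x \<in> inside \<Gamma>")
    case True
    then show ?thesis using con(1) un assms(4) unfolding connected_component_def by blast
  next
    case False
    then have "x \<in> outside \<Gamma>" "y \<in> outside \<Gamma>" using un assms(2,3,4) False by blast+
    then show ?thesis using con(2) un unfolding connected_component_def by blast
  qed
qed

definition flips_side :: "complex set \<Rightarrow> (real \<Rightarrow> complex) \<Rightarrow> real \<Rightarrow> bool" where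
  "flips_side \<Gamma> f t \<longleftrightarrow> (\<exists>\<delta>>0. \<forall>s s'. t - \<delta> < s \<and> s < t \<and> t < s' \<and> s' < t + \<delta>
      \<longrightarrow> (f s \<in> inside \<Gamma>) \<noteq> (f s' \<in> inside \<Gamma>))"

text \<open>
  Induction on the number of meeting points: cut just before and just after the last one. In between
  the side changes once, and after it the path stays on one side.
\<close>

lemma even_flips_iff_same_side:
  fixes f :: "real \<Rightarrow> complex"
  assumes "a \<le> b" "continuous_on {a..b} f" "f a \<notin> \<Gamma>" "f b \<notin> \<Gamma>"
    and "finite {t \<in> {a..b}. f t \<in> \<Gamma>}"
    and "\<And>t. \<lbrakk>t \<in> {a..b}; f t \<in> \<Gamma>\<rbrakk> \<Longrightarrow> flips_side \<Gamma> f t"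
  shows "(f a \<in> inside \<Gamma> \<longleftrightarrow> f b \<in> inside \<Gamma>) \<longleftrightarrow> even (card {t \<in> {a..b}. f t \<in> \<Gamma>})"
  using assms
proof (induction "card {t \<in> {a..b}. f t \<in> \<Gamma>}" arbitrary: b)
  case 0
  then have "{t \<in> {a..b}. f t \<in> \<Gamma>} = {}" by auto
  then have "f ` {a..b} \<inter> \<Gamma> = {}" by auto
  moreover have "connected (f ` {a..b})" using 0 by (intro connected_continuous_image) auto
  moreover have "f a \<in> f ` {a..b}" "f b \<in> f ` {a..b}" using \<open>a \<le> b\<close> by auto
  ultimately have "f a \<in> inside \<Gamma> \<longleftrightarrow> f b \<in> inside \<Gamma>"
    using connected_off_curve_one_side by blast
  then show ?case using 0(1) by (metis even_zero)
next
  case (Suc n)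
  define T where "T = {t \<in> {a..b}. f t \<in> \<Gamma>}"
  have fin: "finite T" using Suc.prems unfolding T_def by blast
  moreover have "card T = Suc n" using Suc.hyps(2) unfolding T_def by simp
  ultimately have ne: "T \<noteq> {}" by auto
  define t where "t = Max T"
  have tT: "t \<in> T" using fin ne unfolding t_def by simp
  have tmax: "\<And>u. u \<in> T \<Longrightarrow> u \<le> t" using fin unfolding t_def by simp
  have tab: "a < t" "t < b" using tT Suc.prems unfolding T_def by (auto simp: less_le)
  obtain \<delta> where "\<delta> > 0" and \<delta>: "\<And>s s'. t - \<delta> < s \<and> s < t \<and> t < s' \<and> s' < t + \<delta>
      \<Longrightarrow> (f s \<in> inside \<Gamma>) \<noteq> (f s' \<in> inside \<Gamma>)"
    using Suc.prems(6)[of t] tT unfolding flips_side_def T_def by blast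
  define m where "m = Max (insert a (insert (t - \<delta>) (T - {t})))"
  have "\<And>u. u \<in> insert a (insert (t - \<delta>) (T - {t})) \<Longrightarrow> u < t" using tmax tab \<open>\<delta> > 0\<close> by (auto simp: less_le)
  then have mt: "m < t" unfolding m_def using fin by (subst Max_less_iff) auto
  obtain s where s: "m < s" "s < t" using mt dense by blast
  have mge: "\<And>u. u \<in> insert a (insert (t - \<delta>) (T - {t})) \<Longrightarrow> u \<le> m" unfolding m_def using fin by (intro Max_ge) auto
  have sa: "a < s" "t - \<delta> < s" using mge[of a] mge[of "t-\<delta>"] s by auto
  obtain s' where s': "t < s'" "s' < min b (t + \<delta>)" using tab \<open>\<delta> > 0\<close> dense[of t "min b (t+\<delta>)"] by auto
  have Ts: "{u \<in> {a..s}. f u \<in> \<Gamma>} = T - {t}"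
  proof
    show "{u \<in> {a..s}. f u \<in> \<Gamma>} \<subseteq> T - {t}" using s tab unfolding T_def by auto
    show "T - {t} \<subseteq> {u \<in> {a..s}. f u \<in> \<Gamma>}"
    proof
      fix u assume u: "u \<in> T - {t}"
      then have "u \<le> s" using mge[of u] s(1) by simp
      then show "u \<in> {u \<in> {a..s}. f u \<in> \<Gamma>}" using u unfolding T_def by simp
    qed
  qed
  have fs: "f s \<notin> \<Gamma>"
  proof
    assume "f s \<in> \<Gamma>"
    then have "s \<in> {u \<in> {a..s}. f u \<in> \<Gamma>}" using sa(1) by simp
    then have "s \<in> insert a (insert (t - \<delta>) (T - {t}))" unfolding Ts by simp
    then show False using mge s(1) by (meson not_le)
  qed
  have "(f a \<in> inside \<Gamma> \<longleftrightarrow> f s \<in> inside \<Gamma>) \<longleftrightarrow> even (card {u \<in> {a..s}. f u \<in> \<Gamma>})"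
  proof (rule Suc.hyps(1))
    show "n = card {u \<in> {a..s}. f u \<in> \<Gamma>}"
      using Ts Suc.hyps(2) tT fin unfolding T_def[symmetric] by simp
    show "continuous_on {a..s} f" using Suc.prems(2) s tab by (auto elim: continuous_on_subset)
    show "finite {u \<in> {a..s}. f u \<in> \<Gamma>}" using Ts fin by simp
    show "\<And>u. \<lbrakk>u \<in> {a..s}; f u \<in> \<Gamma>\<rbrakk> \<Longrightarrow> flips_side \<Gamma> f u" using Suc.prems(6) s tab by auto
  qed (use sa fs Suc.prems in auto)
  moreover have "(f s \<in> inside \<Gamma>) \<noteq> (f s' \<in> inside \<Gamma>)" using \<delta> s s' sa by auto
  moreover have "f s' \<in> inside \<Gamma> \<longleftrightarrow> f b \<in> inside \<Gamma>"
  proof (rule connected_off_curve_one_side)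
    show "connected (f ` {s'..b})" using Suc.prems(2) s' tab
      by (intro connected_continuous_image) (auto elim: continuous_on_subset)
    have "f u \<notin> \<Gamma>" if "u \<in> {s'..b}" for u
      using tmax[of u] that s' tab unfolding T_def by auto
    then show "f ` {s'..b} \<inter> \<Gamma> = {}" by auto
  qed (use s' in auto)
  moreover have "card T = Suc (card (T - {t}))" using tT fin by (metis card.remove)
  ultimately have "(f a \<in> inside \<Gamma> \<longleftrightarrow> f b \<in> inside \<Gamma>) \<longleftrightarrow> even (card T)"
    unfolding Ts by (metis even_Suc)
  then show ?case unfolding T_def .
qed

text \<open>
  In a chart that maps the arc injectively into a line, the position on that line is a continuous
  injective function of the parameter, hence strictly monotone; the sign \<open>\<sigma>\<close>
  records its direction.
\<close>

lemma arc_in_chart_changes_sign: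
  fixes \<phi> :: "complex \<Rightarrow> complex" and h :: "complex \<Rightarrow> real"
  assumes "open U" "p \<in> U" "continuous_on U \<phi>" "inj_on \<phi> U"
    and "continuous_on UNIV h" "inj_on h (\<phi> ` (path_image f \<inter> U))" "h (\<phi> p) = 0"
    and "arc f" "0 < t" "t < 1" "f t = p"
  obtains \<delta> \<sigma> where "\<delta> > 0" "\<sigma> = 1 \<or> \<sigma> = (-1::real)" "{t-\<delta>..t+\<delta>} \<subseteq> {0<..<1}"
    "\<And>s. \<lbrakk>t - \<delta> \<le> s; s \<le> t + \<delta>\<rbrakk> \<Longrightarrow> f s \<in> U"
    "\<And>s. \<lbrakk>t - \<delta> \<le> s; s < t\<rbrakk> \<Longrightarrow> \<sigma> * h (\<phi> (f s)) < 0"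
    "\<And>s. \<lbrakk>t < s; s \<le> t + \<delta>\<rbrakk> \<Longrightarrow> \<sigma> * h (\<phi> (f s)) > 0"
proof -
  have cf: "continuous_on {0..1} f" and inj: "inj_on f {0..1}"
    using \<open>arc f\<close> unfolding arc_def path_def by auto
  have "open (f -` U \<inter> {0<..<1})"
  proof -
    have "continuous_on {0<..<1} f" using cf by (rule continuous_on_subset) auto
    then show ?thesis using continuous_on_open_vimage[of "{0<..<1}" f] \<open>open U\<close> by auto
  qed
  moreover have "t \<in> f -` U \<inter> {0<..<1}" using assms by auto
  ultimately obtain d where "d > 0" and d: "cball t d \<subseteq> f -` U \<inter> {0<..<1}"
    by (meson open_contains_cball)
  have dd: "{t-d..t+d} \<subseteq> f -` U \<inter> {0<..<1}" using d by (simp add: cball_eq_atLeastAtMost)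
  define k where "k = (\<lambda>s. h (\<phi> (f s)))"
  have sub: "{t-d..t+d} \<subseteq> {0..1}" "f ` {t-d..t+d} \<subseteq> U" using dd by (fastforce, auto)
  have ck: "continuous_on {t-d..t+d} k" unfolding k_def
  proof -
    have "continuous_on {t-d..t+d} f" using cf sub by (auto elim: continuous_on_subset)
    then have "continuous_on {t-d..t+d} (\<lambda>s. \<phi> (f s))"
      by (rule continuous_on_compose2[OF \<open>continuous_on U \<phi>\<close>]) (use sub in auto)
    then show "continuous_on {t-d..t+d} (\<lambda>s. h (\<phi> (f s)))"
      by (rule continuous_on_compose2[OF \<open>continuous_on UNIV h\<close>]) auto
  qed
  have ik: "inj_on k {t-d..t+d}"
  proof (rule inj_onI)
    fix s u assume su: "s \<in> {t-d..t+d}" "u \<in> {t-d..t+d}" "k s = k u"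
    have "f s \<in> path_image f \<inter> U" "f u \<in> path_image f \<inter> U"
      using su sub unfolding path_image_def by blast+
    then have "\<phi> (f s) = \<phi> (f u)" using su(3) assms(6) unfolding k_def by (meson image_eqI inj_onD)
    then have "f s = f u" using assms(4) \<open>f s \<in> _\<close> \<open>f u \<in> _\<close> by (meson IntD2 inj_onD)
    then show "s = u" using inj sub su by (meson inj_onD subsetD)
  qed
  have k0: "k t = 0" unfolding k_def using assms by simp
  have mono: "\<And>x y z. \<lbrakk>t-d \<le> x; x < y; y < z; z \<le> t+d\<rbrakk> \<Longrightarrow> (k x < k y \<and> k y < k z) \<or> (k z < k y \<and> k y < k x)"
    by (rule continuous_inj_imp_mono[of _ _ _ k])
       (auto intro: continuous_on_subset[OF ck] inj_on_subset[OF ik])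
  define \<sigma> where "\<sigma> = (if k (t+d) > 0 then 1 else -1::real)"
  have ends: "k (t-d) < 0 \<and> 0 < k (t+d) \<or> k (t+d) < 0 \<and> 0 < k (t-d)"
    using mono[of "t-d" t "t+d"] k0 \<open>d > 0\<close> by auto
  have neg: "\<sigma> * k s < 0" if "t-d \<le> s" "s < t" for s
    using mono[of s t "t+d"] that \<open>d > 0\<close> k0 ends unfolding \<sigma>_def by auto
  have pos: "\<sigma> * k s > 0" if "t < s" "s \<le> t+d" for s
    using mono[of "t-d" t s] that \<open>d > 0\<close> k0 ends unfolding \<sigma>_def by auto
  show thesis
    by (rule that[of d \<sigma>]) (use \<open>d > 0\<close> dd neg pos in \<open>auto simp: \<sigma>_def k_def\<close>)
qed

lemma crossing_chart_disc:
  assumes "open U" "p \<in> U" "homeomorphism U (ball 0 1) \<phi> \<psi>" "\<phi> p = (0::complex)" "open N" "p \<in> N"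
  obtains r where "0 < r" "r \<le> 1" "\<psi> ` ball 0 r \<subseteq> N" "open (\<psi> ` ball 0 r)" "p \<in> \<psi> ` ball 0 r" "\<psi> ` ball 0 r \<subseteq> U"
proof -
  have hom: "continuous_on U \<phi>" "continuous_on (ball 0 1) \<psi>" "\<phi> ` U = ball 0 1" "\<psi> ` ball 0 1 = U"
    "\<And>x. x \<in> U \<Longrightarrow> \<psi> (\<phi> x) = x" "\<And>y. y \<in> ball 0 1 \<Longrightarrow> \<phi> (\<psi> y) = y"
    using assms(3) unfolding homeomorphism_def by auto
  have p0: "\<psi> 0 = p" using hom(5)[OF assms(2)] assms(4) by simp
  have "open (\<psi> -` N \<inter> ball 0 1)"
    using continuous_on_open_vimage[of "ball 0 1" \<psi>] hom(2) \<open>open N\<close> by auto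
  moreover have "0 \<in> \<psi> -` N \<inter> ball 0 1" using p0 assms by simp
  ultimately obtain r' where r': "r' > 0" "ball 0 r' \<subseteq> \<psi> -` N \<inter> ball 0 1" by (meson open_contains_ball)
  define r where "r = min r' 1"
  have r: "r > 0" "ball 0 r \<subseteq> \<psi> -` N \<inter> ball 0 1" and r1: "r \<le> 1" using r' unfolding r_def by auto
  have eq: "\<psi> ` ball 0 r = \<phi> -` ball 0 r \<inter> U"
  proof
    show "\<psi> ` ball 0 r \<subseteq> \<phi> -` ball 0 r \<inter> U" using r hom(4,6) by force
    show "\<phi> -` ball 0 r \<inter> U \<subseteq> \<psi> ` ball 0 r" using hom(5) by force
  qed
  show thesis
  proof (rule that[of r])
    show "open (\<psi> ` ball 0 r)" unfolding eq
      using continuous_on_open_vimage[OF \<open>open U\<close>, of \<phi>] hom(1) by auto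
    show "p \<in> \<psi> ` ball 0 r" using p0 r by force
    show "\<psi> ` ball 0 r \<subseteq> N" using r by blast
  qed (use r r1 eq in auto)
qed

text \<open>
  The data behind a proper crossing, with the two conditions on images turned into pointwise
  criteria: in the chart \<open>e\<close> is the horizontal and \<open>f\<close> the vertical
  diameter.
\<close>

definition crossing_chart ::
  "(real \<Rightarrow> complex) \<Rightarrow> (real \<Rightarrow> complex) \<Rightarrow> complex \<Rightarrow> complex set \<Rightarrow> (complex \<Rightarrow> complex) \<Rightarrow> (complex \<Rightarrow> complex) \<Rightarrow> bool" where
  "crossing_chart e f p U \<phi> \<psi> \<longleftrightarrow> open U \<and> p \<in> U \<and> homeomorphism U (ball 0 1) \<phi> \<psi> \<and> \<phi> p = 0 \<and>
     (\<forall>x\<in>U. (x \<in> path_image e \<longleftrightarrow> Im (\<phi> x) = 0) \<and> (x \<in> path_image f \<longleftrightarrow> Re (\<phi> x) = 0))"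

lemma properly_cross_chartE:
  assumes "properly_cross_at e f p"
  obtains U \<phi> \<psi> where "crossing_chart e f p U \<phi> \<psi>"
proof -
  obtain U \<phi> \<psi> where U: "open U" "p \<in> U" "homeomorphism U (ball 0 1) \<phi> \<psi>" "\<phi> p = 0"
    and e: "\<phi> ` (path_image e \<inter> U) = {z \<in> ball 0 1. Im z = 0}"
    and f: "\<phi> ` (path_image f \<inter> U) = {z \<in> ball 0 1. Re z = 0}"
    using assms unfolding properly_cross_at_def by blast
  have im: "\<phi> ` U = ball 0 1" and inv: "\<And>x. x \<in> U \<Longrightarrow> \<psi> (\<phi> x) = x"
    using U(3) unfolding homeomorphism_def by auto
  have inj: "inj_on \<phi> U" using inv by (metis inj_onI)
  have mem: "x \<in> S \<longleftrightarrow> \<phi> x \<in> \<phi> ` (S \<inter> U)" if "x \<in> U" for x S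
    using inj that by (auto dest: inj_onD)
  have "(x \<in> path_image e \<longleftrightarrow> Im (\<phi> x) = 0) \<and> (x \<in> path_image f \<longleftrightarrow> Re (\<phi> x) = 0)" if "x \<in> U" for x
    using mem[OF that, of "path_image e"] mem[OF that, of "path_image f"] im that unfolding e f by auto
  then show thesis using that[of U \<phi> \<psi>] U unfolding crossing_chart_def by blast
qed

lemma crossing_chartD:
  assumes "crossing_chart e f p U \<phi> \<psi>"
  shows "open U" "p \<in> U" "homeomorphism U (ball 0 1) \<phi> \<psi>" "\<phi> p = 0"
    "continuous_on U \<phi>" "inj_on \<phi> U" "continuous_on (ball 0 1) \<psi>"
    "x \<in> U \<Longrightarrow> \<psi> (\<phi> x) = x" "y \<in> ball 0 1 \<Longrightarrow> \<phi> (\<psi> y) = y"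
    "x \<in> U \<Longrightarrow> x \<in> path_image e \<longleftrightarrow> Im (\<phi> x) = 0"
    "x \<in> U \<Longrightarrow> x \<in> path_image f \<longleftrightarrow> Re (\<phi> x) = 0"
    "inj_on Re (\<phi> ` (path_image e \<inter> U))" "inj_on Im (\<phi> ` (path_image f \<inter> U))"
proof -
  note d = assms[unfolded crossing_chart_def]
  show "open U" "p \<in> U" "homeomorphism U (ball 0 1) \<phi> \<psi>" "\<phi> p = 0" using d by blast+
  then show "continuous_on U \<phi>" "continuous_on (ball 0 1) \<psi>" 
    and inv: "x \<in> U \<Longrightarrow> \<psi> (\<phi> x) = x" "y \<in> ball 0 1 \<Longrightarrow> \<phi> (\<psi> y) = y" for x y
    unfolding homeomorphism_def by auto
  then show "inj_on \<phi> U" by (metis inj_onI)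
  show "x \<in> U \<Longrightarrow> x \<in> path_image e \<longleftrightarrow> Im (\<phi> x) = 0"
    "x \<in> U \<Longrightarrow> x \<in> path_image f \<longleftrightarrow> Re (\<phi> x) = 0" using d by blast+
  show "inj_on Re (\<phi> ` (path_image e \<inter> U))" "inj_on Im (\<phi> ` (path_image f \<inter> U))"
    using d by (auto simp: inj_on_def complex_eq_iff)
qed

text \<open>
  In the chart the curve is the horizontal diameter, so each open half-disc lies on one side of it.
  Both sides occur near \<open>p\<close> because every point of a Jordan curve is on the frontier of
  its inside and of its outside; hence the half-discs lie on different sides, and the vertical arc
  passes from one to the other.
\<close>

lemma proper_crossing_flips_side:
  assumes cr: "properly_cross_at e f p" and J: "jordan_curve \<Gamma>"
    and N: "open N" "p \<in> N" "\<Gamma> \<inter> N = path_image e \<inter> N"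
    and f: "arc f" "0 < t" "t < 1" "f t = p"
  shows "flips_side \<Gamma> f t"
proof -
  obtain U \<phi> \<psi> where ch: "crossing_chart e f p U \<phi> \<psi>" using properly_cross_chartE[OF cr] .
  note U = crossing_chartD(1-4)[OF ch] and hom = crossing_chartD(5-9)[OF ch] and ef = crossing_chartD(10-13)[OF ch]
  obtain r where r: "0 < r" "r \<le> 1" "\<psi> ` ball 0 r \<subseteq> N" "open (\<psi> ` ball 0 r)" "p \<in> \<psi> ` ball 0 r" "\<psi> ` ball 0 r \<subseteq> U"
    using crossing_chart_disc[OF U N(1,2)] by metis
  define D where "D = \<psi> ` ball 0 r"
  have D\<phi>: "\<phi> x \<in> ball 0 r" "\<psi> (\<phi> x) = x" if "x \<in> D" for x using that r(2) hom(5) hom(4) r(6) unfolding D_def by auto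
  have DU: "D \<subseteq> U" using r unfolding D_def by simp
  define half where "half = (\<lambda>\<sigma>. \<psi> ` {z \<in> ball 0 r. \<sigma> * Im z > 0})"
  have half_conn: "connected (half \<sigma>)" if "\<sigma> = 1 \<or> \<sigma> = -1" for \<sigma>
  proof -
    have "{z \<in> ball 0 r. \<sigma> * Im z > 0} = ball 0 r \<inter> {z. inner (\<sigma> *\<^sub>R \<i>) z > 0}"
      by (auto simp: inner_complex_def)
    then have "convex {z \<in> ball 0 r. \<sigma> * Im z > 0}"
      by (simp only:) (intro convex_Int convex_ball convex_halfspace_gt)
    then have "connected {z \<in> ball 0 r. \<sigma> * Im z > 0}" by (rule convex_connected)
    moreover have "continuous_on {z \<in> ball 0 r. \<sigma> * Im z > 0} \<psi>"
      using r(2) by (intro continuous_on_subset[OF hom(3)]) auto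
    ultimately show ?thesis unfolding half_def by (intro connected_continuous_image)
  qed
  have half_off: "half \<sigma> \<inter> \<Gamma> = {}" for \<sigma>
  proof (rule ccontr)
    assume "half \<sigma> \<inter> \<Gamma> \<noteq> {}"
    then obtain z where z: "z \<in> ball 0 r" "\<sigma> * Im z > 0" "\<psi> z \<in> \<Gamma>" unfolding half_def by auto
    then have "\<psi> z \<in> path_image e" "\<psi> z \<in> U" using r N(3) by blast+
    then show False using ef(1)[of "\<psi> z"] hom(5)[of z] z r(2) by auto
  qed
  have cover: "x \<in> half 1 \<union> half (-1)" if "x \<in> D" "x \<notin> \<Gamma>" for x
  proof -
    have "x \<notin> path_image e" using that r N(3) unfolding D_def by blast
    then have "Im (\<phi> x) \<noteq> 0" using ef(1) that DU by blast
    then show ?thesis unfolding half_def using D\<phi>[OF that(1)] image_eqI[of x \<psi> "\<phi> x"]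
      by (cases "Im (\<phi> x) > 0") auto
  qed
  have pG: "p \<in> \<Gamma>" using N(2,3) ef(1)[OF U(2)] U(4) by auto
  have "p \<in> closure (inside \<Gamma>)" "p \<in> closure (outside \<Gamma>)"
    using jordan_curve_frontiers[OF J] pG unfolding frontier_def by auto
  then obtain x y where xy: "x \<in> D" "x \<in> inside \<Gamma>" "y \<in> D" "y \<in> outside \<Gamma>"
    using open_Int_closure_eq_empty[OF r(4)] r(5) unfolding D_def by (metis disjoint_iff)
  have xyn: "x \<notin> \<Gamma>" "y \<notin> \<Gamma>" "y \<notin> inside \<Gamma>"
    using xy inside_no_overlap outside_no_overlap inside_Int_outside by blast+
  have same: "u \<in> inside \<Gamma> \<longleftrightarrow> v \<in> inside \<Gamma>" if "u \<in> half \<sigma>" "v \<in> half \<sigma>" "\<sigma> = 1 \<or> \<sigma> = -1" for u v \<sigma>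
    using that by (intro connected_off_curve_one_side[OF half_conn half_off])
  have opposite: "(u \<in> inside \<Gamma>) \<noteq> (v \<in> inside \<Gamma>)" if "u \<in> half 1" "v \<in> half (-1)" for u v
  proof
    assume eq: "(u \<in> inside \<Gamma>) = (v \<in> inside \<Gamma>)"
    have "(w \<in> inside \<Gamma>) = (u \<in> inside \<Gamma>)" if "w \<in> D" "w \<notin> \<Gamma>" for w
      using cover[OF that] same[of w 1 u] same[of w "-1" v] eq \<open>u \<in> half 1\<close> \<open>v \<in> half (-1)\<close> by blast
    then show False using xy xyn by blast
  qed
  have iD: "inj_on Im (\<phi> ` (path_image f \<inter> D))" using ef(4) DU by (auto elim!: inj_on_subset)
  have cD: "continuous_on D \<phi>" "inj_on \<phi> D" "open D" "p \<in> D" using hom(1,2) DU r unfolding D_def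
    by (auto intro: continuous_on_subset inj_on_subset)
  have cIm: "continuous_on UNIV Im" by (intro continuous_intros)
  obtain \<delta> \<sigma> where \<delta>: "\<delta> > 0" "\<sigma> = 1 \<or> \<sigma> = (-1::real)" "{t-\<delta>..t+\<delta>} \<subseteq> {0<..<1}"
    "\<And>s. \<lbrakk>t - \<delta> \<le> s; s \<le> t + \<delta>\<rbrakk> \<Longrightarrow> f s \<in> D"
    "\<And>s. \<lbrakk>t - \<delta> \<le> s; s < t\<rbrakk> \<Longrightarrow> \<sigma> * Im (\<phi> (f s)) < 0"
    "\<And>s. \<lbrakk>t < s; s \<le> t + \<delta>\<rbrakk> \<Longrightarrow> \<sigma> * Im (\<phi> (f s)) > 0"
    by (rule arc_in_chart_changes_sign[of D p \<phi> Im f t]) (use f U(4) iD cD cIm in auto)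
  have mem: "f s \<in> half \<tau>" if "t - \<delta> \<le> s" "s \<le> t + \<delta>" "\<tau> * Im (\<phi> (f s)) > 0" for s \<tau>
    unfolding half_def using that D\<phi>[OF \<delta>(4)[OF that(1,2)]] by (intro image_eqI[of _ _ "\<phi> (f s)"]) auto
  show ?thesis unfolding flips_side_def
  proof (intro exI[of _ \<delta>] conjI allI impI \<delta>(1))
    fix s s' assume "t - \<delta> < s \<and> s < t \<and> t < s' \<and> s' < t + \<delta>"
    then have "f s \<in> half (- \<sigma>)" "f s' \<in> half \<sigma>"
      using \<delta>(5)[of s] \<delta>(6)[of s'] mem[of s "-\<sigma>"] mem[of s' \<sigma>] by auto
    then show "(f s \<in> inside \<Gamma>) \<noteq> (f s' \<in> inside \<Gamma>)" using opposite \<delta>(2) by (metis minus_minus)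
  qed
qed

text \<open>
  Suppose a curve turns at the crossing point from \<open>e\<close> into \<open>f\<close>, using
  only the first parts of both. In the chart it runs along two of the four half-axes, and the other
  two half-axes are joined by the three remaining quadrants. So the continuations of
  \<open>e\<close> and \<open>f\<close> start on the same side.
\<close>

lemma proper_crossing_corner_same_side:
  assumes cr: "properly_cross_at e f p"
    and e: "arc e" "0 < te" "te < 1" "e te = p" and f: "arc f" "0 < tf" "tf < 1" "f tf = p"
    and N: "open N" "p \<in> N" "\<Gamma> \<inter> N \<subseteq> e ` {0..te} \<union> f ` {0..tf}"
  obtains \<delta> where "\<delta> > 0" "te + \<delta> < 1" "tf + \<delta> < 1"
    "e (te + \<delta>) \<in> inside \<Gamma> \<longleftrightarrow> f (tf + \<delta>) \<in> inside \<Gamma>"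
proof -
  obtain U \<phi> \<psi> where ch: "crossing_chart e f p U \<phi> \<psi>" using properly_cross_chartE[OF cr] .
  note U = crossing_chartD(1-4)[OF ch] and hom = crossing_chartD(5-9)[OF ch] and ef = crossing_chartD(10-13)[OF ch]
  have inj01: "inj_on e {0..1}" "inj_on f {0..1}" and cont01: "continuous_on {0..1} e" "continuous_on {0..1} f"
    using e(1) f(1) unfolding arc_def path_def by auto
  have cRe: "continuous_on UNIV Re" and cIm: "continuous_on UNIV Im" by (intro continuous_intros)+
  obtain de \<sigma> where de: "de > 0" "\<sigma> = 1 \<or> \<sigma> = (-1::real)" "{te-de..te+de} \<subseteq> {0<..<1}"
    "\<And>s. \<lbrakk>te - de \<le> s; s \<le> te + de\<rbrakk> \<Longrightarrow> e s \<in> U"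
    "\<And>s. \<lbrakk>te - de \<le> s; s < te\<rbrakk> \<Longrightarrow> \<sigma> * Re (\<phi> (e s)) < 0"
    "\<And>s. \<lbrakk>te < s; s \<le> te + de\<rbrakk> \<Longrightarrow> \<sigma> * Re (\<phi> (e s)) > 0"
    by (rule arc_in_chart_changes_sign[of U p \<phi> Re e te]) (use U hom(1,2) ef(3) e cRe in auto)
  obtain df \<tau> where df: "df > 0" "\<tau> = 1 \<or> \<tau> = (-1::real)" "{tf-df..tf+df} \<subseteq> {0<..<1}"
    "\<And>s. \<lbrakk>tf - df \<le> s; s \<le> tf + df\<rbrakk> \<Longrightarrow> f s \<in> U"
    "\<And>s. \<lbrakk>tf - df \<le> s; s < tf\<rbrakk> \<Longrightarrow> \<tau> * Im (\<phi> (f s)) < 0"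
    "\<And>s. \<lbrakk>tf < s; s \<le> tf + df\<rbrakk> \<Longrightarrow> \<tau> * Im (\<phi> (f s)) > 0"
    by (rule arc_in_chart_changes_sign[of U p \<phi> Im f tf]) (use U hom(1,2) ef(4) f cIm in auto)
  \<comment> \<open>The early parts of both arcs could return close to \<open>p\<close>; a smaller disc avoids them.\<close>
  define far where "far = e ` {0..te-de} \<union> f ` {0..tf-df}"
  have "compact far" unfolding far_def using de(1,3) df(1,3) e f
    by (intro compact_Un compact_continuous_image continuous_on_subset[OF cont01(1)] continuous_on_subset[OF cont01(2)]) auto
  moreover have "p \<notin> far"
  proof
    assume "p \<in> far"
    then consider s where "s \<in> {0..te-de}" "e s = e te" | s where "s \<in> {0..tf-df}" "f s = f tf"
      unfolding far_def using e(4) f(4) by auto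
    then show False
    proof cases
      case 1 then show False using inj_onD[OF inj01(1) 1(2)] e de(1) by auto
    next
      case 2 then show False using inj_onD[OF inj01(2) 2(2)] f df(1) by auto
    qed
  qed
  ultimately have N': "open (N - far)" "p \<in> N - far" using N by (auto intro: open_Diff compact_imp_closed)
  obtain r where r: "0 < r" "r \<le> 1" "\<psi> ` ball 0 r \<subseteq> N - far" "open (\<psi> ` ball 0 r)" "p \<in> \<psi> ` ball 0 r" "\<psi> ` ball 0 r \<subseteq> U"
    using crossing_chart_disc[OF U N'] by metis
  define D where "D = \<psi> ` ball 0 r"
  have D\<phi>: "\<phi> x \<in> ball 0 r" "\<psi> (\<phi> x) = x" if "x \<in> D" for x using that r(2) hom(5) hom(4) r(6) unfolding D_def by auto
  have DU: "D \<subseteq> U" using r unfolding D_def by simp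
  define A where "A = {z \<in> ball 0 r. \<sigma> * Re z > 0}"
  define B where "B = {z \<in> ball 0 r. \<tau> * Im z > 0}"
  have "A = ball 0 r \<inter> {z. inner (of_real \<sigma>) z > 0}" "B = ball 0 r \<inter> {z. inner (\<tau> *\<^sub>R \<i>) z > 0}"
    unfolding A_def B_def by (auto simp: inner_complex_def)
  then have "convex A" "convex B" by (simp_all only:) (intro convex_Int convex_ball convex_halfspace_gt)+
  moreover have "Complex (\<sigma> * (r/3)) (\<tau> * (r/3)) \<in> A \<inter> B"
  proof -
    have "norm (Complex (\<sigma> * (r/3)) (\<tau> * (r/3))) \<le> r/3 + r/3"
      using cmod_le[of "Complex (\<sigma> * (r/3)) (\<tau> * (r/3))"] de(2) df(2) r(1) by auto
    also have "\<dots> < r" using r(1) by simp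
    finally show ?thesis using de(2) df(2) r unfolding A_def B_def by auto
  qed
  ultimately have "connected (A \<union> B)" by (intro connected_Un convex_connected) auto
  moreover have "continuous_on (A \<union> B) \<psi>"
    using r(2) unfolding A_def B_def by (intro continuous_on_subset[OF hom(3)]) auto
  ultimately have conn: "connected (\<psi> ` (A \<union> B))" by (rule connected_continuous_image[rotated])
  have off: "\<psi> ` (A \<union> B) \<inter> \<Gamma> = {}"
  proof (rule ccontr)
    assume "\<psi> ` (A \<union> B) \<inter> \<Gamma> \<noteq> {}"
    then obtain z where z: "z \<in> A \<union> B" "\<psi> z \<in> \<Gamma>" by auto
    then have zb: "z \<in> ball 0 r" "z \<in> ball 0 1" using r(2) unfolding A_def B_def by auto
    then have "\<psi> z \<in> N - far" "\<psi> z \<in> U" using r by blast+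
    then consider s where "s \<in> {0..te}" "\<psi> z = e s" | s where "s \<in> {0..tf}" "\<psi> z = f s"
      using N(3) z(2) by blast
    then show False
    proof cases
      case 1
      have "\<not> s \<le> te - de" using 1 \<open>\<psi> z \<in> N - far\<close> unfolding far_def by auto
      then have "\<sigma> * Re z \<le> 0" using de(5)[of s] hom(5)[OF zb(2)] 1 U(4) e(4) by (cases "s = te") auto
      moreover have "Im z = 0" using ef(1)[OF \<open>\<psi> z \<in> U\<close>] hom(5)[OF zb(2)] 1 e(2,3) unfolding path_image_def by auto
      ultimately show False using z(1) unfolding A_def B_def by auto
    next
      case 2
      have "\<not> s \<le> tf - df" using 2 \<open>\<psi> z \<in> N - far\<close> unfolding far_def by auto
      then have "\<tau> * Im z \<le> 0" using df(5)[of s] hom(5)[OF zb(2)] 2 U(4) f(4) by (cases "s = tf") auto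
      moreover have "Re z = 0" using ef(2)[OF \<open>\<psi> z \<in> U\<close>] hom(5)[OF zb(2)] 2 f(2,3) unfolding path_image_def by auto
      ultimately show False using z(1) unfolding A_def B_def by auto
    qed
  qed
  have inj: "inj_on Re (\<phi> ` (path_image e \<inter> D))" "inj_on Im (\<phi> ` (path_image f \<inter> D))"
    using ef(3,4) DU by (auto elim!: inj_on_subset)
  have D: "continuous_on D \<phi>" "inj_on \<phi> D" "open D" "p \<in> D" using hom(1,2) DU r unfolding D_def
    by (auto intro: continuous_on_subset inj_on_subset)
  obtain ge where ge: "ge > 0" "\<And>s. \<lbrakk>te - ge \<le> s; s \<le> te + ge\<rbrakk> \<Longrightarrow> e s \<in> D"
    by (rule arc_in_chart_changes_sign[of D p \<phi> Re e te]) (use inj(1) D U(4) e cRe in auto)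
  obtain gf where gf: "gf > 0" "\<And>s. \<lbrakk>tf - gf \<le> s; s \<le> tf + gf\<rbrakk> \<Longrightarrow> f s \<in> D"
    by (rule arc_in_chart_changes_sign[of D p \<phi> Im f tf]) (use inj(2) D U(4) f cIm in auto)
  define \<delta> where "\<delta> = min (min ge gf) (min de df)"
  have d: "\<delta> > 0" "\<delta> \<le> ge" "\<delta> \<le> gf" "\<delta> \<le> de" "\<delta> \<le> df" unfolding \<delta>_def using ge gf de df by auto
  have "e (te + \<delta>) \<in> \<psi> ` (A \<union> B)"
    using D\<phi>[OF ge(2)[of "te+\<delta>"]] de(6)[of "te + \<delta>"] d unfolding A_def
    by (intro image_eqI[of _ _ "\<phi> (e (te+\<delta>))"]) auto
  moreover have "f (tf + \<delta>) \<in> \<psi> ` (A \<union> B)"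
    using D\<phi>[OF gf(2)[of "tf+\<delta>"]] df(6)[of "tf + \<delta>"] d unfolding B_def
    by (intro image_eqI[of _ _ "\<phi> (f (tf+\<delta>))"]) auto
  ultimately have "e (te + \<delta>) \<in> inside \<Gamma> \<longleftrightarrow> f (tf + \<delta>) \<in> inside \<Gamma>"
    using connected_off_curve_one_side[OF conn off] by blast
  moreover have "te + \<delta> \<in> {te-de..te+de}" "tf + \<delta> \<in> {tf-df..tf+df}" using d by auto
  then have "te + \<delta> \<in> {0<..<1}" "tf + \<delta> \<in> {0<..<1}" using de(3) df(3) by blast+
  ultimately show thesis using that[OF d(1)] by auto
qed

section \<open>Cyclic order of arcs and sides of curves at a point\<close>

lemma jordan_curve_of_three_arcs:
  fixes f g h :: "real \<Rightarrow> complex"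
  assumes "arc f" "arc g" "arc h"
    and "pathfinish f = pathstart g" "pathfinish g = pathstart h" "pathfinish h = pathstart f"
    and "path_image f \<inter> path_image g \<subseteq> {pathfinish f}" "path_image g \<inter> path_image h \<subseteq> {pathfinish g}"
      "path_image h \<inter> path_image f \<subseteq> {pathfinish h}"
  shows "jordan_curve (path_image f \<union> path_image g \<union> path_image h)"
proof -
  have fg: "arc (f +++ g)" using assms by (intro arc_join) auto
  have im: "path_image (f +++ g) = path_image f \<union> path_image g" using assms by (simp add: path_image_join)
  have "simple_path ((f +++ g) +++ h)"
    using fg assms im by (intro simple_path_join_loop) auto
  moreover have "pathfinish ((f +++ g) +++ h) = pathstart ((f +++ g) +++ h)" using assms by simp
  moreover have "path_image ((f +++ g) +++ h) = path_image f \<union> path_image g \<union> path_image h"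
    using assms im by (simp add: path_image_join)
  ultimately show ?thesis unfolding jordan_curve_def by blast
qed

text \<open>
  Two closed curves that share the set \<open>A\<close> through \<open>c\<close> and are closed up
  far from \<open>c\<close> by different connected sets have the same local sides at
  \<open>c\<close>. Janiszewski's theorem applies to \<open>A \<union> C1\<close> and \<open>C1
  \<union> C2\<close>, which meet in the connected set \<open>C1\<close>: points near
  \<open>c\<close> are not separated by \<open>C1 \<union> C2\<close>, since a small disc misses it.
\<close>

lemma same_side_transfer_near_point:
  fixes c :: complex
  assumes "compact A" "compact C1" "compact C2" "connected C1" "connected C2"
    and "A \<inter> C1 = D" "A \<inter> C2 = D" "D \<noteq> {}" "c \<notin> C1" "c \<notin> C2"
  obtains \<eta> where "\<eta> > 0" "\<And>x y. \<lbrakk>x \<in> ball c \<eta>; y \<in> ball c \<eta>; connected_component (- (A \<union> C1)) x y\<rbrakk>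
     \<Longrightarrow> connected_component (- (A \<union> C2)) x y"
proof -
  have cl: "closed (C1 \<union> C2)" using assms by (intro closed_Un compact_imp_closed) auto
  then have "open (- (C1 \<union> C2))" by (rule open_Compl)
  then obtain \<eta> where eta: "\<eta> > 0" "ball c \<eta> \<subseteq> - (C1 \<union> C2)"
    using assms(9,10) by (metis ComplI UnE open_contains_ball)
  show thesis
  proof (rule that[OF eta(1)])
    fix x y assume xy: "x \<in> ball c \<eta>" "y \<in> ball c \<eta>" "connected_component (- (A \<union> C1)) x y"
    have "(A \<union> C1) \<inter> (C1 \<union> C2) = C1" using assms(6,7) by blast
    moreover have "connected_component (- (C1 \<union> C2)) x y"
      unfolding connected_component_def using eta(2) xy(1,2) by (metis connected_ball)
    ultimately have "connected_component (- ((A \<union> C1) \<union> (C1 \<union> C2))) x y"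
      using Janiszewski[of "A \<union> C1" "C1 \<union> C2" x y] assms xy(3) cl by (auto intro: compact_Un)
    then show "connected_component (- (A \<union> C2)) x y"
      by (rule connected_component_of_subset) auto
  qed
qed

definition exit_time :: "complex \<Rightarrow> real \<Rightarrow> (real \<Rightarrow> complex) \<Rightarrow> real" where
  "exit_time c \<epsilon> f = (SOME t. 0 < t \<and> t \<le> 1 \<and> dist c (f t) = \<epsilon> \<and> (\<forall>s. 0 \<le> s \<and> s < t \<longrightarrow> dist c (f s) < \<epsilon>))"

lemma exit_time:
  assumes "path f" "pathstart f = c" "\<epsilon> > 0" "dist c (pathfinish f) > \<epsilon>"
  shows "0 < exit_time c \<epsilon> f" "exit_time c \<epsilon> f < 1" "dist c (f (exit_time c \<epsilon> f)) = \<epsilon>"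
    "\<And>s. \<lbrakk>0 \<le> s; s < exit_time c \<epsilon> f\<rbrakk> \<Longrightarrow> dist c (f s) < \<epsilon>"
proof -
  have cf: "continuous_on {0..1} f" using assms(1) unfolding path_def .
  have f0: "f 0 = c" and f1: "dist c (f 1) > \<epsilon>" using assms unfolding pathstart_def pathfinish_def by auto
  define K where "K = {t \<in> {0..1}. dist c (f t) \<ge> \<epsilon>}"
  have "closed K" unfolding K_def
    by (intro continuous_on_closed_Collect_le closed_atLeastAtMost continuous_intros cf)
  then have cK: "compact K" using compact_Int_closed[of "{0..1}" K] unfolding K_def
    by (metis (no_types, lifting) compact_Icc inf.absorb_iff2 mem_Collect_eq subsetI)
  have "1 \<in> K" using f1 unfolding K_def by auto
  then obtain t where t: "t \<in> K" "\<And>s. s \<in> K \<Longrightarrow> t \<le> s" using cK compact_attains_inf by (metis empty_iff)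
  have t01: "0 \<le> t" "t \<le> 1" "dist c (f t) \<ge> \<epsilon>" using t(1) unfolding K_def by auto
  have lt: "dist c (f s) < \<epsilon>" if "0 \<le> s" "s < t" for s
    using t(2)[of s] that t01 unfolding K_def by force
  have "t \<noteq> 0" using t01(3) f0 assms(3) by auto
  have "dist c (f t) = \<epsilon>"
  proof (rule ccontr)
    assume "dist c (f t) \<noteq> \<epsilon>"
    then have "dist c (f t) > \<epsilon>" using t01 by simp
    moreover have "continuous_on {0..t} (\<lambda>s. dist c (f s))"
      using t01 by (intro continuous_intros continuous_on_subset[OF cf]) auto
    ultimately obtain s where "0 \<le> s" "s \<le> t" "dist c (f s) = \<epsilon>"
      using IVT'[of "\<lambda>s. dist c (f s)" 0 \<epsilon> t] f0 assms(3) t01 by auto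
    then show False using lt[of s] \<open>dist c (f t) > \<epsilon>\<close> by (cases "s = t") auto
  qed
  then have ex: "\<exists>t. 0 < t \<and> t \<le> 1 \<and> dist c (f t) = \<epsilon> \<and> (\<forall>s. 0 \<le> s \<and> s < t \<longrightarrow> dist c (f s) < \<epsilon>)"
    using t01 \<open>t \<noteq> 0\<close> lt by (intro exI[of _ t]) auto
  have *: "0 < exit_time c \<epsilon> f \<and> exit_time c \<epsilon> f \<le> 1 \<and> dist c (f (exit_time c \<epsilon> f)) = \<epsilon>
     \<and> (\<forall>s. 0 \<le> s \<and> s < exit_time c \<epsilon> f \<longrightarrow> dist c (f s) < \<epsilon>)"
    unfolding exit_time_def by (rule someI_ex[OF ex])
  then show "0 < exit_time c \<epsilon> f" "dist c (f (exit_time c \<epsilon> f)) = \<epsilon>"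
    "\<And>s. \<lbrakk>0 \<le> s; s < exit_time c \<epsilon> f\<rbrakk> \<Longrightarrow> dist c (f s) < \<epsilon>" by auto
  have "exit_time c \<epsilon> f \<noteq> 1" using * f1 by auto
  then show "exit_time c \<epsilon> f < 1" using * by simp
qed

text \<open>
  The initial piece of an arc, up to its first exit from the disc of radius
  \<open>\<epsilon>\<close>. The arc may come back into the disc later, which is why the cyclic
  order at \<open>c\<close> is read off from first exits and sides are only compared near
  \<open>c\<close>.
\<close>

definition germ :: "complex \<Rightarrow> real \<Rightarrow> (real \<Rightarrow> complex) \<Rightarrow> complex set" where
  "germ c \<epsilon> f = f ` {0..exit_time c \<epsilon> f}"

definition exit_angle :: "complex \<Rightarrow> real \<Rightarrow> (real \<Rightarrow> complex) \<Rightarrow> real" where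
  "exit_angle c \<epsilon> f = Arg (f (exit_time c \<epsilon> f) - c)"

definition circle_point :: "complex \<Rightarrow> real \<Rightarrow> real \<Rightarrow> complex" where
  "circle_point c \<epsilon> \<phi> = c + rcis \<epsilon> \<phi>"

lemma circle_point_eq_iff:
  assumes "\<epsilon> > 0" "- pi < \<phi>" "\<phi> \<le> pi" "- pi < \<phi>'" "\<phi>' \<le> pi"
  shows "circle_point c \<epsilon> \<phi> = circle_point c \<epsilon> \<phi>' \<longleftrightarrow> \<phi> = \<phi>'"
proof
  assume "circle_point c \<epsilon> \<phi> = circle_point c \<epsilon> \<phi>'"
  then have "rcis \<epsilon> \<phi> = rcis \<epsilon> \<phi>'" unfolding circle_point_def by simp
  then have "Arg (rcis \<epsilon> \<phi>) = Arg (rcis \<epsilon> \<phi>')" by simp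
  then show "\<phi> = \<phi>'" using assms by (simp add: Arg_rcis)
qed simp

lemma continuous_circle_point: "continuous_on S (circle_point c \<epsilon>)"
  unfolding circle_point_def rcis_def by (intro continuous_intros)

lemma circle_point_pi: "circle_point c \<epsilon> (- pi) = circle_point c \<epsilon> pi"
  unfolding circle_point_def rcis_def by (simp add: cis.ctr complex_eq_iff)

lemma dist_circle_point: "\<epsilon> > 0 \<Longrightarrow> dist c (circle_point c \<epsilon> \<phi>) = \<epsilon>"
  unfolding circle_point_def by (simp add: dist_norm)

lemma sphere_eq_circle_points:
  assumes "\<epsilon> > 0"
  shows "sphere c \<epsilon> = circle_point c \<epsilon> ` {- pi..pi}"
proof
  show "sphere c \<epsilon> \<subseteq> circle_point c \<epsilon> ` {- pi..pi}"
  proof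
    fix z assume "z \<in> sphere c \<epsilon>"
    then have "z = circle_point c \<epsilon> (Arg (z - c))"
      unfolding circle_point_def using rcis_cmod_Arg[of "z - c"] by (simp add: dist_norm norm_minus_commute)
    moreover have "Arg (z - c) \<in> {- pi..pi}" using Arg_bounded[of "z - c"] by auto
    ultimately show "z \<in> circle_point c \<epsilon> ` {- pi..pi}" by blast
  qed
qed (use assms in \<open>auto simp: dist_circle_point\<close>)

definition star_of_arcs :: "complex \<Rightarrow> real \<Rightarrow> (real \<Rightarrow> complex) set \<Rightarrow> bool" where
  "star_of_arcs c \<epsilon> F \<longleftrightarrow> \<epsilon> > 0 \<and>
     (\<forall>f\<in>F. arc f \<and> pathstart f = c \<and> dist c (pathfinish f) > \<epsilon>) \<and>
     (\<forall>f\<in>F. \<forall>g\<in>F. f \<noteq> g \<longrightarrow> path_image f \<inter> path_image g = {c})"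

definition exit_point :: "complex \<Rightarrow> real \<Rightarrow> (real \<Rightarrow> complex) \<Rightarrow> complex" where
  "exit_point c \<epsilon> f = f (exit_time c \<epsilon> f)"

lemma star_arcD:
  assumes "star_of_arcs c \<epsilon> F" "f \<in> F"
  shows "\<epsilon> > 0" "arc f" "continuous_on {0..1} f" "inj_on f {0..1}" "f 0 = c"
    "0 < exit_time c \<epsilon> f" "exit_time c \<epsilon> f < 1" "dist c (exit_point c \<epsilon> f) = \<epsilon>"
    "\<lbrakk>0 \<le> s; s < exit_time c \<epsilon> f\<rbrakk> \<Longrightarrow> dist c (f s) < \<epsilon>"
    "\<lbrakk>0 < s; s \<le> 1\<rbrakk> \<Longrightarrow> f s \<noteq> c"
proof -
  have *: "\<epsilon> > 0" "arc f" and st: "pathstart f = c" and fin: "dist c (pathfinish f) > \<epsilon>"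
    using assms unfolding star_of_arcs_def by auto
  then show "\<epsilon> > 0" "arc f" by auto
  show "continuous_on {0..1} f" and inj: "inj_on f {0..1}" using *(2) unfolding arc_def path_def by auto
  show f0: "f 0 = c" using st unfolding pathstart_def .
  have "path f" using * by (simp add: arc_imp_path)
  note e = exit_time[OF this st *(1) fin]
  show "0 < exit_time c \<epsilon> f" "exit_time c \<epsilon> f < 1" "dist c (exit_point c \<epsilon> f) = \<epsilon>"
    "\<lbrakk>0 \<le> s; s < exit_time c \<epsilon> f\<rbrakk> \<Longrightarrow> dist c (f s) < \<epsilon>"
    using e unfolding exit_point_def by auto
  show "f s \<noteq> c" if "0 < s" "s \<le> 1" using inj_onD[OF inj, of s 0] that f0 by auto
qed

lemma exit_point_eq_circle_point:
  assumes "star_of_arcs c \<epsilon> F" "f \<in> F"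
  shows "exit_point c \<epsilon> f = circle_point c \<epsilon> (exit_angle c \<epsilon> f)"
    "- pi < exit_angle c \<epsilon> f" "exit_angle c \<epsilon> f \<le> pi"
  using star_arcD(8)[OF assms] Arg_bounded[of "exit_point c \<epsilon> f - c"] rcis_cmod_Arg[of "exit_point c \<epsilon> f - c"]
  unfolding circle_point_def exit_angle_def exit_point_def by (auto simp: dist_norm norm_minus_commute)

lemma distinct_exits:
  assumes "star_of_arcs c \<epsilon> F" "f \<in> F" "g \<in> F" "f \<noteq> g"
  shows "exit_point c \<epsilon> f \<noteq> exit_point c \<epsilon> g" "exit_angle c \<epsilon> f \<noteq> exit_angle c \<epsilon> g"
proof -
  note f = star_arcD[OF assms(1,2)] and g = star_arcD[OF assms(1,3)]
  show "exit_point c \<epsilon> f \<noteq> exit_point c \<epsilon> g"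
  proof
    assume eq: "exit_point c \<epsilon> f = exit_point c \<epsilon> g"
    have "exit_point c \<epsilon> f \<in> path_image f" "exit_point c \<epsilon> g \<in> path_image g"
      using f(6,7) g(6,7) unfolding exit_point_def path_image_def by auto
    then have "exit_point c \<epsilon> f = c" using assms eq unfolding star_of_arcs_def by auto
    then show False using f(1,8) by simp
  qed
  then show "exit_angle c \<epsilon> f \<noteq> exit_angle c \<epsilon> g"
    using exit_point_eq_circle_point(1)[OF assms(1,2)] exit_point_eq_circle_point(1)[OF assms(1,3)] by auto
qed

lemma germ_props:
  assumes "star_of_arcs c \<epsilon> F" "f \<in> F"
  shows "compact (germ c \<epsilon> f)" "connected (germ c \<epsilon> f)" "c \<in> germ c \<epsilon> f" "germ c \<epsilon> f \<subseteq> cball c \<epsilon>"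
    "germ c \<epsilon> f \<inter> sphere c \<epsilon> = {exit_point c \<epsilon> f}" "connected (germ c \<epsilon> f - {c})"
    "germ c \<epsilon> f \<subseteq> path_image f" "exit_point c \<epsilon> f \<in> germ c \<epsilon> f - {c}"
    "germ c \<epsilon> f - {c} = f ` {0<..exit_time c \<epsilon> f}"
    "exit_time c \<epsilon> f \<le> s \<Longrightarrow> s \<le> 1 \<Longrightarrow> f ` {exit_time c \<epsilon> f..s} \<inter> germ c \<epsilon> f = {exit_point c \<epsilon> f}"
proof -
  note f = star_arcD[OF assms]
  have sub: "continuous_on {0..exit_time c \<epsilon> f} f" using f(6,7) by (intro continuous_on_subset[OF f(3)]) auto
  show "compact (germ c \<epsilon> f)" "connected (germ c \<epsilon> f)" unfolding germ_def using sub
    by (auto intro: compact_continuous_image connected_continuous_image)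
  show "c \<in> germ c \<epsilon> f" unfolding germ_def using f(5,6) by force
  have le: "dist c (f s) \<le> \<epsilon>" if "0 \<le> s" "s \<le> exit_time c \<epsilon> f" for s
    using f(8) f(9)[of s] that unfolding exit_point_def by (cases "s = exit_time c \<epsilon> f") auto
  then show "germ c \<epsilon> f \<subseteq> cball c \<epsilon>" unfolding germ_def by auto
  show "germ c \<epsilon> f \<inter> sphere c \<epsilon> = {exit_point c \<epsilon> f}"
  proof
    show "germ c \<epsilon> f \<inter> sphere c \<epsilon> \<subseteq> {exit_point c \<epsilon> f}"
    proof
      fix z assume "z \<in> germ c \<epsilon> f \<inter> sphere c \<epsilon>"
      then obtain s where s: "0 \<le> s" "s \<le> exit_time c \<epsilon> f" "z = f s" "dist c (f s) = \<epsilon>" unfolding germ_def by auto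
      then have "s = exit_time c \<epsilon> f" using f(9)[of s] by fastforce
      then show "z \<in> {exit_point c \<epsilon> f}" using s unfolding exit_point_def by simp
    qed
    show "{exit_point c \<epsilon> f} \<subseteq> germ c \<epsilon> f \<inter> sphere c \<epsilon>" using f(6,8) unfolding germ_def exit_point_def by auto
  qed
  show eq: "germ c \<epsilon> f - {c} = f ` {0<..exit_time c \<epsilon> f}"
  proof
    show "germ c \<epsilon> f - {c} \<subseteq> f ` {0<..exit_time c \<epsilon> f}"
    proof
      fix z assume "z \<in> germ c \<epsilon> f - {c}"
      then obtain s where s: "0 \<le> s" "s \<le> exit_time c \<epsilon> f" "z = f s" "z \<noteq> c" unfolding germ_def by auto
      then have "s \<noteq> 0" using f(5) by auto
      then show "z \<in> f ` {0<..exit_time c \<epsilon> f}" using s by auto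
    qed
    show "f ` {0<..exit_time c \<epsilon> f} \<subseteq> germ c \<epsilon> f - {c}"
      unfolding germ_def using f(7,10) by force
  qed
  show "connected (germ c \<epsilon> f - {c})" unfolding eq
    by (intro connected_continuous_image continuous_on_subset[OF sub]) auto
  show "germ c \<epsilon> f \<subseteq> path_image f" unfolding germ_def path_image_def using f(7) by auto
  show "exit_point c \<epsilon> f \<in> germ c \<epsilon> f - {c}" unfolding eq exit_point_def using f(6) by auto
  show "f ` {exit_time c \<epsilon> f..s} \<inter> germ c \<epsilon> f = {exit_point c \<epsilon> f}" if "exit_time c \<epsilon> f \<le> s" "s \<le> 1"
  proof
    show "f ` {exit_time c \<epsilon> f..s} \<inter> germ c \<epsilon> f \<subseteq> {exit_point c \<epsilon> f}"
    proof
      fix z assume "z \<in> f ` {exit_time c \<epsilon> f..s} \<inter> germ c \<epsilon> f"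
      then obtain u v where u: "exit_time c \<epsilon> f \<le> u" "u \<le> s" "z = f u" 
        and v: "0 \<le> v" "v \<le> exit_time c \<epsilon> f" "z = f v" unfolding germ_def by auto
      then have "u = v" using inj_onD[OF f(4), of u v] that f(6,7) by auto
      then have "u = exit_time c \<epsilon> f" using u v by simp
      then show "z \<in> {exit_point c \<epsilon> f}" using u unfolding exit_point_def by simp
    qed
    show "{exit_point c \<epsilon> f} \<subseteq> f ` {exit_time c \<epsilon> f..s} \<inter> germ c \<epsilon> f"
      using that f(6) unfolding germ_def exit_point_def by auto
  qed
qed

text \<open>
  If \<open>x\<close> and \<open>y\<close> differ from \<open>a\<close> and \<open>b\<close>, this
  says that exactly one of them lies between \<open>a\<close> and \<open>b\<close>, in other words
  that the pair \<open>a b\<close> separates \<open>x\<close> from \<open>y\<close> on a circle.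
\<close>

definition separated :: "real \<Rightarrow> real \<Rightarrow> real \<Rightarrow> real \<Rightarrow> bool" where
  "separated a b x y \<longleftrightarrow> ((a < x) = (b < x)) \<noteq> ((a < y) = (b < y))"

lemma connected_componentI:
  "\<lbrakk>connected T; T \<inter> S = {}; x \<in> T; y \<in> T\<rbrakk> \<Longrightarrow> connected_component (- S) x y"
  unfolding connected_component_def by blast

text \<open>
  Sides of a closed curve at a vertex are determined by the cyclic order of the first exits. The
  curve runs through \<open>c\<close> along \<open>fi\<close> and \<open>fj\<close> and is closed up
  by \<open>M\<close> away from \<open>c\<close>. By the transfer lemma it may be closed up by an
  arc of the circle instead, and then the position of the exit of another arc on the circle tells
  its side.
\<close>

lemma germs_same_side_iff:
  assumes S: "star_of_arcs c \<epsilon> F" and F: "fi \<in> F" "fj \<in> F" "fk \<in> F" "fl \<in> F"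
    and d: "fi \<noteq> fj" "fk \<noteq> fi" "fk \<noteq> fj" "fl \<noteq> fi" "fl \<noteq> fj"
    and M: "compact M" "connected M" "M \<inter> cball c \<epsilon> = {}"
    and s: "fi s \<in> M" "0 \<le> s" "s \<le> 1" and s': "fj s' \<in> M" "0 \<le> s'" "s' \<le> 1"
    and \<Gamma>: "\<Gamma> = fi ` {0..s} \<union> M \<union> fj ` {0..s'}"
    and x: "x \<in> germ c \<epsilon> fk - {c}" and y: "y \<in> germ c \<epsilon> fl - {c}"
  shows "connected_component (- \<Gamma>) x y \<longleftrightarrow>
    \<not> separated (exit_angle c \<epsilon> fi) (exit_angle c \<epsilon> fj) (exit_angle c \<epsilon> fk) (exit_angle c \<epsilon> fl)"
proof -
  let ?g = "germ c \<epsilon>" and ?t = "exit_time c \<epsilon>" and ?P = "exit_point c \<epsilon>" and ?\<theta> = "exit_angle c \<epsilon>"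
  note ai = star_arcD[OF S F(1)] and aj = star_arcD[OF S F(2)] and ak = star_arcD[OF S F(3)] and al = star_arcD[OF S F(4)]
  note gi = germ_props[OF S F(1)] and gj = germ_props[OF S F(2)] and gk = germ_props[OF S F(3)] and gl = germ_props[OF S F(4)]
  have pi: "path_image f \<inter> path_image g = {c}" if "f \<in> F" "g \<in> F" "f \<noteq> g" for f g
    using S that unfolding star_of_arcs_def by auto
  have eps: "\<epsilon> > 0" using ai by simp
  have ts: "?t fi < s" "?t fj < s'"
  proof -
    have "fi s \<notin> ?g fi" "fj s' \<notin> ?g fj" using s s' M(3) gi(4) gj(4) by blast+
    then show "?t fi < s" "?t fj < s'" using s s' unfolding germ_def by (metis atLeastAtMost_iff imageI not_le)+
  qed
  define A where "A = ?g fi \<union> ?g fj"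
  define C where "C = fi ` {?t fi..s} \<union> M \<union> fj ` {?t fj..s'}"
  have cA: "compact A" "connected A" "c \<in> A" unfolding A_def using gi gj by (auto intro!: compact_Un connected_Un)
  have ci: "compact (fi ` {?t fi..s})" "connected (fi ` {?t fi..s})" "compact (fj ` {?t fj..s'})" "connected (fj ` {?t fj..s'})"
    using ai(3,6) aj(3,6) s s' by (auto intro!: compact_continuous_image connected_continuous_image elim: continuous_on_subset)
  have cC: "compact C" "connected C"
  proof -
    show "compact C" unfolding C_def using ci M by (intro compact_Un)
    have "fi s \<in> fi ` {?t fi..s} \<inter> M" "fj s' \<in> M \<inter> fj ` {?t fj..s'}" using ts s s' by auto
    then show "connected C" unfolding C_def using ci M by (intro connected_Un) auto
  qed
  have subi: "fi ` {?t fi..s} \<subseteq> path_image fi" "fj ` {?t fj..s'} \<subseteq> path_image fj"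
    using ai(6) aj(6) s s' unfolding path_image_def by auto
  have \<Gamma>AC: "\<Gamma> = A \<union> C"
  proof -
    have "fi ` {0..s} = ?g fi \<union> fi ` {?t fi..s}" "fj ` {0..s'} = ?g fj \<union> fj ` {?t fj..s'}"
      unfolding germ_def image_Un[symmetric] using ts ai(6) aj(6) by (simp_all add: ivl_disj_un_two_touch)
    then show ?thesis unfolding \<Gamma> A_def C_def by blast
  qed
  have cnot: "c \<notin> fi ` {?t fi..s}" "c \<notin> fj ` {?t fj..s'}" "c \<notin> M"
  proof -
    have "fi u \<noteq> c" if "u \<in> {?t fi..s}" for u using ai(10)[of u] ai(6) that s by auto
    then show "c \<notin> fi ` {?t fi..s}" by blast
    have "fj u \<noteq> c" if "u \<in> {?t fj..s'}" for u using aj(10)[of u] aj(6) that s' by auto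
    then show "c \<notin> fj ` {?t fj..s'}" by blast
    show "c \<notin> M" using M(3) eps by force
  qed
  have cC': "c \<notin> C" unfolding C_def using cnot by auto
  have AC: "A \<inter> C = {?P fi, ?P fj}"
  proof -
    have ij: "z = c" if "z \<in> path_image fi" "z \<in> path_image fj" for z using pi[OF F(1,2) d(1)] that by blast
    have "fi ` {?t fi..s} \<inter> ?g fj = {}" using ij subi(1) gj(7) cnot(1) by (metis disjoint_iff subsetD)
    moreover have "fj ` {?t fj..s'} \<inter> ?g fi = {}" using ij subi(2) gi(7) cnot(2) by (metis disjoint_iff subsetD)
    moreover have "M \<inter> ?g fi = {}" "M \<inter> ?g fj = {}" using M(3) gi(4) gj(4) by blast+
    moreover have "fi ` {?t fi..s} \<inter> ?g fi = {?P fi}" "fj ` {?t fj..s'} \<inter> ?g fj = {?P fj}"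
      using gi(10)[of s] gj(10)[of s'] ts s s' by auto
    ultimately show ?thesis unfolding A_def C_def by blast
  qed
  have offA: "(?g f - {c}) \<inter> A = {}" "(?g f - {c}) \<inter> C = {}" if "f \<in> F" "f \<noteq> fi" "f \<noteq> fj" for f
  proof -
    note gf = germ_props[OF S that(1)]
    have i: "z \<notin> path_image fi" if "z \<in> path_image f" "z \<noteq> c" for z using pi[OF \<open>f \<in> F\<close> F(1) \<open>f \<noteq> fi\<close>] that by blast
    have j: "z \<notin> path_image fj" if "z \<in> path_image f" "z \<noteq> c" for z using pi[OF \<open>f \<in> F\<close> F(2) \<open>f \<noteq> fj\<close>] that by blast
    have "z \<notin> A" if "z \<in> ?g f - {c}" for z
      using i[of z] j[of z] that subsetD[OF gf(7), of z] subsetD[OF gi(7), of z] subsetD[OF gj(7), of z] unfolding A_def by auto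
    then show "(?g f - {c}) \<inter> A = {}" by auto
    have "z \<notin> C" if "z \<in> ?g f - {c}" for z
    proof -
      have "z \<notin> M" using that subsetD[OF gf(4), of z] M(3) by auto
      then show ?thesis
        using i[of z] j[of z] that subsetD[OF gf(7), of z] subsetD[OF subi(1), of z] subsetD[OF subi(2), of z] unfolding C_def by auto
    qed
    then show "(?g f - {c}) \<inter> C = {}" by auto
  qed
  define circ where "circ = circle_point c \<epsilon>"
  have P: "?P f = circ (?\<theta> f)" "- pi < ?\<theta> f" "?\<theta> f \<le> pi" if "f \<in> F" for f
    using exit_point_eq_circle_point[OF S that] unfolding circ_def by auto
  have Psph: "?P f \<in> sphere c \<epsilon>" if "f \<in> F" for f using star_arcD(8)[OF S that] by simp
  have Asph: "A \<inter> sphere c \<epsilon> = {?P fi, ?P fj}" unfolding A_def using gi(5) gj(5) by blast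
  have near: "\<exists>z\<in>?g f - {c}. z \<in> ball c \<eta> \<and> z \<in> ball c \<epsilon>" if "f \<in> F" "\<eta> > 0" for f \<eta>
  proof -
    note af = star_arcD[OF S that(1)]
    have "continuous (at 0 within {0..1}) f" using af(3) by (simp add: continuous_on_eq_continuous_within)
    then obtain r where r: "r > 0" "\<And>u. \<lbrakk>u \<in> {0..1}; dist u 0 < r\<rbrakk> \<Longrightarrow> dist (f u) (f 0) < \<eta>"
      unfolding continuous_within_eps_delta using \<open>\<eta> > 0\<close> by blast
    define u where "u = min (r/2) (?t f / 2)"
    have u: "0 < u" "u < r" "u < ?t f" "u \<le> 1" unfolding u_def using r af(6,7) by auto
    have "f u \<in> ?g f - {c}" unfolding germ_props(9)[OF S that(1)] using u by auto
    moreover have "f u \<in> ball c \<eta>" using r(2)[of u] u af(5) by (auto simp: dist_commute)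
    moreover have "f u \<in> ball c \<epsilon>" using af(9)[of u] u by auto
    ultimately show ?thesis by blast
  qed
  have comp_germ: "connected_component (- T) u v" if "f \<in> F" "u \<in> ?g f - {c}" "v \<in> ?g f - {c}" "(?g f - {c}) \<inter> T = {}" for f u v T
    by (rule connected_componentI[of "?g f - {c}"]) (use germ_props(6)[OF S that(1)] that in auto)
  have off: "(?g f - {c}) \<inter> (A \<union> T) = {}" if "f \<in> F" "f \<noteq> fi" "f \<noteq> fj" "?P f \<notin> T" "T \<subseteq> sphere c \<epsilon>" for f T
  proof -
    have "z \<notin> T" if z: "z \<in> ?g f - {c}" for z
    proof
      assume "z \<in> T"
      then have "z \<in> ?g f \<inter> sphere c \<epsilon>" using z \<open>T \<subseteq> sphere c \<epsilon>\<close> by blast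
      then have "z = ?P f" using germ_props(5)[OF S \<open>f \<in> F\<close>] by simp
      then show False using \<open>z \<in> T\<close> \<open>?P f \<notin> T\<close> by simp
    qed
    then show ?thesis using offA(1)[OF that(1-3)] by blast
  qed
  have meet: "A \<inter> T = {?P fi, ?P fj}" if "T \<subseteq> sphere c \<epsilon>" "?P fi \<in> T" "?P fj \<in> T" for T
  proof -
    have "A \<inter> T = (A \<inter> sphere c \<epsilon>) \<inter> T" using that(1) by auto
    then show ?thesis unfolding Asph using that by auto
  qed
  have off\<Gamma>: "(?g f - {c}) \<inter> \<Gamma> = {}" if "f \<in> F" "f \<noteq> fi" "f \<noteq> fj" for f
    unfolding \<Gamma>AC Int_Un_distrib offA[OF that] by simp
  \<comment> \<open>Near \<open>c\<close> the curve \<open>\<Gamma>\<close> may be replaced by \<open>A\<close> closed up with an arc \<open>B\<close> of the circle. Two exits on the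
    complementary arc \<open>B'\<close> can then be joined along \<open>B'\<close>.\<close>
  have same_if_not_cut: "connected_component (- \<Gamma>) x y"
    if B: "compact B" "connected B" "B \<subseteq> sphere c \<epsilon>" "?P fi \<in> B" "?P fj \<in> B"
      and B': "connected B'" "B' \<subseteq> sphere c \<epsilon>" "B' \<inter> B = {}" "?P fk \<in> B'" "?P fl \<in> B'" for B B'
  proof -
    have AB: "A \<inter> B = {?P fi, ?P fj}" by (rule meet[OF B(3,4,5)])
    have cB: "c \<notin> B" using B(3) eps by auto
    obtain \<eta> where \<eta>: "\<eta> > 0" "\<And>u v. \<lbrakk>u \<in> ball c \<eta>; v \<in> ball c \<eta>; connected_component (- (A \<union> B)) u v\<rbrakk>
       \<Longrightarrow> connected_component (- (A \<union> C)) u v"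
      using same_side_transfer_near_point[OF cA(1) B(1) cC(1) B(2) cC(2) AB AC _ cB cC'] by auto
    obtain u where u: "u \<in> ?g fk - {c}" "u \<in> ball c \<eta>" using near[OF F(3) \<eta>(1)] by blast
    obtain v where v: "v \<in> ?g fl - {c}" "v \<in> ball c \<eta>" using near[OF F(4) \<eta>(1)] by blast
    have nB: "?P fk \<notin> B" "?P fl \<notin> B" using B'(3-5) by blast+
    have uk: "connected_component (- (A \<union> B)) u (?P fk)"
      by (rule comp_germ[OF F(3) u(1) gk(8) off[OF F(3) d(2,3) nB(1) B(3)]])
    have vl: "connected_component (- (A \<union> B)) v (?P fl)"
      by (rule comp_germ[OF F(4) v(1) gl(8) off[OF F(4) d(4,5) nB(2) B(3)]])
    have kl: "connected_component (- (A \<union> B)) (?P fk) (?P fl)"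
    proof (rule connected_componentI[OF B'(1) _ B'(4,5)])
      have nP: "?P fi \<notin> B'" "?P fj \<notin> B'" using B(4,5) B'(3) by auto
      have "B' \<inter> A \<subseteq> A \<inter> sphere c \<epsilon>" using B'(2) by blast
      then have "B' \<inter> A = {}" unfolding Asph using nP by auto
      then show "B' \<inter> (A \<union> B) = {}" unfolding Int_Un_distrib B'(3) by simp
    qed
    have "connected_component (- (A \<union> B)) u v"
      by (rule connected_component_trans[OF uk connected_component_trans[OF kl connected_component_sym[OF vl]]])
    then have uv: "connected_component (- \<Gamma>) u v" unfolding \<Gamma>AC by (rule \<eta>(2)[OF u(2) v(2)])
    show ?thesis
      by (rule connected_component_trans[OF comp_germ[OF F(3) x u(1) off\<Gamma>[OF F(3) d(2,3)]]
            connected_component_trans[OF uv comp_germ[OF F(4) v(1) y off\<Gamma>[OF F(4) d(4,5)]]]])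
  qed
  \<comment> \<open>Otherwise each germ escapes through its own arc of the circle to a far point, avoiding \<open>A\<close> and the other
    arc. If \<open>x\<close> and \<open>y\<close> were on the same side, Janiszewski's theorem would let one of them escape past \<open>A\<close> and
    the whole circle.\<close>
  have different_if_cut: "\<not> connected_component (- \<Gamma>) x y"
    if B: "compact B" "connected B" "B \<subseteq> sphere c \<epsilon>" "?P fi \<in> B" "?P fj \<in> B" "?P fl \<notin> B"
      and B': "compact B'" "connected B'" "B' \<subseteq> sphere c \<epsilon>" "?P fi \<in> B'" "?P fj \<in> B'" "?P fk \<notin> B'"
      and BB: "B \<inter> B' \<subseteq> {?P fi, ?P fj}" "sphere c \<epsilon> \<subseteq> B \<union> B'" for B B'
  proof
    assume xy: "connected_component (- \<Gamma>) x y"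
    have AB: "A \<inter> B = {?P fi, ?P fj}" "A \<inter> B' = {?P fi, ?P fj}"
      by (rule meet[OF B(3,4,5)], rule meet[OF B'(3,4,5)])
    have cB: "c \<notin> B" "c \<notin> B'" using B(3) B'(3) eps by auto
    obtain \<eta> where \<eta>: "\<eta> > 0" "\<And>u v. \<lbrakk>u \<in> ball c \<eta>; v \<in> ball c \<eta>; connected_component (- (A \<union> C)) u v\<rbrakk>
       \<Longrightarrow> connected_component (- (A \<union> B)) u v"
      using same_side_transfer_near_point[OF cA(1) cC(1) B(1) cC(2) B(2) AC AB(1) _ cC' cB(1)] by auto
    obtain \<eta>' where \<eta>': "\<eta>' > 0" "\<And>u v. \<lbrakk>u \<in> ball c \<eta>'; v \<in> ball c \<eta>'; connected_component (- (A \<union> C)) u v\<rbrakk>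
       \<Longrightarrow> connected_component (- (A \<union> B')) u v"
      using same_side_transfer_near_point[OF cA(1) cC(1) B'(1) cC(2) B'(2) AC AB(2) _ cC' cB(2)] by auto
    have mn: "min \<eta> \<eta>' > 0" using \<eta> \<eta>' by simp
    obtain u where u: "u \<in> ?g fk - {c}" "u \<in> ball c \<eta>" "u \<in> ball c \<eta>'" "u \<in> ball c \<epsilon>" using near[OF F(3) mn] by auto
    obtain v where v: "v \<in> ?g fl - {c}" "v \<in> ball c \<eta>" "v \<in> ball c \<eta>'" "v \<in> ball c \<epsilon>" using near[OF F(4) mn] by auto
    have "connected_component (- \<Gamma>) u v"
      by (rule connected_component_trans[OF comp_germ[OF F(3) u(1) x off\<Gamma>[OF F(3) d(2,3)]]
            connected_component_trans[OF xy comp_germ[OF F(4) y v(1) off\<Gamma>[OF F(4) d(4,5)]]]])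
    then have uv: "connected_component (- (A \<union> C)) u v" unfolding \<Gamma>AC .
    note uvB = \<eta>(2)[OF u(2) v(2) uv] \<eta>'(2)[OF u(3) v(3) uv]
    \<comment> \<open>The factor 2 only has to put the end of the radial segment outside the disc.\<close>
    define far where "far = (\<lambda>f. c + 2 * (?P f - c))"
    have ray: "connected_component (- (A \<union> T)) (?P f) (far f)"
      if "f \<in> F" "f \<noteq> fi" "f \<noteq> fj" "?P f \<notin> T" "T \<subseteq> sphere c \<epsilon>" for f T
    proof (rule connected_componentI[of "closed_segment (?P f) (far f)"])
      have "z = ?P f" if z: "z \<in> closed_segment (?P f) (far f)" "z \<in> cball c \<epsilon>" for z
      proof -
        obtain u where u: "0 \<le> u" "u \<le> 1" "z = (1 - u) *\<^sub>R ?P f + u *\<^sub>R far f" using z(1) unfolding in_segment by auto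
        then have eq: "z - c = (1 + u) *\<^sub>R (?P f - c)" unfolding far_def by (simp add: algebra_simps scaleR_conv_of_real)
        have "norm (?P f - c) = \<epsilon>" using Psph[OF \<open>f \<in> F\<close>] by (simp add: dist_norm norm_minus_commute)
        then have "norm (z - c) = (1 + u) * \<epsilon>" unfolding eq using u by simp
        moreover have "norm (z - c) \<le> \<epsilon>" using z(2) by (simp add: dist_norm norm_minus_commute)
        ultimately have "u = 0" using eps u by (simp add: distrib_right mult_le_0_iff)
        then show ?thesis using u by simp
      qed
      moreover have "A \<union> T \<subseteq> cball c \<epsilon>" using gi(4) gj(4) that(5) unfolding A_def by auto
      moreover have "?P f \<notin> A" using offA(1)[OF that(1-3)] germ_props(8)[OF S that(1)] by blast
      ultimately show "closed_segment (?P f) (far f) \<inter> (A \<union> T) = {}" using that(4) by blast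
    qed auto
    have farout: "far f \<in> - cball c \<epsilon>" if "f \<in> F" for f
    proof -
      have "dist c (far f) = norm (2 * (?P f - c))" unfolding far_def dist_norm by (metis add_diff_cancel_left' norm_minus_commute)
      also have "\<dots> = 2 * dist c (?P f)" by (simp only: norm_mult dist_norm norm_minus_commute[of c]) simp
      finally show ?thesis using Psph[OF that] eps by simp
    qed
    have far2: "connected_component (- (A \<union> T)) (far fk) (far fl)" if "T \<subseteq> sphere c \<epsilon>" for T
    proof (rule connected_componentI[of "- cball c \<epsilon>"])
      show "connected (- cball c \<epsilon>)" by (intro connected_complement_bounded_convex) auto
      show "- cball c \<epsilon> \<inter> (A \<union> T) = {}" using gi(4) gj(4) that unfolding A_def by auto
    qed (use farout F in auto)
    note vfar = connected_component_trans[OF comp_germ[OF F(4) v(1) gl(8) off[OF F(4) d(4,5) B(6,3)]] ray[OF F(4) d(4,5) B(6,3)]]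
    note 1 = connected_component_trans[OF uvB(1) vfar]
    note ufar = connected_component_trans[OF comp_germ[OF F(3) u(1) gk(8) off[OF F(3) d(2,3) B'(6,3)]] ray[OF F(3) d(2,3) B'(6,3)]]
    note 2 = connected_component_trans[OF ufar far2[OF B'(3)]]
    have "(A \<union> B) \<inter> (A \<union> B') = A" using AB BB by blast
    then have "connected_component (- ((A \<union> B) \<union> (A \<union> B'))) u (far fl)"
      using Janiszewski[of "A \<union> B" "A \<union> B'" u "far fl"] 1 2 cA(2)
        compact_Un[OF cA(1) B(1)] compact_imp_closed[OF compact_Un[OF cA(1) B'(1)]] by simp
    then obtain T where T: "connected T" "T \<inter> sphere c \<epsilon> = {}" "u \<in> T" "far fl \<in> T"
      unfolding connected_component_def using BB by blast
    have "T \<inter> ball c \<epsilon> \<noteq> {}" "T - ball c \<epsilon> \<noteq> {}" using T(3,4) u(4) farout[OF F(4)] by auto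
    then have "T \<inter> frontier (ball c \<epsilon>) \<noteq> {}" using connected_Int_frontier[OF T(1)] by blast
    then show False using T(2) eps by (simp add: frontier_ball)
  qed
  \<comment> \<open>\<open>B\<close> and \<open>B'\<close> are the two closed arcs of the circle between the exits of \<open>fi\<close> and \<open>fj\<close>, \<open>Bo\<close> and \<open>Bo'\<close>
    their interiors; the angles \<open>- pi\<close> and \<open>pi\<close> describe the same point, which lies on \<open>B'\<close>.\<close>
  have main: "connected_component (- \<Gamma>) x y \<longleftrightarrow> \<not> separated \<alpha> \<beta> (?\<theta> fk) (?\<theta> fl)"
    if ab: "\<alpha> < \<beta>" "- pi < \<alpha>" "\<beta> \<le> pi" "{circ \<alpha>, circ \<beta>} = {?P fi, ?P fj}" for \<alpha> \<beta>
  proof -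
    define B where "B = circ ` {\<alpha>..\<beta>}"
    define B' where "B' = circ ` {- pi..\<alpha>} \<union> circ ` {\<beta>..pi}"
    define Bo where "Bo = circ ` {\<alpha><..<\<beta>}"
    define Bo' where "Bo' = circ ` {- pi<..<\<alpha>} \<union> circ ` {\<beta><..pi}"
    have cont: "continuous_on T circ" for T unfolding circ_def by (rule continuous_circle_point)
    have con: "compact B" "connected B" "compact B'" "connected B'" "connected Bo"
    proof -
      show "compact B" "connected B" "compact B'" "connected Bo" unfolding B_def B'_def Bo_def
        by (auto intro!: compact_Un compact_continuous_image connected_continuous_image cont)
      have "circ pi \<in> circ ` {- pi..\<alpha>} \<inter> circ ` {\<beta>..pi}"
        using ab circle_point_pi[of c \<epsilon>] unfolding circ_def by (metis IntI atLeastAtMost_iff imageI less_imp_le order_refl)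
      then show "connected B'" unfolding B'_def
        by (intro connected_Un connected_continuous_image cont) auto
    qed
    have sph: "B \<subseteq> sphere c \<epsilon>" "B' \<subseteq> sphere c \<epsilon>" "Bo \<subseteq> sphere c \<epsilon>" "Bo' \<subseteq> sphere c \<epsilon>"
      unfolding B_def B'_def Bo_def Bo'_def circ_def using dist_circle_point[OF eps] by auto
    have cover: "sphere c \<epsilon> \<subseteq> B \<union> B'"
      unfolding sphere_eq_circle_points[OF eps] B_def B'_def circ_def by force
    have norm: "\<exists>\<psi>. - pi < \<psi> \<and> \<psi> \<le> pi \<and> circ \<phi> = circ \<psi> \<and> (\<psi> = \<phi> \<or> (\<phi> = - pi \<and> \<psi> = pi))" if "- pi \<le> \<phi>" "\<phi> \<le> pi" for \<phi>
    proof (cases "\<phi> = - pi")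
      case True
      then show ?thesis using circle_point_pi[of c \<epsilon>] pi_gt_zero unfolding circ_def by (intro exI[of _ pi]) simp
    next
      case False
      then show ?thesis using that by (intro exI[of _ \<phi>]) auto
    qed
    have inj: "circ \<phi> = circ \<psi> \<longleftrightarrow> \<phi> = \<psi>" if "- pi < \<phi>" "\<phi> \<le> pi" "- pi < \<psi>" "\<psi> \<le> pi" for \<phi> \<psi>
      unfolding circ_def using circle_point_eq_iff[OF eps that] .
    have inB: "circ \<phi> \<in> B \<longleftrightarrow> \<alpha> \<le> \<phi> \<and> \<phi> \<le> \<beta>" "circ \<phi> \<in> B' \<longleftrightarrow> \<phi> \<le> \<alpha> \<or> \<beta> \<le> \<phi>"
       "circ \<phi> \<in> Bo \<longleftrightarrow> \<alpha> < \<phi> \<and> \<phi> < \<beta>" "circ \<phi> \<in> Bo' \<longleftrightarrow> \<phi> < \<alpha> \<or> \<beta> < \<phi>" if p: "- pi < \<phi>" "\<phi> \<le> pi" for \<phi>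
    proof -
      have m: "circ \<phi> \<in> circ ` I \<longleftrightarrow> \<phi> \<in> I \<or> (\<phi> = pi \<and> - pi \<in> I)" if "I \<subseteq> {- pi..pi}" for I
      proof
        assume "circ \<phi> \<in> circ ` I"
        then obtain \<xi> where \<xi>: "\<xi> \<in> I" "circ \<phi> = circ \<xi>" by auto
        then obtain \<psi> where "- pi < \<psi>" "\<psi> \<le> pi" "circ \<xi> = circ \<psi>" "\<psi> = \<xi> \<or> (\<xi> = - pi \<and> \<psi> = pi)"
          using norm[of \<xi>] \<open>I \<subseteq> {- pi..pi}\<close> by (metis atLeastAtMost_iff subsetD)
        then show "\<phi> \<in> I \<or> (\<phi> = pi \<and> - pi \<in> I)" using inj[OF p, of \<psi>] \<xi> by auto
      next
        assume "\<phi> \<in> I \<or> (\<phi> = pi \<and> - pi \<in> I)"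
        then show "circ \<phi> \<in> circ ` I" using circle_point_pi[of c \<epsilon>] unfolding circ_def by (metis imageI)
      qed
      have sub: "{- pi..\<alpha>} \<subseteq> {- pi..pi}" "{\<beta>..pi} \<subseteq> {- pi..pi}" "{- pi<..<\<alpha>} \<subseteq> {- pi..pi}" "{\<beta><..pi} \<subseteq> {- pi..pi}"
        "{\<alpha>..\<beta>} \<subseteq> {- pi..pi}" "{\<alpha><..<\<beta>} \<subseteq> {- pi..pi}"
        using ab by auto
      show "circ \<phi> \<in> B \<longleftrightarrow> \<alpha> \<le> \<phi> \<and> \<phi> \<le> \<beta>" "circ \<phi> \<in> Bo \<longleftrightarrow> \<alpha> < \<phi> \<and> \<phi> < \<beta>"
        unfolding B_def Bo_def m[OF sub(5)] m[OF sub(6)] using ab p by auto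
      show "circ \<phi> \<in> B' \<longleftrightarrow> \<phi> \<le> \<alpha> \<or> \<beta> \<le> \<phi>"
        unfolding B'_def Un_iff m[OF sub(1)] m[OF sub(2)] using ab p by auto
      show "circ \<phi> \<in> Bo' \<longleftrightarrow> \<phi> < \<alpha> \<or> \<beta> < \<phi>"
        unfolding Bo'_def Un_iff m[OF sub(3)] m[OF sub(4)] using ab p by auto
    qed
    have conBo': "connected Bo'"
    proof (cases "\<beta> < pi")
      case True
      have "circ pi \<in> circ ` {- pi..<\<alpha>} \<inter> circ ` {\<beta><..pi}"
        using True ab circle_point_pi[of c \<epsilon>] unfolding circ_def
        by (metis IntI atLeastLessThan_iff greaterThanAtMost_iff imageI order_refl)
      then have "connected (circ ` {- pi..<\<alpha>} \<union> circ ` {\<beta><..pi})"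
        by (intro connected_Un connected_continuous_image cont) auto
      moreover have "circ ` {- pi..<\<alpha>} \<union> circ ` {\<beta><..pi} = Bo'"
      proof -
        have "{- pi..<\<alpha>} = insert (- pi) {- pi<..<\<alpha>}" using ab by auto
        moreover have "circ (- pi) \<in> circ ` {\<beta><..pi}" using True circle_point_pi[of c \<epsilon>] unfolding circ_def by auto
        ultimately show ?thesis unfolding Bo'_def by auto
      qed
      ultimately show ?thesis by simp
    next
      case False
      then show ?thesis unfolding Bo'_def using ab by (auto intro!: connected_continuous_image cont)
    qed
    have ends: "?P fi \<in> B" "?P fj \<in> B" "?P fi \<in> B'" "?P fj \<in> B'"
    proof -
      have "circ \<alpha> \<in> B \<inter> B'" "circ \<beta> \<in> B \<inter> B'" unfolding B_def B'_def using ab(1-3) by auto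
      then have "{?P fi, ?P fj} \<subseteq> B \<inter> B'" unfolding ab(4)[symmetric] by blast
      then show "?P fi \<in> B" "?P fj \<in> B" "?P fi \<in> B'" "?P fj \<in> B'" by auto
    qed
    have angle: "\<exists>\<phi>. - pi < \<phi> \<and> \<phi> \<le> pi \<and> z = circ \<phi>" if z: "z \<in> sphere c \<epsilon>" for z
    proof -
      obtain \<phi> where "- pi \<le> \<phi>" "\<phi> \<le> pi" "z = circ \<phi>"
        using z unfolding sphere_eq_circle_points[OF eps] circ_def[symmetric] by auto
      then show ?thesis using norm[of \<phi>] by metis
    qed
    have BBi: "B \<inter> B' \<subseteq> {?P fi, ?P fj}" "Bo' \<inter> B = {}" "Bo \<inter> B' = {}"
    proof -
      show "B \<inter> B' \<subseteq> {?P fi, ?P fj}"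
      proof
        fix z assume z: "z \<in> B \<inter> B'"
        then obtain \<phi> where "- pi < \<phi>" "\<phi> \<le> pi" "z = circ \<phi>" using angle[of z] sph(1) by blast
        then show "z \<in> {?P fi, ?P fj}" using inB[of \<phi>] z ab by (auto simp flip: ab(4))
      qed
      show "Bo' \<inter> B = {}"
      proof (rule ccontr)
        assume "Bo' \<inter> B \<noteq> {}"
        then obtain z where z: "z \<in> Bo'" "z \<in> B" by blast
        then obtain \<phi> where "- pi < \<phi>" "\<phi> \<le> pi" "z = circ \<phi>" using angle[of z] sph(1) by blast
        then show False using inB[of \<phi>] z by auto
      qed
      show "Bo \<inter> B' = {}"
      proof (rule ccontr)
        assume "Bo \<inter> B' \<noteq> {}"
        then obtain z where z: "z \<in> Bo" "z \<in> B'" by blast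
        then obtain \<phi> where "- pi < \<phi>" "\<phi> \<le> pi" "z = circ \<phi>" using angle[of z] sph(2) by blast
        then show False using inB[of \<phi>] z by auto
      qed
    qed
    have ne: "?\<theta> f \<noteq> \<alpha>" "?\<theta> f \<noteq> \<beta>" if "f \<in> F" "f \<noteq> fi" "f \<noteq> fj" for f
      using distinct_exits(1)[OF S that(1) F(1) that(2)] distinct_exits(1)[OF S that(1) F(2) that(3)] ab(4) P(1)[OF that(1)]
      by (metis doubleton_eq_iff)+
    note nk = ne[OF F(3) d(2,3)] and nl = ne[OF F(4) d(4,5)]
    note Pk = P[OF F(3)] and Pl = P[OF F(4)]
    consider "\<alpha> < ?\<theta> fk" "?\<theta> fk < \<beta>" "\<alpha> < ?\<theta> fl" "?\<theta> fl < \<beta>"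
      | "\<alpha> < ?\<theta> fk" "?\<theta> fk < \<beta>" "?\<theta> fl < \<alpha> \<or> \<beta> < ?\<theta> fl"
      | "?\<theta> fk < \<alpha> \<or> \<beta> < ?\<theta> fk" "\<alpha> < ?\<theta> fl" "?\<theta> fl < \<beta>"
      | "?\<theta> fk < \<alpha> \<or> \<beta> < ?\<theta> fk" "?\<theta> fl < \<alpha> \<or> \<beta> < ?\<theta> fl"
      using nk nl by linarith
    then show ?thesis
    proof cases
      case 1
      have "connected_component (- \<Gamma>) x y"
        by (rule same_if_not_cut[OF con(3,4) sph(2) ends(3,4) con(5) sph(3) BBi(3)])
          (use 1 inB(3)[OF Pk(2,3)] inB(3)[OF Pl(2,3)] Pk Pl in auto)
      then show ?thesis using 1 unfolding separated_def by auto
    next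
      case 2
      have "\<not> connected_component (- \<Gamma>) x y"
        by (rule different_if_cut[OF con(1,2) sph(1) ends(1,2) _ con(3,4) sph(2) ends(3,4) _ BBi(1) cover])
          (use 2 inB(1,2)[OF Pk(2,3)] inB(1,2)[OF Pl(2,3)] Pk Pl in auto)
      then show ?thesis using 2 ab(1) unfolding separated_def by auto
    next
      case 3
      have "\<not> connected_component (- \<Gamma>) x y"
        by (rule different_if_cut[OF con(3,4) sph(2) ends(3,4) _ con(1,2) sph(1) ends(1,2)])
          (use 3 inB(1,2)[OF Pk(2,3)] inB(1,2)[OF Pl(2,3)] Pk Pl BBi(1) cover in auto)
      then show ?thesis using 3 ab(1) unfolding separated_def by auto
    next
      case 4
      have "connected_component (- \<Gamma>) x y"
        by (rule same_if_not_cut[OF con(1,2) sph(1) ends(1,2) conBo' sph(4) BBi(2)])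
          (use 4 inB(4)[OF Pk(2,3)] inB(4)[OF Pl(2,3)] Pk Pl in auto)
      then show ?thesis using 4 ab(1) unfolding separated_def by auto
    qed
  qed
  have nij: "?\<theta> fi \<noteq> ?\<theta> fj" using distinct_exits(2)[OF S F(1,2) d(1)] .
  show ?thesis
  proof (cases "?\<theta> fi < ?\<theta> fj")
    case True
    show ?thesis using main[OF True] P[OF F(1)] P[OF F(2)] by auto
  next
    case False
    then have "?\<theta> fj < ?\<theta> fi" using nij by simp
    from main[OF this] show ?thesis using P[OF F(1)] P[OF F(2)] unfolding separated_def by auto
  qed
qed

section \<open>Crossing rules for complete simple topological graphs\<close>

lemma properly_cross_at_cong:
  "\<lbrakk>path_image e = path_image e'; path_image f = path_image f'\<rbrakk> \<Longrightarrow>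
    properly_cross_at e f p \<longleftrightarrow> properly_cross_at e' f' p"
  unfolding properly_cross_at_def by simp

lemma not_in_if_Int_eq: "\<lbrakk>Q \<inter> V = S; x \<in> V; x \<notin> S\<rbrakk> \<Longrightarrow> x \<notin> Q"
  by blast

context complete_simple_topological_graph
begin

definition edge :: "complex \<Rightarrow> complex \<Rightarrow> real \<Rightarrow> complex" where
  "edge u v = (THE e. e \<in> E \<and> edge_ends e = {u, v})"

definition curve :: "complex \<Rightarrow> complex \<Rightarrow> complex set" where
  "curve u v = path_image (edge u v)"

definition from_to :: "complex \<Rightarrow> complex \<Rightarrow> real \<Rightarrow> complex" where
  "from_to u v = (if pathstart (edge u v) = u then edge u v else reversepath (edge u v))"

definition cross :: "complex \<Rightarrow> complex \<Rightarrow> complex \<Rightarrow> complex \<Rightarrow> bool" where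
  "cross a b c d \<longleftrightarrow> edges_cross (edge a b) (edge c d)"

lemma edge_commute: "edge u v = edge v u"
  unfolding edge_def by (simp add: insert_commute)

lemma curve_commute: "curve u v = curve v u"
  unfolding curve_def by (simp add: edge_commute)

lemma cross_commute1: "cross a b c d = cross b a c d"
  and cross_commute2: "cross a b c d = cross c d a b"
  unfolding cross_def edges_cross_def by (metis edge_commute, metis Int_commute)

lemma cross_commute3: "cross a b c d = cross a b d c"
  by (metis cross_commute1 cross_commute2)

lemma edge_in:
  assumes "u \<in> V" "v \<in> V" "u \<noteq> v"
  shows "edge u v \<in> E" "edge_ends (edge u v) = {u, v}"
  using theI'[OF joined_by_unique_edge[OF assms]] unfolding edge_def by auto

lemma from_to:
  assumes "u \<in> V" "v \<in> V" "u \<noteq> v"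
  shows "arc (from_to u v)" "pathstart (from_to u v) = u" "pathfinish (from_to u v) = v"
    "path_image (from_to u v) = curve u v"
    "continuous_on {0..1} (from_to u v)" "inj_on (from_to u v) {0..1}" "from_to u v 0 = u" "from_to u v 1 = v"
proof -
  note e = edge_in[OF assms]
  have a: "arc (edge u v)" using edge_arc[OF e(1)] .
  have ends: "{pathstart (edge u v), pathfinish (edge u v)} = {u, v}" using e(2) unfolding edge_ends_def .
  show 1: "arc (from_to u v)" unfolding from_to_def using a by (simp add: arc_reversepath)
  show 2: "pathstart (from_to u v) = u" "pathfinish (from_to u v) = v"
    unfolding from_to_def using ends by (auto simp: doubleton_eq_iff)
  show "path_image (from_to u v) = curve u v" unfolding from_to_def curve_def by simp
  show "continuous_on {0..1} (from_to u v)" "inj_on (from_to u v) {0..1}" using 1 unfolding arc_def path_def by auto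
  show "from_to u v 0 = u" "from_to u v 1 = v" using 2 unfolding pathstart_def pathfinish_def by auto
qed

lemma curve_props:
  assumes "u \<in> V" "v \<in> V" "u \<noteq> v"
  shows "compact (curve u v)" "connected (curve u v)" "u \<in> curve u v" "v \<in> curve u v"
    "w \<in> V \<Longrightarrow> w \<noteq> u \<Longrightarrow> w \<noteq> v \<Longrightarrow> w \<notin> curve u v"
    "connected (curve u v - {u})" "from_to u v ` {0..1} = curve u v"
proof -
  note f = from_to[OF assms]
  show "compact (curve u v)" "connected (curve u v)" using f(1,4)
    by (metis arc_imp_path compact_path_image, metis arc_imp_path connected_path_image)
  show "u \<in> curve u v" "v \<in> curve u v" using f(2-4) by (metis pathstart_in_path_image, metis pathfinish_in_path_image)
  show im: "from_to u v ` {0..1} = curve u v" using f(4) unfolding path_image_def .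
  show "w \<notin> curve u v" if "w \<in> V" "w \<noteq> u" "w \<noteq> v"
    using edge_avoids_vertices[OF edge_in(1)[OF assms]] edge_in(2)[OF assms] that
    unfolding edge_interior_def curve_def by auto
  have "curve u v - {u} = from_to u v ` {0<..1}"
  proof -
    have "from_to u v ` {0<..1} = from_to u v ` ({0..1} - {0})" by (rule arg_cong[of _ _ "image _"]) auto
    also have "\<dots> = from_to u v ` {0..1} - from_to u v ` {0}"
      by (rule inj_on_image_set_diff[OF f(6)]) auto
    finally show ?thesis using im f(7) by simp
  qed
  moreover have "continuous_on {0<..1} (from_to u v)" by (rule continuous_on_subset[OF f(5)]) auto
  then have "connected (from_to u v ` {0<..1})" by (rule connected_continuous_image) simp
  ultimately show "connected (curve u v - {u})" by simp
qed

lemma adjacent_curves: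
  assumes "u \<in> V" "v \<in> V" "w \<in> V" "u \<noteq> v" "u \<noteq> w" "v \<noteq> w"
  shows "curve u v \<inter> curve u w = {u}"
proof -
  note e = edge_in[OF assms(1,2,4)] and e' = edge_in[OF assms(1,3,5)]
  have "edge u v \<noteq> edge u w" using e(2) e'(2) assms by (auto simp: doubleton_eq_iff)
  moreover have "u \<in> curve u v" "u \<in> curve u w" using curve_props assms by auto
  ultimately show ?thesis using intersect_at_most_once[OF e(1) e'(1)] unfolding curve_def by blast
qed

lemma opposite_curves:
  assumes "a \<in> V" "b \<in> V" "c \<in> V" "d \<in> V" "distinct [a, b, c, d]"
  shows "\<not> cross a b c d \<Longrightarrow> curve a b \<inter> curve c d = {}"
    "cross a b c d \<Longrightarrow> \<exists>p. curve a b \<inter> curve c d = {p} \<and> p \<notin> V \<and>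
       properly_cross_at (from_to a b) (from_to c d) p"
proof -
  have ab: "a \<noteq> b" "c \<noteq> d" using assms by auto
  note e = edge_in[OF assms(1,2) ab(1)] and f = edge_in[OF assms(3,4) ab(2)]
  have ne: "edge a b \<noteq> edge c d" using e(2) f(2) assms(5) by (auto simp: doubleton_eq_iff)
  have int: "x \<in> edge_interior (edge a b) \<inter> edge_interior (edge c d)" if "x \<in> curve a b \<inter> curve c d" for x
    using that curve_props(5)[OF assms(1,2) ab(1)] curve_props(5)[OF assms(3,4) ab(2)] assms e(2) f(2)
    unfolding edge_interior_def curve_def by auto
  show "\<not> cross a b c d \<Longrightarrow> curve a b \<inter> curve c d = {}"
    using int unfolding cross_def edges_cross_def by blast
  assume "cross a b c d"
  then obtain p where p: "p \<in> edge_interior (edge a b) \<inter> edge_interior (edge c d)"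
    unfolding cross_def edges_cross_def by blast
  have "properly_cross_at (edge a b) (edge c d) p" using proper_crossings[OF e(1) f(1) ne p] .
  then have "properly_cross_at (from_to a b) (from_to c d) p"
    using properly_cross_at_cong[of "edge a b" "from_to a b" "edge c d" "from_to c d"]
      from_to(4)[OF assms(1,2) ab(1)] from_to(4)[OF assms(3,4) ab(2)] unfolding curve_def by simp
  moreover have "p \<in> curve a b" "p \<in> curve c d" using p unfolding curve_def edge_interior_def by auto
  moreover have "curve a b \<inter> curve c d = {p}"
    using intersect_at_most_once[OF e(1) f(1) ne] calculation(2,3) unfolding curve_def by blast
  moreover have "p \<notin> V" using p edge_avoids_vertices[OF e(1)] by blast
  ultimately show "\<exists>p. curve a b \<inter> curve c d = {p} \<and> p \<notin> V \<and> properly_cross_at (from_to a b) (from_to c d) p"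
    by blast
qed

text \<open>
  The curve may be pieced together from parts of several edges, as long as it agrees with some edge
  near each meeting point; then every meeting point is a proper crossing.
\<close>

lemma side_parity:
  assumes J: "jordan_curve \<Gamma>" and uv: "u \<in> V" "v \<in> V" "u \<noteq> v"
    and ab: "0 \<le> \<alpha>" "\<alpha> \<le> \<beta>" "\<beta> \<le> 1" "from_to u v \<alpha> \<notin> \<Gamma>" "from_to u v \<beta> \<notin> \<Gamma>"
    and loc: "\<And>p. p \<in> from_to u v ` {\<alpha>..\<beta>} \<inter> \<Gamma> \<Longrightarrow>
      \<exists>a b N. a \<in> V \<and> b \<in> V \<and> distinct [a, b, u, v] \<and> open N \<and> p \<in> N \<and> \<Gamma> \<inter> N = curve a b \<inter> N"
  shows "(from_to u v \<alpha> \<in> inside \<Gamma> \<longleftrightarrow> from_to u v \<beta> \<in> inside \<Gamma>)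
    \<longleftrightarrow> even (card (from_to u v ` {\<alpha>..\<beta>} \<inter> \<Gamma>))"
proof -
  let ?f = "from_to u v"
  note f = from_to[OF uv]
  have sub: "{\<alpha>..\<beta>} \<subseteq> {0..1}" using ab by auto
  have im: "?f ` {t \<in> {\<alpha>..\<beta>}. ?f t \<in> \<Gamma>} = ?f ` {\<alpha>..\<beta>} \<inter> \<Gamma>" by auto
  have inj: "inj_on ?f {t \<in> {\<alpha>..\<beta>}. ?f t \<in> \<Gamma>}" by (rule inj_on_subset[OF f(6)]) (use sub in auto)
  have "?f ` {\<alpha>..\<beta>} \<inter> \<Gamma> \<subseteq> (\<Union>(a, b) \<in> {(a, b). a \<in> V \<and> b \<in> V \<and> distinct [a, b, u, v]}. curve a b \<inter> curve u v)"
  proof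
    fix p assume p: "p \<in> ?f ` {\<alpha>..\<beta>} \<inter> \<Gamma>"
    then obtain a b N where "a \<in> V" "b \<in> V" "distinct [a, b, u, v]" "p \<in> N" "\<Gamma> \<inter> N = curve a b \<inter> N"
      using loc[OF p] by blast
    moreover have "p \<in> curve u v" using p sub curve_props(7)[OF uv] by blast
    ultimately show "p \<in> (\<Union>(a, b) \<in> {(a, b). a \<in> V \<and> b \<in> V \<and> distinct [a, b, u, v]}. curve a b \<inter> curve u v)"
      using p by blast
  qed
  moreover have "finite (\<Union>(a, b) \<in> {(a, b). a \<in> V \<and> b \<in> V \<and> distinct [a, b, u, v]}. curve a b \<inter> curve u v)"
  proof (rule finite_UN_I)
    show "finite {(a, b). a \<in> V \<and> b \<in> V \<and> distinct [a, b, u, v]}"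
      by (rule finite_subset[of _ "V \<times> V"]) (use finite_vertices in auto)
    fix ab assume ab: "ab \<in> {(a, b). a \<in> V \<and> b \<in> V \<and> distinct [a, b, u, v]}"
    obtain a b where "ab = (a, b)" by (cases ab)
    moreover have "a \<in> V" "b \<in> V" "distinct [a, b, u, v]" using ab unfolding \<open>ab = (a, b)\<close> by simp_all
    ultimately have "curve a b \<inter> curve u v = {} \<or> (\<exists>p. curve a b \<inter> curve u v = {p})"
      using opposite_curves[of a b u v] uv(1,2) by blast
    then have "finite (curve a b \<inter> curve u v)" by (elim disjE exE) simp_all
    then show "finite (case ab of (a, b) \<Rightarrow> curve a b \<inter> curve u v)"
      using \<open>ab = (a, b)\<close> by simp
  qed
  ultimately have fin: "finite (?f ` {\<alpha>..\<beta>} \<inter> \<Gamma>)" by (rule finite_subset)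
  have "(?f \<alpha> \<in> inside \<Gamma> \<longleftrightarrow> ?f \<beta> \<in> inside \<Gamma>) \<longleftrightarrow> even (card {t \<in> {\<alpha>..\<beta>}. ?f t \<in> \<Gamma>})"
  proof (rule even_flips_iff_same_side)
    show "continuous_on {\<alpha>..\<beta>} ?f" by (rule continuous_on_subset[OF f(5) sub])
    show "finite {t \<in> {\<alpha>..\<beta>}. ?f t \<in> \<Gamma>}" using finite_imageD[OF _ inj] fin unfolding im by blast
    fix t assume t: "t \<in> {\<alpha>..\<beta>}" "?f t \<in> \<Gamma>"
    then have p: "?f t \<in> ?f ` {\<alpha>..\<beta>} \<inter> \<Gamma>" by blast
    from loc[OF this] obtain a b N where N: "a \<in> V" "b \<in> V" "distinct [a, b, u, v]" "open N" "?f t \<in> N" "\<Gamma> \<inter> N = curve a b \<inter> N"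
      by blast
    have "?f t \<in> curve a b \<inter> curve u v" using N(5,6) t p sub curve_props(7)[OF uv] by blast
    then have cr: "properly_cross_at (from_to a b) ?f (?f t)"
      using opposite_curves[OF N(1,2) uv(1,2) N(3)] by (metis empty_iff singletonD)
    have "a \<noteq> b" using N(3) by simp
    have t01: "0 < t" "t < 1" using t ab by (cases "t = \<alpha>"; cases "t = \<beta>"; auto)+
    show "flips_side \<Gamma> ?f t"
      by (rule proper_crossing_flips_side[OF cr J N(4,5) _ f(1) t01 refl])
         (use N(6) from_to(4)[OF N(1,2) \<open>a \<noteq> b\<close>] in simp)
  qed (use ab in auto)
  also have "card {t \<in> {\<alpha>..\<beta>}. ?f t \<in> \<Gamma>} = card (?f ` {\<alpha>..\<beta>} \<inter> \<Gamma>)" using card_image[OF inj] im by simp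
  finally show ?thesis .
qed

text \<open>
  If \<open>ab\<close> and \<open>cd\<close> cross at \<open>p\<close>, the pieces \<open>ap\<close>
  and \<open>pd\<close> (whose union is \<open>Q\<close>) form a Jordan curve together with the edge
  \<open>ad\<close>. The remaining pieces \<open>pb\<close> and \<open>pc\<close> start on the same
  side of it and never return, so \<open>b\<close> and \<open>c\<close> are on the same side. All
  rules below that involve only crossings come from parity arguments for this curve.
\<close>

lemma corner:
  assumes abcd: "a \<in> V" "b \<in> V" "c \<in> V" "d \<in> V" "distinct [a, b, c, d]" and X: "cross a b c d"
  obtains p t t' Q where "0 < t" "t < 1" "0 < t'" "t' < 1" "from_to a b t = p" "from_to d c t' = p"
    "Q = from_to a b ` {0..t} \<union> from_to d c ` {0..t'}" "compact Q" "Q \<subseteq> curve a b \<union> curve c d"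
    "jordan_curve (Q \<union> curve a d)" "Q \<inter> V = {a, d}"
    "b \<in> inside (Q \<union> curve a d) \<longleftrightarrow> c \<in> inside (Q \<union> curve a d)"
proof -
  have ne: "a \<noteq> b" "d \<noteq> c" "a \<noteq> d" "c \<noteq> d" "d \<noteq> a" using abcd(5) by auto
  obtain p where p: "curve a b \<inter> curve c d = {p}" "p \<notin> V" "properly_cross_at (from_to a b) (from_to c d) p"
    using opposite_curves(2)[OF abcd X] by blast
  let ?e = "from_to a b" and ?f = "from_to d c"
  note e = from_to[OF abcd(1,2) ne(1)] and f = from_to[OF abcd(4,3) ne(2)]
  note ce = curve_props[OF abcd(1,2) ne(1)] and cf = curve_props[OF abcd(4,3) ne(2)] and cg = curve_props[OF abcd(1,4) ne(3)]
  have cdc: "curve d c = curve c d" by (rule curve_commute)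
  have pc: "p \<in> curve a b" "p \<in> curve d c" using p(1) cdc by auto
  obtain t where t: "t \<in> {0..1}" "?e t = p" using pc(1) ce(7) by (metis imageE)
  obtain t' where t': "t' \<in> {0..1}" "?f t' = p" using pc(2) cf(7) by (metis imageE)
  have t01: "0 < t" "t < 1" "0 < t'" "t' < 1"
    using t t' e(7,8) f(7,8) p(2) abcd by (metis atLeastAtMost_iff less_le)+
  have cr: "properly_cross_at ?e ?f p"
    using p(3) properly_cross_at_cong[of ?e ?e "from_to c d" ?f] f(4) from_to(4)[OF abcd(3,4) ne(4)] cdc by metis
  define Q where "Q = ?e ` {0..t} \<union> ?f ` {0..t'}"
  have Qsub: "?e ` {0..t} \<subseteq> curve a b" "?f ` {0..t'} \<subseteq> curve c d" using ce(7) cf(7) cdc t01 by auto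
  have cQ: "compact Q" unfolding Q_def using t01
    by (intro compact_Un compact_continuous_image continuous_on_subset[OF e(5)] continuous_on_subset[OF f(5)]) auto
  have adj: "curve a b \<inter> curve a d = {a}" "curve c d \<inter> curve a d = {d}"
    using adjacent_curves[of a b d] adjacent_curves[of d c a] abcd by (auto simp: curve_commute)
  have J: "jordan_curve (Q \<union> curve a d)"
  proof -
    note g = from_to[OF abcd(4,1) ne(5)]
    have da: "path_image (from_to d a) = curve a d" using g(4) curve_commute[of a d] by simp
    have im: "path_image (subpath 0 t ?e) = ?e ` {0..t}" "path_image (subpath t' 0 ?f) = ?f ` {0..t'}"
      using t01 by (auto simp: path_image_subpath)
    have "jordan_curve (path_image (subpath 0 t ?e) \<union> path_image (subpath t' 0 ?f) \<union> path_image (from_to d a))"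
    proof (rule jordan_curve_of_three_arcs)
      show "arc (subpath 0 t ?e)" "arc (subpath t' 0 ?f)"
        using t01 e(1) f(1) by (auto intro!: arc_subpath_arc)
      show "arc (from_to d a)" by (rule g(1))
      show "path_image (subpath 0 t ?e) \<inter> path_image (subpath t' 0 ?f) \<subseteq> {pathfinish (subpath 0 t ?e)}"
        unfolding im using Qsub p(1) t(2) by auto
      show "path_image (subpath t' 0 ?f) \<inter> path_image (from_to d a) \<subseteq> {pathfinish (subpath t' 0 ?f)}"
        unfolding im da using Qsub(2) adj(2) f(7) by auto
      show "path_image (from_to d a) \<inter> path_image (subpath 0 t ?e) \<subseteq> {pathfinish (from_to d a)}"
        unfolding im da g(3) using Qsub(1) adj(1) by auto
      show "pathfinish (subpath 0 t ?e) = pathstart (subpath t' 0 ?f)" using t t' by simp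
      show "pathfinish (subpath t' 0 ?f) = pathstart (from_to d a)" using f(7) g(2) by simp
      show "pathfinish (from_to d a) = pathstart (subpath 0 t ?e)" using e(7) g(3) by simp
    qed
    then show ?thesis unfolding im Q_def da .
  qed
  have QV: "Q \<inter> V = {a, d}"
  proof
    have "w = a" if w: "w \<in> V" "w \<in> ?e ` {0..t}" for w
    proof -
      obtain s where s: "s \<in> {0..t}" "w = ?e s" using w by auto
      have "w \<noteq> b" using inj_onD[OF e(6), of s 1] s e(8) t01 by auto
      then show ?thesis using ce(5)[of w] Qsub w by auto
    qed
    moreover have "w = d" if w: "w \<in> V" "w \<in> ?f ` {0..t'}" for w
    proof -
      obtain s where s: "s \<in> {0..t'}" "w = ?f s" using w by auto
      have "w \<noteq> c" using inj_onD[OF f(6), of s 1] s f(8) t01 by auto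
      then show ?thesis using cf(5)[of w] Qsub w cdc by auto
    qed
    ultimately show "Q \<inter> V \<subseteq> {a, d}" unfolding Q_def by blast
    show "{a, d} \<subseteq> Q \<inter> V" using abcd e(7) f(7) t01 unfolding Q_def by force
  qed
  let ?G = "Q \<union> curve a d"
  have pnot: "p \<notin> curve a d" using adj(1) pc(1) p(2) abcd(1) by (metis IntI singletonD)
  have bc: "b \<in> inside ?G \<longleftrightarrow> c \<in> inside ?G"
  proof -
    obtain \<delta> where \<delta>: "\<delta> > 0" "t + \<delta> < 1" "t' + \<delta> < 1"
      "?e (t + \<delta>) \<in> inside ?G \<longleftrightarrow> ?f (t' + \<delta>) \<in> inside ?G"
    proof (rule proper_crossing_corner_same_side[OF cr e(1) t01(1,2) t(2) f(1) t01(3,4) t'(2)])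
      show "open (- curve a d)" using cg(1) by (simp add: compact_imp_closed open_Compl)
      show "p \<in> - curve a d" using pnot by simp
      show "?G \<inter> - curve a d \<subseteq> ?e ` {0..t} \<union> ?f ` {0..t'}" unfolding Q_def by blast
    qed blast
    have "?e (t + \<delta>) \<in> inside ?G \<longleftrightarrow> ?e 1 \<in> inside ?G"
    proof (rule connected_off_curve_one_side[of "?e ` {t+\<delta>..1}"])
      show "connected (?e ` {t+\<delta>..1})" using \<delta> t01
        by (intro connected_continuous_image continuous_on_subset[OF e(5)]) auto
      have "?e s \<notin> ?G" if s: "s \<in> {t+\<delta>..1}" for s
      proof -
        have m: "?e s \<in> curve a b" using imageI[of s "{0..1}" ?e] s \<delta> t01 ce(7) by auto
        have "?e s \<noteq> p" "?e s \<noteq> a" using inj_onD[OF e(6), of s t] inj_onD[OF e(6), of s 0] s \<delta> t01 t(2) e(7) by auto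
        then have "?e s \<notin> curve c d" "?e s \<notin> curve a d" using m p(1) adj(1) by blast+
        moreover have "?e s \<notin> ?e ` {0..t}"
        proof
          assume "?e s \<in> ?e ` {0..t}"
          then obtain r where "r \<in> {0..t}" "?e s = ?e r" by blast
          then show False using inj_onD[OF e(6), of s r] s \<delta> t01 by auto
        qed
        ultimately show ?thesis using Qsub(2) unfolding Q_def by blast
      qed
      then show "?e ` {t+\<delta>..1} \<inter> ?G = {}" by blast
    qed (use \<delta> in auto)
    moreover have "?f (t' + \<delta>) \<in> inside ?G \<longleftrightarrow> ?f 1 \<in> inside ?G"
    proof (rule connected_off_curve_one_side[of "?f ` {t'+\<delta>..1}"])
      show "connected (?f ` {t'+\<delta>..1})" using \<delta> t01
        by (intro connected_continuous_image continuous_on_subset[OF f(5)]) auto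
      have "?f s \<notin> ?G" if s: "s \<in> {t'+\<delta>..1}" for s
      proof -
        have m: "?f s \<in> curve c d" using imageI[of s "{0..1}" ?f] s \<delta> t01 cf(7) cdc by auto
        have "?f s \<noteq> p" "?f s \<noteq> d" using inj_onD[OF f(6), of s t'] inj_onD[OF f(6), of s 0] s \<delta> t01 t'(2) f(7) by auto
        then have "?f s \<notin> curve a b" "?f s \<notin> curve a d" using m p(1) adj(2) by blast+
        moreover have "?f s \<notin> ?f ` {0..t'}"
        proof
          assume "?f s \<in> ?f ` {0..t'}"
          then obtain r where "r \<in> {0..t'}" "?f s = ?f r" by blast
          then show False using inj_onD[OF f(6), of s r] s \<delta> t01 by auto
        qed
        ultimately show ?thesis using Qsub(1) unfolding Q_def by blast
      qed
      then show "?f ` {t'+\<delta>..1} \<inter> ?G = {}" by blast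
    qed (use \<delta> in auto)
    ultimately show ?thesis using \<delta>(4) e(8) f(8) by simp
  qed
  show thesis
    by (rule that[OF t01 t(2) t'(2) Q_def cQ _ J QV bc]) (use Qsub Q_def in blast)
qed

lemma curve_parity:
  assumes J: "jordan_curve \<Gamma>" and uv: "u \<in> V" "v \<in> V" "u \<noteq> v" "u \<notin> \<Gamma>" "v \<notin> \<Gamma>"
    and loc: "\<And>p. p \<in> curve u v \<inter> \<Gamma> \<Longrightarrow>
      \<exists>a b N. a \<in> V \<and> b \<in> V \<and> distinct [a, b, u, v] \<and> open N \<and> p \<in> N \<and> \<Gamma> \<inter> N = curve a b \<inter> N"
  shows "(u \<in> inside \<Gamma> \<longleftrightarrow> v \<in> inside \<Gamma>) \<longleftrightarrow> even (card (curve u v \<inter> \<Gamma>))"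
proof -
  note f = from_to(7,8)[OF uv(1-3)] and im = curve_props(7)[OF uv(1-3)]
  have "(from_to u v 0 \<in> inside \<Gamma> \<longleftrightarrow> from_to u v 1 \<in> inside \<Gamma>) \<longleftrightarrow> even (card (from_to u v ` {0..1} \<inter> \<Gamma>))"
    by (rule side_parity[OF J uv(1-3) order_refl zero_le_one order_refl]) (unfold f im, fact uv(4), fact uv(5), fact loc)
  then show ?thesis unfolding f im .
qed

lemma corner_flip:
  assumes J: "jordan_curve (Q \<union> curve a d)" and Q: "compact Q" "Q \<inter> V = {a, d}"
    and V: "a \<in> V" "d \<in> V" "f \<in> V" "g \<in> V" "distinct [a, d, f, g]" and off: "curve f g \<inter> Q = {}"
  shows "(f \<in> inside (Q \<union> curve a d) \<longleftrightarrow> g \<in> inside (Q \<union> curve a d)) \<longleftrightarrow> \<not> cross f g a d"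
proof -
  let ?G = "Q \<union> curve a d"
  have ne: "f \<noteq> g" "a \<noteq> d" using V by auto
  have "f \<notin> Q" "g \<notin> Q" using not_in_if_Int_eq[OF Q(2) V(3)] not_in_if_Int_eq[OF Q(2) V(4)] V(5) by auto
  moreover have "f \<notin> curve a d" "g \<notin> curve a d"
    using curve_props(5)[OF V(1,2) ne(2) V(3)] curve_props(5)[OF V(1,2) ne(2) V(4)] V(5) by auto
  ultimately have nin: "f \<notin> ?G" "g \<notin> ?G" by auto
  have int: "curve f g \<inter> ?G = curve f g \<inter> curve a d" using off by blast
  have fg: "distinct [f, g, a, d]" "distinct [a, d, f, g]" using V by auto
  have "(f \<in> inside ?G \<longleftrightarrow> g \<in> inside ?G) \<longleftrightarrow> even (card (curve f g \<inter> ?G))"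
  proof (rule curve_parity[OF J V(3,4) ne(1) nin])
    fix p assume p: "p \<in> curve f g \<inter> ?G"
    have "open (- Q)" "p \<in> - Q" "?G \<inter> - Q = curve a d \<inter> - Q"
      using open_Compl[OF compact_imp_closed[OF Q(1)]] p off by blast+
    then show "\<exists>a b N. a \<in> V \<and> b \<in> V \<and> distinct [a, b, f, g] \<and> open N \<and> p \<in> N \<and> ?G \<inter> N = curve a b \<inter> N"
      using V by blast
  qed
  also have "\<dots> \<longleftrightarrow> \<not> cross f g a d"
  proof (cases "cross f g a d")
    case True
    then obtain p where "curve f g \<inter> curve a d = {p}" using opposite_curves(2)[OF V(3,4,1,2) fg(1)] by blast
    then show ?thesis using True int by simp
  next
    case False
    then have "curve f g \<inter> curve a d = {}" using opposite_curves(1)[OF V(3,4,1,2) fg(1)] by blast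
    then show ?thesis using False int by simp
  qed
  finally show ?thesis .
qed

text \<open>
  An end of \<open>fg\<close> may coincide with the end \<open>b\<close> of \<open>ab\<close> as
  long as the piece \<open>Q\<close> of \<open>ab\<close> stops before \<open>b\<close>.
\<close>

lemma curve_off_arc:
  assumes V: "a \<in> V" "b \<in> V" "f \<in> V" "g \<in> V" "a \<noteq> b" "f \<noteq> g" "f \<noteq> a" "g \<noteq> a" "f \<noteq> b \<or> b \<notin> Q" "g \<noteq> b \<or> b \<notin> Q"
    and X: "distinct [f, g, a, b] \<Longrightarrow> \<not> cross f g a b"
  shows "curve f g \<inter> (curve a b \<inter> Q) = {}"
proof -
  consider "f = b" | "g = b" | "f \<noteq> b" "g \<noteq> b" by blast
  then show ?thesis
  proof cases
    case 1
    then have "curve f g \<inter> curve a b = {b}" using adjacent_curves[of b g a] V curve_commute[of a b] by auto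
    moreover have "b \<notin> Q" using 1 V(9) by simp
    ultimately show ?thesis by (metis Int_assoc Int_insert_left_if0 Int_empty_left)
  next
    case 2
    then have "curve f g \<inter> curve a b = {b}"
      using adjacent_curves[of b f a] V curve_commute[of a b] curve_commute[of f b] by auto
    moreover have "b \<notin> Q" using 2 V(10) by simp
    ultimately show ?thesis by (metis Int_assoc Int_insert_left_if0 Int_empty_left)
  next
    case 3
    then have "distinct [f, g, a, b]" using V by auto
    then have "curve f g \<inter> curve a b = {}" using opposite_curves(1)[OF V(3,4,1,2)] X by blast
    then show ?thesis by blast
  qed
qed

lemma curve_off_corner:
  assumes V: "a \<in> V" "b \<in> V" "c \<in> V" "d \<in> V" "distinct [a, b, c, d]"
    and Q: "Q \<subseteq> curve a b \<union> curve c d" "Q \<inter> V = {a, d}"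
    and fg: "f \<in> V" "g \<in> V" "f \<noteq> g" "f \<notin> {a, d}" "g \<notin> {a, d}"
    and X: "distinct [f, g, a, b] \<Longrightarrow> \<not> cross f g a b" "distinct [f, g, c, d] \<Longrightarrow> \<not> cross f g c d"
  shows "curve f g \<inter> Q = {}"
proof -
  have nin: "b \<notin> Q" "c \<notin> Q"
    using not_in_if_Int_eq[OF Q(2) V(2)] not_in_if_Int_eq[OF Q(2) V(3)] V(5) by auto
  have "curve f g \<inter> (curve a b \<inter> Q) = {}"
    by (rule curve_off_arc) (use V fg nin X(1) in auto)
  moreover have "curve f g \<inter> (curve d c \<inter> Q) = {}"
  proof (rule curve_off_arc)
    show "distinct [f, g, d, c] \<Longrightarrow> \<not> cross f g d c" using X(2) cross_commute3 by auto
  qed (use V fg nin in auto)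
  moreover have "curve d c = curve c d" by (rule curve_commute)
  ultimately show ?thesis using Q(1) by blast
qed

lemma pendant_off_corner:
  assumes V: "a \<in> V" "b \<in> V" "c \<in> V" "d \<in> V" "g \<in> V" "distinct [a, b, c, d, g]"
    and Q: "Q \<subseteq> curve a b \<union> curve c d" and X: "\<not> cross a g c d"
  shows "(curve a g - {a}) \<inter> (Q \<union> curve a d) = {}"
proof -
  have "curve a g \<inter> curve a d = {a}" "curve a g \<inter> curve a b = {a}"
    using adjacent_curves[of a g d] adjacent_curves[of a g b] V by auto
  moreover have "curve a g \<inter> curve c d = {}" using opposite_curves(1)[of a g c d] V X by auto
  ultimately show ?thesis using Q by blast
qed

text \<open>
  An edge \<open>bc\<close> that crosses \<open>ad\<close> would separate \<open>b\<close> from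
  \<open>c\<close> with respect to the corner curve, as it meets that curve nowhere else.
\<close>

lemma no_two_crossings:
  assumes "a \<in> V" "b \<in> V" "c \<in> V" "d \<in> V" "distinct [a, b, c, d]" "cross a b c d"
  shows "\<not> cross b c a d"
proof -
  obtain Q where Q: "compact Q" "Q \<subseteq> curve a b \<union> curve c d" "jordan_curve (Q \<union> curve a d)" "Q \<inter> V = {a, d}"
    "b \<in> inside (Q \<union> curve a d) \<longleftrightarrow> c \<in> inside (Q \<union> curve a d)"
    using corner[OF assms] by metis
  have "curve b c \<inter> Q = {}" by (rule curve_off_corner[OF assms(1-5) Q(2,4)]) (use assms in auto)
  then show ?thesis using corner_flip[OF Q(3,1,4), of b c] assms Q(5) by auto
qed

text \<open>
  As \<open>b\<close> and \<open>c\<close> are on the same side of the corner curve, and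
  \<open>be\<close> and \<open>ce\<close> can meet this curve only on \<open>ad\<close>, either both
  of them or none of them cross \<open>ad\<close>.
\<close>

lemma corner_rule:
  assumes V: "a \<in> V" "b \<in> V" "c \<in> V" "d \<in> V" "e \<in> V" "distinct [a, b, c, d, e]"
    and X: "cross a b c d" "\<not> cross b e c d" "\<not> cross c e a b"
  shows "cross b e a d \<longleftrightarrow> cross c e a d"
proof -
  have d4: "distinct [a, b, c, d]" using V by auto
  obtain Q where Q: "compact Q" "Q \<subseteq> curve a b \<union> curve c d" "jordan_curve (Q \<union> curve a d)" "Q \<inter> V = {a, d}"
    "b \<in> inside (Q \<union> curve a d) \<longleftrightarrow> c \<in> inside (Q \<union> curve a d)"
    using corner[OF V(1-4) d4 X(1)] by metis
  have "curve b e \<inter> Q = {}" by (rule curve_off_corner[OF V(1-4) d4 Q(2,4)]) (use V X in auto)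
  moreover have "curve c e \<inter> Q = {}" by (rule curve_off_corner[OF V(1-4) d4 Q(2,4)]) (use V X in auto)
  ultimately show ?thesis
    using corner_flip[OF Q(3,1,4), of b e] corner_flip[OF Q(3,1,4), of c e] V Q(5) by auto
qed

text \<open>
  Say that \<open>j\<close> blocks \<open>z\<close> if the edge from \<open>o'\<close> to
  \<open>j\<close> crosses \<open>vz\<close>. The vertex \<open>z\<close> blocks \<open>k\<close>,
  which gives a corner curve with side \<open>vz\<close>. With respect to it, \<open>l\<close> is on
  the side opposite to \<open>o'\<close>, together with the whole edge \<open>vl\<close>. The edge
  from \<open>o'\<close> to \<open>j\<close> meets \<open>vl\<close>, so it has to pass through
  \<open>vz\<close>.
\<close>

lemma blocker_transitivity:
  assumes V: "o' \<in> V" "v \<in> V" "z \<in> V" "k \<in> V" "l \<in> V" "j \<in> V" "distinct [o', v, z, k, l]" "j \<notin> {o', v, z, l}"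
    and X: "cross o' z v k" "cross o' l v z" "cross o' j v l" "j = k \<or> \<not> cross o' j v k" "\<not> cross o' l v k"
  shows "cross o' j v z"
proof (rule ccontr)
  assume nX: "\<not> cross o' j v z"
  have d4: "distinct [v, k, o', z]" using V by auto
  have X': "cross v k o' z" using X(1) cross_commute2 by simp
  obtain Q where Q: "compact Q" "Q \<subseteq> curve v k \<union> curve o' z" "jordan_curve (Q \<union> curve v z)" "Q \<inter> V = {v, z}"
    using corner[OF V(2,4,1,3) d4 X'] by metis
  have l: "curve o' l \<inter> Q = {}" by (rule curve_off_corner[OF V(2,4,1,3) d4 Q(2,4)]) (use V X in auto)
  have j: "curve o' j \<inter> Q = {}" by (rule curve_off_corner[OF V(2,4,1,3) d4 Q(2,4)]) (use V X in auto)
  have opp: "(o' \<in> inside (Q \<union> curve v z)) \<noteq> (l \<in> inside (Q \<union> curve v z))"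
    using corner_flip[OF Q(3,1,4) V(2,3,1,5) _ l] V X(2) by auto
  have "curve o' j \<inter> curve v z = {}" using opposite_curves(1)[of o' j v z] V nX by auto
  then have oj: "curve o' j \<inter> (Q \<union> curve v z) = {}" using j by blast
  have "\<not> cross v l o' z"
    using no_two_crossings[of o' l v z] X(2) V cross_commute1[of v l] by auto
  then have vl: "(curve v l - {v}) \<inter> (Q \<union> curve v z) = {}"
    by (intro pendant_off_corner[OF V(2,4,1,3,5) _ Q(2)]) (use V in auto)
  obtain p where p: "curve o' j \<inter> curve v l = {p}" "p \<notin> V"
    using opposite_curves(2)[of o' j v l] X(3) V by auto
  have ne: "o' \<noteq> j" "v \<noteq> l" using V by auto
  have "o' \<in> inside (Q \<union> curve v z) \<longleftrightarrow> p \<in> inside (Q \<union> curve v z)"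
    by (rule connected_off_curve_one_side[OF curve_props(2)[OF V(1,6) ne(1)] oj])
       (use p curve_props(3)[OF V(1,6) ne(1)] in auto)
  moreover have "l \<in> inside (Q \<union> curve v z) \<longleftrightarrow> p \<in> inside (Q \<union> curve v z)"
    by (rule connected_off_curve_one_side[OF curve_props(6)[OF V(2,5) ne(2)] vl])
       (use p V curve_props(4)[OF V(2,5) ne(2)] in auto)
  ultimately show False using opp by simp
qed

text \<open>
  Small enough that within the disc around \<open>c\<close> nothing is seen of the drawing except the
  edges at \<open>c\<close>, and that each of these leaves the disc.
\<close>

definition good_radius :: "complex \<Rightarrow> real \<Rightarrow> bool" where
  "good_radius c \<epsilon> \<longleftrightarrow> \<epsilon> > 0 \<and> (\<forall>k\<in>V - {c}. dist c k > \<epsilon>) \<and>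
     (\<forall>u\<in>V - {c}. \<forall>v\<in>V - {c}. u \<noteq> v \<longrightarrow> curve u v \<inter> cball c \<epsilon> = {})"

lemma good_radius_exists:
  assumes "c \<in> V"
  obtains \<epsilon> where "good_radius c \<epsilon>"
proof -
  define K where "K = (V - {c}) \<union> (\<Union>(u, v) \<in> {(u, v). u \<in> V - {c} \<and> v \<in> V - {c} \<and> u \<noteq> v}. curve u v)"
  have fin: "finite {(u, v). u \<in> V - {c} \<and> v \<in> V - {c} \<and> u \<noteq> v}"
    by (rule finite_subset[of _ "V \<times> V"]) (use finite_vertices in auto)
  have "closed K" unfolding K_def
    using finite_vertices fin curve_props(1) by (intro closed_Un closed_UN) (auto intro: finite_imp_closed compact_imp_closed)
  then have "open (- K)" by (rule open_Compl)
  moreover have "c \<in> - K" unfolding K_def using curve_props(5) assms by auto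
  ultimately obtain r where r: "r > 0" "ball c r \<subseteq> - K" by (meson open_contains_ball)
  have "good_radius c (r/2)" unfolding good_radius_def
  proof (intro conjI ballI impI)
    have sub: "cball c (r/2) \<inter> K = {}" using r by (force simp: disjoint_iff)
    show "dist c k > r/2" if "k \<in> V - {c}" for k
      using sub that unfolding K_def by (force simp: disjoint_iff not_le[symmetric])
    show "curve u v \<inter> cball c (r/2) = {}" if "u \<in> V - {c}" "v \<in> V - {c}" "u \<noteq> v" for u v
      using sub that unfolding K_def by fast
  qed (use r in auto)
  then show thesis by (rule that)
qed

definition rotation :: "complex \<Rightarrow> real \<Rightarrow> complex \<Rightarrow> real" where
  "rotation c \<epsilon> k = exit_angle c \<epsilon> (from_to c k)"

lemma star_of_edges:
  assumes "c \<in> V" "good_radius c \<epsilon>"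
  shows "star_of_arcs c \<epsilon> (from_to c ` (V - {c}))"
    "inj_on (from_to c) (V - {c})" "inj_on (rotation c \<epsilon>) (V - {c})"
proof -
  have ft: "arc (from_to c k)" "pathstart (from_to c k) = c" "pathfinish (from_to c k) = k"
     "path_image (from_to c k) = curve c k" if "k \<in> V - {c}" for k
    using from_to[of c k] that assms(1) by auto
  show inj: "inj_on (from_to c) (V - {c})" using ft(3) by (metis inj_onI)
  show S: "star_of_arcs c \<epsilon> (from_to c ` (V - {c}))"
    unfolding star_of_arcs_def
  proof (intro conjI ballI impI)
    fix f g assume "f \<in> from_to c ` (V - {c})" "g \<in> from_to c ` (V - {c})" "f \<noteq> g"
    then obtain k l where "k \<in> V - {c}" "l \<in> V - {c}" "f = from_to c k" "g = from_to c l" "k \<noteq> l" by blast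
    then show "path_image f \<inter> path_image g = {c}" using adjacent_curves[of c k l] ft(4) assms(1) by auto
  qed (use assms(2) ft in \<open>auto simp: good_radius_def\<close>)
  show "inj_on (rotation c \<epsilon>) (V - {c})"
  proof (rule inj_onI)
    fix k l assume "k \<in> V - {c}" "l \<in> V - {c}" "rotation c \<epsilon> k = rotation c \<epsilon> l"
    then show "k = l" using distinct_exits(2)[OF S, of "from_to c k" "from_to c l"] inj
      unfolding rotation_def by (metis image_eqI inj_onD)
  qed
qed

lemma germ_sides:
  assumes c: "c \<in> V" "good_radius c \<epsilon>"
    and V: "i \<in> V" "j \<in> V" "k \<in> V" "l \<in> V" "distinct [c, i, j, k]" "distinct [c, i, j, l]"
    and M: "compact M" "connected M" "M \<inter> cball c \<epsilon> = {}"
    and s: "from_to c i s \<in> M" "0 \<le> s" "s \<le> 1" "from_to c j s' \<in> M" "0 \<le> s'" "s' \<le> 1"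
    and \<Gamma>: "\<Gamma> = from_to c i ` {0..s} \<union> M \<union> from_to c j ` {0..s'}" and J: "jordan_curve \<Gamma>"
  obtains x y where "x \<in> curve c k - {c}" "y \<in> curve c l - {c}" "x \<notin> \<Gamma>" "y \<notin> \<Gamma>"
    "x = from_to c k (exit_time c \<epsilon> (from_to c k))" "y = from_to c l (exit_time c \<epsilon> (from_to c l))"
    "(x \<in> inside \<Gamma> \<longleftrightarrow> y \<in> inside \<Gamma>) \<longleftrightarrow>
      \<not> separated (rotation c \<epsilon> i) (rotation c \<epsilon> j) (rotation c \<epsilon> k) (rotation c \<epsilon> l)"
proof -
  note S = star_of_edges[OF c]
  have mem: "i \<in> V - {c}" "j \<in> V - {c}" "k \<in> V - {c}" "l \<in> V - {c}" using V by auto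
  have F: "from_to c i \<in> from_to c ` (V - {c})" "from_to c j \<in> from_to c ` (V - {c})"
    "from_to c k \<in> from_to c ` (V - {c})" "from_to c l \<in> from_to c ` (V - {c})" using mem by auto
  have ne: "from_to c i \<noteq> from_to c j" "from_to c k \<noteq> from_to c i" "from_to c k \<noteq> from_to c j"
    "from_to c l \<noteq> from_to c i" "from_to c l \<noteq> from_to c j"
    using inj_onD[OF S(2)] mem V by (metis distinct_length_2_or_more)+
  let ?x = "exit_point c \<epsilon> (from_to c k)" and ?y = "exit_point c \<epsilon> (from_to c l)"
  have iff: "connected_component (- \<Gamma>) ?x ?y \<longleftrightarrow>
      \<not> separated (rotation c \<epsilon> i) (rotation c \<epsilon> j) (rotation c \<epsilon> k) (rotation c \<epsilon> l)"
    unfolding rotation_def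
    by (rule germs_same_side_iff[OF S(1) F ne M s \<Gamma> germ_props(8)[OF S(1) F(3)] germ_props(8)[OF S(1) F(4)]])
  have in_curve: "exit_point c \<epsilon> (from_to c w) \<in> curve c w - {c}" if "w \<in> V - {c}" for w
    using germ_props(7,8)[OF S(1) imageI[OF that]] from_to(4)[of c w] that c(1) by auto
  have off: "exit_point c \<epsilon> (from_to c w) \<notin> \<Gamma>" if w: "w \<in> V - {c}" "w \<noteq> i" "w \<noteq> j" for w
  proof -
    have "exit_point c \<epsilon> (from_to c w) \<in> cball c \<epsilon>" using star_arcD(8)[OF S(1) imageI[OF w(1)]] by auto
    then have "exit_point c \<epsilon> (from_to c w) \<notin> M" using M(3) by blast
    moreover have "curve c w \<inter> curve c i = {c}" "curve c w \<inter> curve c j = {c}"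
      using adjacent_curves[of c w i] adjacent_curves[of c w j] w mem c(1) by auto
    then have "exit_point c \<epsilon> (from_to c w) \<notin> curve c i \<union> curve c j" using in_curve[OF w(1)] by blast
    moreover have "{0..s} \<subseteq> {0..1}" "{0..s'} \<subseteq> {0..1}" using s by auto
    then have "from_to c i ` {0..s} \<subseteq> curve c i" "from_to c j ` {0..s'} \<subseteq> curve c j"
      using curve_props(7)[of c i] curve_props(7)[of c j] mem c(1)
      by (metis DiffD1 DiffD2 image_mono singletonI)+
    ultimately show ?thesis unfolding \<Gamma> by blast
  qed
  have nx: "?x \<notin> \<Gamma>" "?y \<notin> \<Gamma>" using off mem V by auto
  have "connected_component (- \<Gamma>) ?x ?y \<longleftrightarrow> (?x \<in> inside \<Gamma> \<longleftrightarrow> ?y \<in> inside \<Gamma>)"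
    using same_side_connected_component[OF J nx] by (meson connected_component_sym inside_same_component)
  then show thesis
    using that[of ?x ?y] iff nx in_curve[OF mem(3)] in_curve[OF mem(4)] unfolding exit_point_def by simp
qed

text \<open>
  The parity of crossings between \<open>ij\<close> and \<open>kl\<close> is determined by the star
  at \<open>c\<close>. In the triangle with corners \<open>c\<close>, \<open>i\<close>,
  \<open>j\<close>, the sides of the germs towards \<open>k\<close> and \<open>l\<close> are given
  by the rotation; each of the edges to \<open>k\<close> and \<open>l\<close> changes side if it
  crosses \<open>ij\<close>; and the edge \<open>kl\<close> changes side at every side of the
  triangle that it crosses.
\<close>

lemma cross_formula:
  assumes c: "c \<in> V" "good_radius c \<epsilon>"
    and V: "i \<in> V" "j \<in> V" "k \<in> V" "l \<in> V" "distinct [c, i, j, k, l]"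
  shows "cross i j k l \<longleftrightarrow> (separated (rotation c \<epsilon> i) (rotation c \<epsilon> j) (rotation c \<epsilon> k) (rotation c \<epsilon> l)
     \<noteq> (cross c k i j \<noteq> (cross c l i j \<noteq> (cross c i k l \<noteq> cross c j k l))))"
proof -
  define \<Gamma> where "\<Gamma> = curve c i \<union> curve i j \<union> curve c j"
  have ne: "c \<noteq> i" "i \<noteq> j" "c \<noteq> j" "j \<noteq> c" "c \<noteq> k" "c \<noteq> l" "k \<noteq> l" using V by auto
  note cci = curve_props[OF c(1) V(1) ne(1)] and cij = curve_props[OF V(1,2) ne(2)] and ccj = curve_props[OF c(1) V(2) ne(3)]
  have J: "jordan_curve \<Gamma>"
  proof -
    note f1 = from_to[OF c(1) V(1) ne(1)] and f2 = from_to[OF V(1,2) ne(2)] and f3 = from_to[OF V(2) c(1) ne(4)]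
    have "jordan_curve (path_image (from_to c i) \<union> path_image (from_to i j) \<union> path_image (from_to j c))"
    proof (rule jordan_curve_of_three_arcs[OF f1(1) f2(1) f3(1)])
      show "path_image (from_to c i) \<inter> path_image (from_to i j) \<subseteq> {pathfinish (from_to c i)}"
        unfolding f1 f2 using adjacent_curves[of i c j] c V curve_commute[of c i] by auto
      show "path_image (from_to i j) \<inter> path_image (from_to j c) \<subseteq> {pathfinish (from_to i j)}"
        unfolding f2 f3 using adjacent_curves[of j i c] c V curve_commute[of i j] by auto
      show "path_image (from_to j c) \<inter> path_image (from_to c i) \<subseteq> {pathfinish (from_to j c)}"
        unfolding f1 f3 using adjacent_curves[of c j i] c V curve_commute[of j c] by auto
    qed (use f1 f2 f3 in auto)
    then show ?thesis unfolding f1 f2 f3 \<Gamma>_def using curve_commute[of j c] by simp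
  qed
  have \<Gamma>V: "w \<notin> \<Gamma>" if "w \<in> V" "w \<notin> {c, i, j}" for w
    using that cci(5) cij(5) ccj(5) unfolding \<Gamma>_def by auto
  have cl: "closed (curve c i)" "closed (curve i j)" "closed (curve c j)" using cci(1) cij(1) ccj(1) by (auto intro: compact_imp_closed)
  \<comment> \<open>The edge \<open>kl\<close> meets the triangle once for each side that it crosses.\<close>
  have kl: "(k \<in> inside \<Gamma> \<longleftrightarrow> l \<in> inside \<Gamma>) \<longleftrightarrow> \<not> (cross i j k l \<noteq> (cross c i k l \<noteq> cross c j k l))"
  proof -
    have op: "(cross a b k l \<longrightarrow> (\<exists>p. curve k l \<inter> curve a b = {p} \<and> p \<notin> V)) \<and> (\<not> cross a b k l \<longrightarrow> curve k l \<inter> curve a b = {})"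
      if "a \<in> V" "b \<in> V" "distinct [a, b, k, l]" for a b
      using opposite_curves[OF that(1,2) V(3,4) that(3)] by (metis Int_commute)
    have o1: "curve k l \<inter> curve i j = {} \<and> \<not> cross i j k l \<or> (\<exists>p. curve k l \<inter> curve i j = {p} \<and> p \<notin> V) \<and> cross i j k l"
      and o2: "curve k l \<inter> curve c i = {} \<and> \<not> cross c i k l \<or> (\<exists>p. curve k l \<inter> curve c i = {p} \<and> p \<notin> V) \<and> cross c i k l"
      and o3: "curve k l \<inter> curve c j = {} \<and> \<not> cross c j k l \<or> (\<exists>p. curve k l \<inter> curve c j = {p} \<and> p \<notin> V) \<and> cross c j k l"
      using op[of i j] op[of c i] op[of c j] c V by auto
    have adj: "curve i j \<inter> curve c i = {i}" "curve i j \<inter> curve c j = {j}" "curve c i \<inter> curve c j = {c}"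
      using adjacent_curves[of i j c] adjacent_curves[of j i c] adjacent_curves[of c i j] c V
        curve_commute[of i c] curve_commute[of j i] curve_commute[of j c] by auto
    have dij: "distinct [i, j, k, l]" "distinct [c, i, k, l]" "distinct [c, j, k, l]" using V by auto
    have nV: "p \<notin> V" if "a \<in> V" "b \<in> V" "distinct [a, b, k, l]" "p \<in> curve k l" "p \<in> curve a b" for a b p
      using op[OF that(1-3)] that(4,5) by (metis IntI empty_iff singletonD)
    have sep: "p \<notin> curve c i" "p \<notin> curve c j" if "p \<in> curve k l" "p \<in> curve i j" for p
      using nV[OF V(1,2) dij(1) that] adj(1,2) that(2) V(1,2) by (metis IntI singletonD)+
    have sep': "p \<notin> curve c j" if "p \<in> curve k l" "p \<in> curve c i" for p
      using nV[OF c(1) V(1) dij(2) that] adj(3) that(2) c(1) by (metis IntI singletonD)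
    have "(k \<in> inside \<Gamma> \<longleftrightarrow> l \<in> inside \<Gamma>) \<longleftrightarrow> even (card (curve k l \<inter> \<Gamma>))"
    proof (rule curve_parity[OF J V(3,4) ne(7)])
      show "k \<notin> \<Gamma>" "l \<notin> \<Gamma>" using \<Gamma>V V by auto
      fix p assume p: "p \<in> curve k l \<inter> \<Gamma>"
      then have pk: "p \<in> curve k l" by blast
      consider "p \<in> curve i j" | "p \<in> curve c i" | "p \<in> curve c j" using p unfolding \<Gamma>_def by blast
      then show "\<exists>a b N. a \<in> V \<and> b \<in> V \<and> distinct [a, b, k, l] \<and> open N \<and> p \<in> N \<and> \<Gamma> \<inter> N = curve a b \<inter> N"
      proof cases
        case 1
        have "open (- (curve c i \<union> curve c j))" using cl by (intro open_Compl closed_Un)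
        moreover have "p \<in> - (curve c i \<union> curve c j)" using sep[OF pk 1] by blast
        moreover have "\<Gamma> \<inter> - (curve c i \<union> curve c j) = curve i j \<inter> - (curve c i \<union> curve c j)" unfolding \<Gamma>_def by blast
        ultimately show ?thesis using V(1,2) dij(1) by blast
      next
        case 2
        have "open (- (curve i j \<union> curve c j))" using cl by (intro open_Compl closed_Un)
        moreover have "p \<in> - (curve i j \<union> curve c j)" using sep[OF pk] sep'[OF pk 2] 2 by blast
        moreover have "\<Gamma> \<inter> - (curve i j \<union> curve c j) = curve c i \<inter> - (curve i j \<union> curve c j)" unfolding \<Gamma>_def by blast
        ultimately show ?thesis using c(1) V(1) dij(2) by blast
      next
        case 3
        have "open (- (curve i j \<union> curve c i))" using cl by (intro open_Compl closed_Un)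
        moreover have "p \<in> - (curve i j \<union> curve c i)" using sep[OF pk] sep'[OF pk] 3 by blast
        moreover have "\<Gamma> \<inter> - (curve i j \<union> curve c i) = curve c j \<inter> - (curve i j \<union> curve c i)" unfolding \<Gamma>_def by blast
        ultimately show ?thesis using c(1) V(2) dij(3) by blast
      qed
    qed
    also have "card (curve k l \<inter> \<Gamma>) = card (curve k l \<inter> curve i j) + card (curve k l \<inter> curve c i) + card (curve k l \<inter> curve c j)"
    proof -
      have fin: "finite (curve k l \<inter> curve i j)" "finite (curve k l \<inter> curve c i)" "finite (curve k l \<inter> curve c j)"
        using o1 o2 o3 by (metis finite.simps)+
      have d1: "(curve k l \<inter> curve i j) \<inter> (curve k l \<inter> curve c i) = {}" using sep(1) by blast
      have d2: "(curve k l \<inter> curve i j \<union> curve k l \<inter> curve c i) \<inter> (curve k l \<inter> curve c j) = {}" using sep(2) sep' by blast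
      have "curve k l \<inter> \<Gamma> = (curve k l \<inter> curve i j \<union> curve k l \<inter> curve c i) \<union> (curve k l \<inter> curve c j)" unfolding \<Gamma>_def by blast
      then show ?thesis using card_Un_disjoint[OF _ fin(3) d2] card_Un_disjoint[OF fin(1,2) d1] fin by simp
    qed
    also have "even \<dots> \<longleftrightarrow> \<not> (cross i j k l \<noteq> (cross c i k l \<noteq> cross c j k l))"
    proof -
      have "odd (card (curve k l \<inter> curve i j)) = cross i j k l" "odd (card (curve k l \<inter> curve c i)) = cross c i k l"
        "odd (card (curve k l \<inter> curve c j)) = cross c j k l" using o1 o2 o3 by auto
      then show ?thesis by (simp add: even_add) blast
    qed
    finally show ?thesis .
  qed
  \<comment> \<open>An edge at \<open>c\<close> can leave the side of its germ only through the opposite side \<open>ij\<close> of the triangle.\<close>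
  have M: "curve i j \<inter> cball c \<epsilon> = {}" using c(2) V unfolding good_radius_def by auto
  have one: "from_to c i 1 \<in> curve i j" "from_to c j 1 \<in> curve i j" 
    using from_to(8)[OF c(1) V(1) ne(1)] from_to(8)[OF c(1) V(2) ne(3)] cij(3,4) by auto
  have d: "distinct [c, i, j, k]" "distinct [c, i, j, l]" using V by auto
  obtain x y where xy: "x \<in> curve c k - {c}" "y \<in> curve c l - {c}" "x \<notin> \<Gamma>" "y \<notin> \<Gamma>"
    "x = from_to c k (exit_time c \<epsilon> (from_to c k))" "y = from_to c l (exit_time c \<epsilon> (from_to c l))"
    "(x \<in> inside \<Gamma> \<longleftrightarrow> y \<in> inside \<Gamma>) \<longleftrightarrow>
      \<not> separated (rotation c \<epsilon> i) (rotation c \<epsilon> j) (rotation c \<epsilon> k) (rotation c \<epsilon> l)"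
    by (rule germ_sides[OF c V(1-4) d cij(1,2) M one(1) _ _ one(2) _ _ _ J])
       (use cci(7) ccj(7) in \<open>auto simp: \<Gamma>_def\<close>)
  have germ_end: "(from_to c w (exit_time c \<epsilon> (from_to c w)) \<in> inside \<Gamma> \<longleftrightarrow> w \<in> inside \<Gamma>) \<longleftrightarrow> \<not> cross c w i j"
    if w: "w \<in> V" "distinct [c, w, i, j]" and off: "from_to c w (exit_time c \<epsilon> (from_to c w)) \<notin> \<Gamma>" for w
  proof -
    let ?t = "exit_time c \<epsilon> (from_to c w)"
    have cw: "c \<noteq> w" "w \<in> V - {c}" using w by auto
    note S = star_arcD[OF star_of_edges(1)[OF c] imageI[OF cw(2)]]
    note fw = from_to[OF c(1) w(1) cw(1)] and cu = curve_props[OF c(1) w(1) cw(1)]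
    have wi: "curve c w \<inter> curve c i = {c}" "curve c w \<inter> curve c j = {c}"
      using adjacent_curves[of c w i] adjacent_curves[of c w j] w c V by auto
    have sub: "from_to c w ` {?t..1} \<subseteq> curve c w - {c}"
      using S(6,10) cu(7) by force
    have int: "from_to c w ` {?t..1} \<inter> \<Gamma> = curve c w \<inter> curve i j"
    proof
      show "from_to c w ` {?t..1} \<inter> \<Gamma> \<subseteq> curve c w \<inter> curve i j"
        using sub wi unfolding \<Gamma>_def by blast
      have "p \<in> from_to c w ` {?t..1}" if p: "p \<in> curve c w \<inter> curve i j" for p
      proof -
        obtain s where s: "s \<in> {0..1}" "p = from_to c w s" using p cu(7) by blast
        have "dist c p > \<epsilon>" using M p by auto
        then have "?t \<le> s" using S(9)[of s] s by force
        then show ?thesis using s by auto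
      qed
      then show "curve c w \<inter> curve i j \<subseteq> from_to c w ` {?t..1} \<inter> \<Gamma>" unfolding \<Gamma>_def by blast
    qed
    have w1: "from_to c w 1 = w" "w \<notin> \<Gamma>" using fw(8) \<Gamma>V w by auto
    have d4: "distinct [i, j, c, w]" using w by auto
    have "(from_to c w ?t \<in> inside \<Gamma> \<longleftrightarrow> from_to c w 1 \<in> inside \<Gamma>) \<longleftrightarrow> even (card (from_to c w ` {?t..1} \<inter> \<Gamma>))"
    proof (rule side_parity[OF J c(1) w(1) cw(1)])
      fix p assume p: "p \<in> from_to c w ` {?t..1} \<inter> \<Gamma>"
      have "open (- (curve c i \<union> curve c j))" using cl by (intro open_Compl closed_Un)
      moreover have "p \<in> - (curve c i \<union> curve c j)" using p sub wi by blast
      moreover have "\<Gamma> \<inter> - (curve c i \<union> curve c j) = curve i j \<inter> - (curve c i \<union> curve c j)" unfolding \<Gamma>_def by blast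
      ultimately show "\<exists>a b N. a \<in> V \<and> b \<in> V \<and> distinct [a, b, c, w] \<and> open N \<and> p \<in> N \<and> \<Gamma> \<inter> N = curve a b \<inter> N"
        using V d4 by metis
    qed (use S(6,7) off w1 in auto)
    also have "\<dots> \<longleftrightarrow> \<not> cross c w i j"
      unfolding int using opposite_curves[OF c(1) w(1) V(1,2) w(2)] by (cases "cross c w i j") auto
    finally show ?thesis unfolding w1(1) .
  qed
  have "(x \<in> inside \<Gamma> \<longleftrightarrow> k \<in> inside \<Gamma>) \<longleftrightarrow> \<not> cross c k i j" "(y \<in> inside \<Gamma> \<longleftrightarrow> l \<in> inside \<Gamma>) \<longleftrightarrow> \<not> cross c l i j"
    using germ_end[of k] germ_end[of l] xy(3-6) V by auto
  then show ?thesis using kl xy(7) by argo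
qed

text \<open>
  Here \<open>z\<close> blocks \<open>a\<close> and \<open>b\<close> blocks \<open>w\<close>. The
  corner curve at \<open>c\<close> made of the crossing of \<open>va\<close> with the edge to
  \<open>z\<close> separates the germs towards \<open>b\<close> and \<open>w\<close>. The edge
  \<open>vw\<close> does not meet this curve again but meets the edge to \<open>b\<close>, so
  \<open>b\<close> and \<open>w\<close> are on the same side, and the edge to \<open>w\<close> must
  have crossed \<open>va\<close>.
\<close>

lemma interlocked_blockers_rule:
  assumes c: "c \<in> V" "good_radius c \<epsilon>"
    and V: "v \<in> V" "z \<in> V" "a \<in> V" "b \<in> V" "w \<in> V" "distinct [c, v, z, a, b, w]"
    and X: "cross c z v a" "cross c b v w" "\<not> cross c z v w" "\<not> cross c b v a"
    and sep: "separated (rotation c \<epsilon> v) (rotation c \<epsilon> z) (rotation c \<epsilon> b) (rotation c \<epsilon> w)"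
  shows "cross c w v a"
proof (rule ccontr)
  assume nX: "\<not> cross c w v a"
  have d4: "distinct [c, z, a, v]" using V by auto
  have X': "cross c z a v" using X(1) cross_commute3[of c z a v] by simp
  obtain p t t' Q where t: "0 < t" "t < 1" "0 < t'" "t' < 1" "from_to c z t = p" "from_to v a t' = p"
    and Qd: "Q = from_to c z ` {0..t} \<union> from_to v a ` {0..t'}" and Q: "compact Q" "Q \<subseteq> curve c z \<union> curve a v"
    and J: "jordan_curve (Q \<union> curve c v)" and QV: "Q \<inter> V = {c, v}"
    using corner[OF c(1) V(2,3,1) d4 X'] by metis
  have ne: "v \<noteq> a" "c \<noteq> v" "v \<noteq> w" "c \<noteq> b" "c \<noteq> w" "a \<noteq> v" using V by auto
  define M where "M = from_to v a ` {0..t'}"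
  have cont: "continuous_on {0..t'} (from_to v a)"
    by (rule continuous_on_subset[OF from_to(5)[OF V(1,3) ne(1)]]) (use t in auto)
  have Msub: "M \<subseteq> curve v a" unfolding M_def using curve_props(7)[OF V(1,3) ne(1)] image_mono[of "{0..t'}" "{0..1}" "from_to v a"] t by auto
  have M: "compact M" "connected M" unfolding M_def using cont by (auto intro: compact_continuous_image connected_continuous_image)
  have "curve v a \<inter> cball c \<epsilon> = {}" using c(2) V unfolding good_radius_def by auto
  then have Mc: "M \<inter> cball c \<epsilon> = {}" using Msub by blast
  have s: "from_to c z t \<in> M" "from_to c v 1 \<in> M"
  proof -
    show "from_to c z t \<in> M" unfolding M_def using t by (metis atLeastAtMost_iff imageI less_imp_le order_refl)
    have "from_to v a 0 \<in> M" unfolding M_def using t by auto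
    then show "from_to c v 1 \<in> M" using from_to(8)[OF c(1) V(1) ne(2)] from_to(7)[OF V(1,3) ne(1)] by simp
  qed
  let ?G = "Q \<union> curve c v"
  have G: "?G = from_to c z ` {0..t} \<union> M \<union> from_to c v ` {0..1}"
    unfolding Qd M_def curve_props(7)[OF c(1) V(1) ne(2)] by blast
  have dd: "distinct [c, z, v, b]" "distinct [c, z, v, w]" using V by auto
  have sep': "separated (rotation c \<epsilon> z) (rotation c \<epsilon> v) (rotation c \<epsilon> b) (rotation c \<epsilon> w)"
    using sep unfolding separated_def by auto
  obtain x y where xy: "x \<in> curve c b - {c}" "y \<in> curve c w - {c}" "(x \<in> inside ?G) \<noteq> (y \<in> inside ?G)"
    by (rule germ_sides[OF c V(2,1,4,5) dd M Mc s(1) _ _ s(2) _ _ G J]) (use t sep' in auto)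
  have offb: "(curve c b - {c}) \<inter> ?G = {}"
    by (rule pendant_off_corner[OF c(1) V(2,3,1,4) _ Q(2)]) (use V X(4) cross_commute3[of c b a v] in auto)
  have offw: "(curve c w - {c}) \<inter> ?G = {}"
    by (rule pendant_off_corner[OF c(1) V(2,3,1,5) _ Q(2)]) (use V nX cross_commute3[of c w a v] in auto)
  have "(curve v w - {v}) \<inter> (Q \<union> curve v c) = {}"
  proof (rule pendant_off_corner[OF V(1,3,2) c(1) V(5)])
    show "Q \<subseteq> curve v a \<union> curve z c" using Q(2) curve_commute[of v a] curve_commute[of z c] by auto
    show "\<not> cross v w z c" using X(3) cross_commute2[of v w z c] cross_commute1[of z c v w] by simp
  qed (use V in auto)
  then have offv: "(curve v w - {v}) \<inter> ?G = {}" by (simp add: curve_commute[of v c])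
  have "distinct [c, b, v, w]" using V by auto
  then obtain q where q: "curve c b \<inter> curve v w = {q}" "q \<notin> V"
    using opposite_curves(2)[OF c(1) V(4,1,5)] X(2) by blast
  have qm: "q \<in> curve c b - {c}" "q \<in> curve v w - {v}" using q c V by auto
  have "x \<in> inside ?G \<longleftrightarrow> q \<in> inside ?G"
    by (rule connected_off_curve_one_side[OF curve_props(6)[OF c(1) V(4) ne(4)] offb xy(1) qm(1)])
  moreover have "y \<in> inside ?G \<longleftrightarrow> w \<in> inside ?G"
    by (rule connected_off_curve_one_side[OF curve_props(6)[OF c(1) V(5) ne(5)] offw xy(2)])
       (use curve_props(4)[OF c(1) V(5) ne(5)] ne in auto)
  moreover have "w \<in> inside ?G \<longleftrightarrow> q \<in> inside ?G"
    by (rule connected_off_curve_one_side[OF curve_props(6)[OF V(1,5) ne(3)] offv _ qm(2)])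
       (use curve_props(4)[OF V(1,5) ne(3)] ne in auto)
  ultimately show False using xy(3) by blast
qed

text \<open>
  The crossing of \<open>ve\<close> with \<open>xy\<close> yields a quadrilateral with corners
  \<open>c\<close>, \<open>v\<close>, the crossing point, and \<open>x\<close>. It separates the
  germs towards \<open>k\<close> and \<open>b\<close>, and neither of these edges crosses it. The
  edge \<open>vk\<close> stays on the side of \<open>k\<close>, so it cannot meet the edge to
  \<open>b\<close>.
\<close>

lemma quadrilateral_rule:
  assumes c: "c \<in> V" "good_radius c \<epsilon>"
    and V: "v \<in> V" "e \<in> V" "x \<in> V" "y \<in> V" "k \<in> V" "b \<in> V" "distinct [c, v, e, x, y, k]" "b \<notin> {c, v, x, k}"
    and X: "cross v e x y" "\<not> cross c v x y" "\<not> cross c x v e" "\<not> cross c k v e" "\<not> cross c k x y"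
      "b = e \<or> \<not> cross c b v e" "b = y \<or> \<not> cross c b x y" "\<not> cross v k x y" "\<not> cross c x v k"
    and sep: "separated (rotation c \<epsilon> v) (rotation c \<epsilon> x) (rotation c \<epsilon> k) (rotation c \<epsilon> b)"
  shows "\<not> cross c b v k"
proof
  assume bX: "cross c b v k"
  have d4: "distinct [v, e, y, x]" using V by auto
  have X': "cross v e y x" using X(1) cross_commute3[of v e x y] by simp
  obtain p t t' Q where t: "0 < t" "t < 1" "0 < t'" "t' < 1" "from_to v e t = p" "from_to x y t' = p"
    and Qd: "Q = from_to v e ` {0..t} \<union> from_to x y ` {0..t'}" and Q: "compact Q" "Q \<subseteq> curve v e \<union> curve y x"
    and QV: "Q \<inter> V = {v, x}"
    using corner[OF V(1,2,4,3) d4 X'] by metis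
  have ne: "v \<noteq> e" "x \<noteq> y" "c \<noteq> v" "c \<noteq> x" "x \<noteq> c" "c \<noteq> k" "c \<noteq> b" "v \<noteq> k" using V by auto
  note fe = from_to[OF V(1,2) ne(1)] and fx = from_to[OF V(3,4) ne(2)] and fc = from_to[OF c(1) V(1) ne(3)] and fh = from_to[OF V(3) c(1) ne(5)]
  have vp: "from_to v e ` {0..t} \<subseteq> curve v e" and xp: "from_to x y ` {0..t'} \<subseteq> curve x y"
    using curve_props(7)[OF V(1,2) ne(1)] image_mono[of "{0..t}" "{0..1}" "from_to v e"]
      curve_props(7)[OF V(3,4) ne(2)] image_mono[of "{0..t'}" "{0..1}" "from_to x y"] t by auto
  have conQ: "connected Q"
  proof -
    have "connected (from_to v e ` {0..t})" "connected (from_to x y ` {0..t'})" using t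
      by (auto intro!: connected_continuous_image continuous_on_subset[OF fe(5)] continuous_on_subset[OF fx(5)])
    moreover have "p \<in> from_to v e ` {0..t} \<inter> from_to x y ` {0..t'}" using t by (metis IntI atLeastAtMost_iff imageI less_imp_le order_refl)
    ultimately show ?thesis unfolding Qd by (intro connected_Un) auto
  qed
  have int: "curve c v \<inter> curve v e = {v}" "curve c v \<inter> curve x y = {}" "curve c x \<inter> curve v e = {}" "curve c x \<inter> curve x y = {x}"
    "curve c v \<inter> curve c x = {c}"
    using adjacent_curves[of v c e] adjacent_curves[of x c y] adjacent_curves[of c v x] curve_commute[of v c] curve_commute[of x c]
      opposite_curves(1)[of c v x y] opposite_curves(1)[of c x v e] X(2,3) c V by auto
  obtain r where r: "curve v e \<inter> curve x y = {r}" using opposite_curves(2)[of v e x y] X(1) V by auto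
  define \<Gamma> where "\<Gamma> = curve c v \<union> Q \<union> curve c x"
  have J: "jordan_curve \<Gamma>"
  proof -
    let ?g1 = "subpath 0 t (from_to v e)" and ?g2 = "subpath t' 0 (from_to x y)"
    have im: "path_image ?g1 = from_to v e ` {0..t}" "path_image ?g2 = from_to x y ` {0..t'}"
      using t by (auto simp: path_image_subpath)
    have pr: "p = r" using r vp xp t by (metis IntI atLeastAtMost_iff imageI less_imp_le order_refl singletonD subsetD)
    have "arc ?g1" "arc ?g2" using t fe(1) fx(1) by (auto intro!: arc_subpath_arc)
    moreover have "path_image ?g1 \<inter> path_image ?g2 \<subseteq> {pathstart ?g2}"
      unfolding im using vp xp r pr t(6) by auto
    ultimately have g: "arc (?g1 +++ ?g2)" using t by (intro arc_join) auto
    have img: "path_image (?g1 +++ ?g2) = Q" using t im Qd by (subst path_image_join) auto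
    have "jordan_curve (path_image (from_to c v) \<union> path_image (?g1 +++ ?g2) \<union> path_image (from_to x c))"
    proof (rule jordan_curve_of_three_arcs[OF fc(1) g fh(1)])
      have "curve c v \<inter> Q \<subseteq> {v}" "Q \<inter> curve c x \<subseteq> {x}" unfolding Qd using vp xp int by blast+
      then show "path_image (from_to c v) \<inter> path_image (?g1 +++ ?g2) \<subseteq> {pathfinish (from_to c v)}"
        "path_image (?g1 +++ ?g2) \<inter> path_image (from_to x c) \<subseteq> {pathfinish (?g1 +++ ?g2)}"
        unfolding img fc fh curve_commute[of x c] using fx(7) by auto
      show "path_image (from_to x c) \<inter> path_image (from_to c v) \<subseteq> {pathfinish (from_to x c)}"
        unfolding fc fh curve_commute[of x c] using int(5) by auto
    qed (use fc fh fe fx t in auto)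
    then show ?thesis unfolding img fc fh curve_commute[of x c] \<Gamma>_def .
  qed
  have Mc: "Q \<inter> cball c \<epsilon> = {}"
  proof -
    have gr: "curve u w \<inter> cball c \<epsilon> = {}" if "u \<in> V" "w \<in> V" "distinct [c, u, w]" for u w
      using c(2) that unfolding good_radius_def by auto
    have "curve v e \<inter> cball c \<epsilon> = {}" "curve y x \<inter> cball c \<epsilon> = {}"
      by (rule gr; use V in auto)+
    then show ?thesis using Q(2) by blast
  qed
  have s: "from_to c v 1 \<in> Q" "from_to c x 1 \<in> Q"
    using fc(8) from_to(8)[OF c(1) V(3) ne(4)] QV by auto
  have G: "\<Gamma> = from_to c v ` {0..1} \<union> Q \<union> from_to c x ` {0..1}"
    unfolding \<Gamma>_def curve_props(7)[OF c(1) V(1) ne(3)] curve_props(7)[OF c(1) V(3) ne(4)] ..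
  have dd: "distinct [c, v, x, k]" "distinct [c, v, x, b]" using V by auto
  obtain x' y' where xy: "x' \<in> curve c k - {c}" "y' \<in> curve c b - {c}" "(x' \<in> inside \<Gamma>) \<noteq> (y' \<in> inside \<Gamma>)"
    by (rule germ_sides[OF c V(1,3,5,6) dd Q(1) conQ Mc s(1) _ _ s(2) _ _ G J]) (use sep in auto)
  have off: "(curve c w - {c}) \<inter> \<Gamma> = {}"
    if w: "w \<in> V" "w \<notin> {c, v, x}" "w = e \<or> \<not> cross c w v e" "w = y \<or> \<not> cross c w x y" for w
  proof -
    have "curve c w \<inter> Q = {}"
      by (rule curve_off_corner[OF V(1,2,4,3) d4 Q(2) QV c(1) w(1)]) (use w V cross_commute3[of c w y x] in auto)
    moreover have "curve c w \<inter> curve c v = {c}" "curve c w \<inter> curve c x = {c}"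
      using adjacent_curves[of c w v] adjacent_curves[of c w x] w c V by auto
    ultimately show ?thesis unfolding \<Gamma>_def by blast
  qed
  have offk: "(curve c k - {c}) \<inter> \<Gamma> = {}" by (rule off) (use V X in auto)
  have offb: "(curve c b - {c}) \<inter> \<Gamma> = {}" by (rule off) (use V X in auto)
  have offv: "(curve v k - {v}) \<inter> \<Gamma> = {}"
  proof -
    have "curve v k \<inter> curve v e = {v}" "curve v k \<inter> curve c v = {v}"
      using adjacent_curves[of v k e] adjacent_curves[of v k c] curve_commute[of v c] c V by auto
    moreover have "curve v k \<inter> curve x y = {}" using opposite_curves(1)[of v k x y] X(8) V by auto
    moreover have "curve v k \<inter> curve c x = {}"
      using opposite_curves(1)[of c x v k] X(9) V c by auto
    ultimately show ?thesis unfolding \<Gamma>_def using Q(2) curve_commute[of x y] by blast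
  qed
  have "distinct [c, b, v, k]" using V by auto
  then obtain q where q: "curve c b \<inter> curve v k = {q}" "q \<notin> V"
    using opposite_curves(2)[OF c(1) V(6,1,5)] bX by blast
  have qm: "q \<in> curve c b - {c}" "q \<in> curve v k - {v}" using q c V by auto
  have "y' \<in> inside \<Gamma> \<longleftrightarrow> q \<in> inside \<Gamma>"
    by (rule connected_off_curve_one_side[OF curve_props(6)[OF c(1) V(6) ne(7)] offb xy(2) qm(1)])
  moreover have "x' \<in> inside \<Gamma> \<longleftrightarrow> k \<in> inside \<Gamma>"
    by (rule connected_off_curve_one_side[OF curve_props(6)[OF c(1) V(5) ne(6)] offk xy(1)])
       (use curve_props(4)[OF c(1) V(5) ne(6)] ne in auto)
  moreover have "k \<in> inside \<Gamma> \<longleftrightarrow> q \<in> inside \<Gamma>"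
    by (rule connected_off_curve_one_side[OF curve_props(6)[OF V(1,5) ne(8)] offv _ qm(2)])
       (use curve_props(4)[OF V(1,5) ne(8)] ne in auto)
  ultimately show False using xy(3) by blast
qed

end

section \<open>Uncrossed edges in crossing patterns\<close>

text \<open>
  What remains of a drawing once only crossings and the rotation \<open>\<rho>\<close> at a vertex
  \<open>c\<close> are kept; \<open>X p q r s\<close> stands for a crossing of \<open>pq\<close> and
  \<open>rs\<close>. The function \<open>\<rho>\<close> matters only through its cyclic order. A
  vertex \<open>j\<close> is said to block \<open>z\<close> (for fixed \<open>v\<close>) if
  \<open>cj\<close> crosses \<open>vz\<close>.
\<close>

locale crossing_pattern =
  fixes c :: 'a and W :: "'a set" and X :: "'a \<Rightarrow> 'a \<Rightarrow> 'a \<Rightarrow> 'a \<Rightarrow> bool" and \<rho> :: "'a \<Rightarrow> real"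
  assumes finite_W: "finite W" and c_notin: "c \<notin> W" and inj_\<rho>: "inj_on \<rho> W"
    and swap1: "X p q r s = X q p r s" and swap2: "X p q r s = X r s p q"
    and one_crossing: "\<lbrakk>p \<in> insert c W; q \<in> insert c W; r \<in> insert c W; s \<in> insert c W; distinct [p, q, r, s]; X p q r s\<rbrakk>
      \<Longrightarrow> \<not> X q r p s"
    and corner: "\<lbrakk>p \<in> insert c W; q \<in> insert c W; r \<in> insert c W; s \<in> insert c W; t \<in> insert c W; distinct [p, q, r, s, t];
      X p q r s; \<not> X q t r s; \<not> X r t p q\<rbrakk> \<Longrightarrow> X q t p s = X r t p s"
    and blockers_trans: "\<lbrakk>v \<in> W; z \<in> W; k \<in> W; l \<in> W; j \<in> W; distinct [v, z, k, l]; j \<notin> {v, z, l};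
      X c z v k; X c l v z; X c j v l; j = k \<or> \<not> X c j v k; \<not> X c l v k\<rbrakk> \<Longrightarrow> X c j v z"
    and interlocked_blockers: "\<lbrakk>v \<in> W; z \<in> W; k \<in> W; x \<in> W; w \<in> W; distinct [v, z, k, x, w];
      X c z v k; X c x v w; \<not> X c z v w; \<not> X c x v k; separated (\<rho> v) (\<rho> z) (\<rho> x) (\<rho> w)\<rbrakk> \<Longrightarrow> X c w v k"
    and quadrilateral: "\<lbrakk>v \<in> W; e \<in> W; x \<in> W; y \<in> W; k \<in> W; b \<in> W; distinct [v, e, x, y, k]; b \<notin> {v, x, k};
      X v e x y; \<not> X c v x y; \<not> X c x v e; \<not> X c k v e; \<not> X c k x y; b = e \<or> \<not> X c b v e; b = y \<or> \<not> X c b x y;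
      \<not> X v k x y; \<not> X c x v k; separated (\<rho> v) (\<rho> x) (\<rho> k) (\<rho> b)\<rbrakk> \<Longrightarrow> \<not> X c b v k"
    and formula: "\<lbrakk>p \<in> W; q \<in> W; r \<in> W; s \<in> W; distinct [p, q, r, s]\<rbrakk> \<Longrightarrow>
      X p q r s \<longleftrightarrow> (separated (\<rho> p) (\<rho> q) (\<rho> r) (\<rho> s) \<noteq> (X c r p q \<noteq> (X c s p q \<noteq> (X c p r s \<noteq> X c q r s))))"
begin

lemma swap3: "X p q r s = X p q s r"
  by (metis swap1 swap2)

lemma reorder:
  assumes "inj_on \<rho>' W"
    and "\<And>p q r s. \<lbrakk>p \<in> W; q \<in> W; r \<in> W; s \<in> W; p \<noteq> q; r \<notin> {p, q}; s \<notin> {p, q}\<rbrakk> \<Longrightarrow>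
      separated (\<rho>' p) (\<rho>' q) (\<rho>' r) (\<rho>' s) = separated (\<rho> p) (\<rho> q) (\<rho> r) (\<rho> s)"
  shows "crossing_pattern c W X \<rho>'"
proof
  fix v e x y k b
  assume "v \<in> W" "e \<in> W" "x \<in> W" "y \<in> W" "k \<in> W" "b \<in> W" "distinct [v, e, x, y, k]" "b \<notin> {v, x, k}"
      "X v e x y" "\<not> X c v x y" "\<not> X c x v e" "\<not> X c k v e" "\<not> X c k x y" "b = e \<or> \<not> X c b v e" "b = y \<or> \<not> X c b x y"
      "\<not> X v k x y" "\<not> X c x v k" "separated (\<rho>' v) (\<rho>' x) (\<rho>' k) (\<rho>' b)"
  then show "\<not> X c b v k" using assms(2)[of v x k b] quadrilateral[of v e x y k b] by auto
next
  fix v z k x w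
  assume "v \<in> W" "z \<in> W" "k \<in> W" "x \<in> W" "w \<in> W" "distinct [v, z, k, x, w]"
      "X c z v k" "X c x v w" "\<not> X c z v w" "\<not> X c x v k" "separated (\<rho>' v) (\<rho>' z) (\<rho>' x) (\<rho>' w)"
  then show "X c w v k" using assms(2)[of v z x w] interlocked_blockers[of v z k x w] by auto
next
  fix p q r s assume a: "p \<in> W" "q \<in> W" "r \<in> W" "s \<in> W" "distinct [p, q, r, s]"
  then have "separated (\<rho>' p) (\<rho>' q) (\<rho>' r) (\<rho>' s) = separated (\<rho> p) (\<rho> q) (\<rho> r) (\<rho> s)" using assms(2)[of p q r s] by auto
  then show "X p q r s \<longleftrightarrow> (separated (\<rho>' p) (\<rho>' q) (\<rho>' r) (\<rho>' s) \<noteq> (X c r p q \<noteq> (X c s p q \<noteq> (X c p r s \<noteq> X c q r s))))"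
    using formula[OF a] by simp
qed (fact finite_W c_notin assms(1) swap1 swap2 one_crossing corner blockers_trans)+

text \<open>
  A cyclic shift of the rotation preserves separation, so any vertex may be taken as the first one.
\<close>

lemma rotate_to_front:
  assumes "v \<in> W"
  obtains \<rho>' where "crossing_pattern c W X \<rho>'" "\<And>w. w \<in> W - {v} \<Longrightarrow> \<rho>' v < \<rho>' w"
proof -
  define B where "B = Max (\<rho> ` W) - Min (\<rho> ` W) + 1"
  have bd: "\<rho> p < \<rho> q + B" if "p \<in> W" "q \<in> W" for p q
  proof -
    have "\<rho> p \<le> Max (\<rho> ` W)" "Min (\<rho> ` W) \<le> \<rho> q" using finite_W that by (auto intro: Max_ge Min_le)
    then show ?thesis unfolding B_def by simp
  qed
  have Bpos: "B > 0" using bd[OF assms assms] by simp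
  define \<rho>' where "\<rho>' w = (if \<rho> w < \<rho> v then \<rho> w + B else \<rho> w)" for w
  have lt: "\<rho>' p < \<rho>' q \<longleftrightarrow> ((\<rho> p < \<rho> v) \<noteq> (\<rho> q < \<rho> v)) \<noteq> (\<rho> p < \<rho> q)" if "p \<in> W" "q \<in> W" "p \<noteq> q" for p q
  proof -
    have "\<rho> p \<noteq> \<rho> q" using inj_\<rho> that by (meson inj_onD)
    then show ?thesis unfolding \<rho>'_def using bd[OF that(1,2)] bd[OF that(2,1)] by auto
  qed
  show thesis
  proof (rule that)
    show "crossing_pattern c W X \<rho>'"
    proof (rule reorder)
      show "inj_on \<rho>' W" using lt inj_\<rho> by (smt (verit) inj_on_def)
      fix p q r s assume "p \<in> W" "q \<in> W" "r \<in> W" "s \<in> W" "p \<noteq> q" "r \<notin> {p, q}" "s \<notin> {p, q}"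
      then show "separated (\<rho>' p) (\<rho>' q) (\<rho>' r) (\<rho>' s) = separated (\<rho> p) (\<rho> q) (\<rho> r) (\<rho> s)"
        unfolding separated_def using lt[of p r] lt[of q r] lt[of p s] lt[of q s] by auto
    qed
    show "\<rho>' v < \<rho>' w" if "w \<in> W - {v}" for w
      using lt[of v w] assms that inj_onD[OF inj_\<rho>, of v w] by fastforce
  qed
qed

text \<open>
  The edge \<open>pq\<close> is crossed by no edge from \<open>c\<close> to a vertex of
  \<open>A\<close>. The set \<open>A\<close> varies because the inductions pass to induced
  subgraphs.
\<close>

definition uncrossed :: "'a set \<Rightarrow> 'a \<Rightarrow> 'a \<Rightarrow> bool" where
  "uncrossed A p q \<longleftrightarrow> p \<in> A \<and> q \<in> A \<and> p \<noteq> q \<and> (\<forall>k\<in>A - {p, q}. \<not> X c k p q)"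

definition plane_pairs :: "'a set \<Rightarrow> ('a \<times> 'a) set \<Rightarrow> bool" where
  "plane_pairs A M \<longleftrightarrow> (\<forall>p q. (p, q) \<in> M \<longrightarrow> uncrossed A p q) \<and>
     (\<forall>p q r s. (p, q) \<in> M \<longrightarrow> (r, s) \<in> M \<longrightarrow> distinct [p, q, r, s] \<longrightarrow> \<not> X p q r s)"

lemma uncrossed_sym: "uncrossed A p q \<longleftrightarrow> uncrossed A q p"
  unfolding uncrossed_def using swap3 by auto

lemma not_both_block:
  "\<lbrakk>v \<in> W; p \<in> W; q \<in> W; distinct [v, p, q]; X c p v q\<rbrakk> \<Longrightarrow> \<not> X c q v p"
  using one_crossing[of p c q v] c_notin swap1 swap2 swap3 by (smt (verit) distinct_length_2_or_more distinct_singleton insert_iff)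

text \<open>
  Induction on \<open>A\<close>: leave out a vertex \<open>z\<close> and take \<open>k\<close> that
  has no blocker except possibly \<open>z\<close>. If \<open>z\<close> does block \<open>k\<close>,
  the set \<open>L\<close> of blockers of \<open>z\<close> is closed under taking blockers, by the
  transitivity rule; so either \<open>L\<close> is empty and \<open>z\<close> is unblocked, or a
  vertex of \<open>L\<close> that is unblocked within \<open>L\<close> is unblocked altogether.
\<close>

lemma uncrossed_neighbour_exists:
  assumes "A \<subseteq> W" "v \<in> A" "A \<noteq> {v}"
  shows "\<exists>e. uncrossed A v e"
  using assms
proof (induction "card A" arbitrary: A rule: less_induct)
  case less
  have finA: "finite A" using less.prems finite_W finite_subset by blast
  obtain z where z: "z \<in> A" "z \<noteq> v" using less.prems by blast
  show ?case
  proof (cases "A = {v, z}")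
    case True
    then have "uncrossed A v z" unfolding uncrossed_def using z by auto
    then show ?thesis by blast
  next
    case False
    have "card (A - {z}) < card A" by (rule card_Diff1_less[OF finA z(1)])
    then obtain k where k: "uncrossed (A - {z}) v k"
      using less.hyps[of "A - {z}"] less.prems z False by blast
    then have kA: "k \<in> A" "k \<noteq> z" "k \<noteq> v" unfolding uncrossed_def by auto
    show ?thesis
    proof (cases "X c z v k")
      case False
      then have "uncrossed A v k" using k z unfolding uncrossed_def by auto
      then show ?thesis by blast
    next
      case zk: True
      define L where "L = {l \<in> A - {v, z}. X c l v z}"
      show ?thesis
      proof (cases "L = {}")
        case True
        then have "uncrossed A v z" unfolding uncrossed_def L_def using less.prems z by auto
        then show ?thesis by blast
      next
        case False
        have "insert v L \<subset> A" using less.prems z unfolding L_def by auto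
        then have "card (insert v L) < card A" using finA psubset_card_mono by blast
        moreover have "insert v L \<subseteq> W" "insert v L \<noteq> {v}" using less.prems False unfolding L_def by auto
        ultimately obtain l where l: "uncrossed (insert v L) v l" using less.hyps[of "insert v L"] by blast
        then have lL: "l \<in> L" unfolding uncrossed_def by auto
        then have lA: "l \<in> A" "l \<noteq> v" "l \<noteq> z" "X c l v z" unfolding L_def by auto
        have W: "v \<in> W" "z \<in> W" "k \<in> W" "l \<in> W" using less.prems z kA lA by auto
        have lk: "l \<noteq> k" using not_both_block[of v z k] zk lA W z kA by auto
        have "\<not> X c l v k" using k lA lk unfolding uncrossed_def by auto
        have "\<not> X c j v l" if j: "j \<in> A - {v, l}" for j
        proof
          assume jl: "X c j v l"
          have jz: "j \<noteq> z" using not_both_block[of v l z] lA W z jl by auto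
          have "j = k \<or> \<not> X c j v k" using k j jz unfolding uncrossed_def by auto
          then have "X c j v z"
            using blockers_trans[of v z k l j] W z kA lA lk zk jl \<open>\<not> X c l v k\<close> j jz less.prems(1) by auto
          then have "j \<in> L" using j jz unfolding L_def by auto
          then show False using l jl j unfolding uncrossed_def by auto
        qed
        then have "uncrossed A v l" unfolding uncrossed_def using less.prems lA by auto
        then show ?thesis by blast
      qed
    qed
  qed
qed

end

locale crossing_pattern_from = crossing_pattern +
  fixes v assumes v_in: "v \<in> W" and v_first: "w \<in> W \<Longrightarrow> w \<noteq> v \<Longrightarrow> \<rho> v < \<rho> w"
begin

lemma reverse_order:
  obtains \<rho>' where "crossing_pattern_from c W X \<rho>' v"
    "\<And>p q. \<lbrakk>p \<in> W - {v}; q \<in> W - {v}\<rbrakk> \<Longrightarrow> \<rho>' p < \<rho>' q \<longleftrightarrow> \<rho> q < \<rho> p"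
proof -
  define m where "m = - Max (\<rho> ` W) - 1"
  define \<rho>' where "\<rho>' w = (if w = v then m else - \<rho> w)" for w
  have m: "m < \<rho>' w" if "w \<in> W" "w \<noteq> v" for w
  proof -
    have "\<rho> w \<le> Max (\<rho> ` W)" using finite_W that by (auto intro: Max_ge)
    then show ?thesis using that unfolding m_def \<rho>'_def by simp
  qed
  have rv: "\<rho>' v = m" unfolding \<rho>'_def by simp
  have lt: "\<rho>' p < \<rho>' q \<longleftrightarrow> \<rho> q < \<rho> p" if "p \<in> W - {v}" "q \<in> W - {v}" for p q
    using that unfolding \<rho>'_def by auto
  have ne: "\<rho> p \<noteq> \<rho> q" if "p \<in> W" "q \<in> W" "p \<noteq> q" for p q using inj_\<rho> that by (meson inj_onD)
  have "crossing_pattern c W X \<rho>'"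
  proof (rule reorder)
    show "inj_on \<rho>' W"
    proof (rule inj_onI)
      fix p q assume "p \<in> W" "q \<in> W" "\<rho>' p = \<rho>' q"
      then show "p = q" using m[of p] m[of q] rv ne[of p q] unfolding \<rho>'_def by (auto split: if_splits)
    qed
    fix p q r s assume a: "p \<in> W" "q \<in> W" "r \<in> W" "s \<in> W" "p \<noteq> q" "r \<notin> {p, q}" "s \<notin> {p, q}"
    have both: "((\<rho>' a < \<rho>' b) = (\<rho> a < \<rho> b)) \<longleftrightarrow> (a = v \<or> b = v)" if "a \<in> W" "b \<in> W" "a \<noteq> b" for a b
    proof -
      consider "a = v" | "b = v" | "a \<noteq> v" "b \<noteq> v" by blast
      then show ?thesis
      proof cases
        case 1 then show ?thesis using m[of b] rv v_first[of b] that by simp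
      next
        case 2 then show ?thesis using m[of a] rv v_first[of a] that by simp
      next
        case 3 then show ?thesis using lt[of a b] ne[OF that] that by auto
      qed
    qed
    have d: "p \<noteq> r" "q \<noteq> r" "p \<noteq> s" "q \<noteq> s" "p \<noteq> q" using a by auto
    note both[OF a(1,3) d(1)] both[OF a(2,3) d(2)] both[OF a(1,4) d(3)] both[OF a(2,4) d(4)]
    then show "separated (\<rho>' p) (\<rho>' q) (\<rho>' r) (\<rho>' s) = separated (\<rho> p) (\<rho> q) (\<rho> r) (\<rho> s)"
      using d unfolding separated_def by metis
  qed
  then have "crossing_pattern_from c W X \<rho>' v"
    unfolding crossing_pattern_from_def crossing_pattern_from_axioms_def using v_in m rv by auto
  then show thesis using that lt by blast
qed

lemma formula_from:
  assumes "e \<in> W" "x \<in> W" "y \<in> W" "distinct [v, e, x, y]"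
  shows "X v e x y \<longleftrightarrow> (((\<rho> x < \<rho> e) \<noteq> (\<rho> y < \<rho> e)) \<noteq> (X c x v e \<noteq> (X c y v e \<noteq> (X c v x y \<noteq> X c e x y))))"
proof -
  have "\<rho> e \<noteq> \<rho> x" "\<rho> e \<noteq> \<rho> y" using inj_\<rho> assms by (auto dest: inj_onD)
  then have "separated (\<rho> v) (\<rho> e) (\<rho> x) (\<rho> y) \<longleftrightarrow> (\<rho> x < \<rho> e) \<noteq> (\<rho> y < \<rho> e)"
    using v_first[of x] v_first[of y] assms unfolding separated_def by auto
  then show ?thesis using formula[of v e x y] assms v_in by auto
qed

text \<open>
  Let \<open>ve\<close> and \<open>xy\<close> cross. The edge \<open>vx\<close> runs inside the
  quadrilateral formed by \<open>c\<close>, \<open>v\<close>, the crossing point and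
  \<open>x\<close>, or outside of it, and in the latter case \<open>y\<close> blocks
  \<open>x\<close>. So if \<open>y\<close> does not block \<open>x\<close>, only vertices in the
  sector between \<open>v\<close> and \<open>x\<close> can do so.
\<close>

lemma no_far_blocker:
  assumes W: "x \<in> W" "e \<in> W" "y \<in> W" "b \<in> W" and ord: "\<rho> v < \<rho> x" "\<rho> x < \<rho> e" "\<rho> e < \<rho> y" "\<rho> x < \<rho> b"
    and H: "\<not> X c x v e" "\<not> X c y v e" "b = e \<or> \<not> X c b v e" "\<not> X c v x y" "\<not> X c e x y" "b = y \<or> \<not> X c b x y"
    and y: "\<not> X c y v x"
  shows "\<not> X c b v x"
proof
  assume b: "X c b v x"
  have V: "v \<in> insert c W" "x \<in> insert c W" "e \<in> insert c W" "y \<in> insert c W" "b \<in> insert c W" "c \<in> insert c W" using W v_in by auto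
  have cW: "c \<noteq> v" "c \<noteq> x" "c \<noteq> e" "c \<noteq> y" "c \<noteq> b" using W v_in c_notin by auto
  have d: "v \<noteq> x" "v \<noteq> e" "v \<noteq> y" "v \<noteq> b" "x \<noteq> e" "x \<noteq> y" "e \<noteq> y" "b \<noteq> x" "b \<noteq> y" using ord y b by auto
  have ve: "X v e x y" using formula_from[of e x y] W ord d H by auto
  have nxb: "\<not> X c x v b" using not_both_block[of v b x] W v_in d b by auto
  show False
  proof (cases "\<rho> b < \<rho> y")
    case True
    have "X x y v b = X c y v b"
      by (rule corner[of v x c b y]) (use V cW d b y H swap1 swap2 swap3 in auto)
    moreover have "X v b x y \<longleftrightarrow> \<not> X c y v b"
      using formula_from[of b x y] W d ord True nxb H by auto
    ultimately show False using swap2 by metis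
  next
    case False
    have "\<not> X v x c e"
    proof
      assume "X v x c e"
      then have "X x y v e = X c y v e"
        by (intro corner[of v x c e y]) (use V cW d y H swap2[of x y c e] in auto)
      then show False using ve H(2) swap2 by metis
    qed
    then have "\<not> X c e x v" using swap1 swap2 by metis
    then have "X v e x b = X c e x b"
      by (intro corner[of x v c b e]) (use V cW d b H False swap1 swap2 swap3 in auto)
    moreover have "\<not> X c v x b"
      using one_crossing[of b c v x] V cW d b swap1[of c b v x] swap2[of c v b x] swap3[of c v x b] swap2[of c v x b] swap1[of b x c v] by auto
    then have "X v e x b \<longleftrightarrow> \<not> X c e x b"
      using formula_from[of e x b] W d ord False H by auto
    ultimately show False by simp
  qed
qed

text \<open>
  If \<open>cx\<close> crossed \<open>vy\<close>, then by the corner rule \<open>ck\<close> and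
  \<open>vk\<close> would both cross \<open>xy\<close> or both miss it; by the crossing formula exactly
  one of them crosses it.
\<close>

lemma opposite_block:
  assumes "x \<in> W" "y \<in> W" "k \<in> W" "distinct [v, k, x, y]" "\<rho> k < \<rho> x" "\<rho> x < \<rho> y"
    and "\<not> X c v x y" "X c y v k" "\<not> X c x v k"
  shows "\<not> X c x v y"
proof
  assume x: "X c x v y"
  have "\<not> X c k v y" using not_both_block[of v y k] assms v_in by auto
  then have "X c k x y = X v k x y"
    using assms v_in c_notin x swap1[of x c v y] swap2[of v k x c] swap3[of x c v k] swap1[of x c v k]
    by (intro corner[of x c v y k]) (auto simp: swap2[of v k x c])
  moreover have "X v k x y \<longleftrightarrow> \<not> X c k x y"
    using formula_from[of k x y] assms by auto
  ultimately show False by simp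
qed

definition good_neighbour :: "'a set \<Rightarrow> ('a \<times> 'a) set \<Rightarrow> 'a \<Rightarrow> bool" where
  "good_neighbour A M e \<longleftrightarrow> uncrossed A v e \<and> (\<forall>p q. (p, q) \<in> M \<longrightarrow> distinct [v, e, p, q] \<longrightarrow> \<not> X v e p q)"

lemma uncrossed_cross_iff:
  assumes "A \<subseteq> W" "uncrossed A v e" "uncrossed A p q" "distinct [v, e, p, q]"
  shows "X v e p q \<longleftrightarrow> (\<rho> p < \<rho> e) \<noteq> (\<rho> q < \<rho> e)"
  using formula_from[of e p q] assms unfolding uncrossed_def by auto

text \<open>
  Here \<open>ve\<close> is uncrossed and crosses just one member \<open>xy\<close> of
  \<open>M\<close>. The induction hypothesis for the sector between \<open>v\<close> and
  \<open>x\<close> gives a vertex \<open>k\<close> that is good within the sector. Any member of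
  \<open>M\<close> that crosses \<open>vk\<close> and leaves the sector would also cross
  \<open>ve\<close> or \<open>xy\<close>, so \<open>k\<close> can only fail because of a blocker
  outside the sector. Then \<open>vk\<close> must enter the sector through \<open>xy\<close>, and
  this means that \<open>y\<close> blocks \<open>k\<close>.
\<close>

lemma neighbour_or_outside_blocker:
  assumes A: "A \<subseteq> W" "v \<in> A" and M: "plane_pairs A M" "(x, y) \<in> M \<or> (y, x) \<in> M"
    and IH: "\<And>A' M'. \<lbrakk>A' \<subset> A; v \<in> A'; A' \<noteq> {v}; M' \<subseteq> M; plane_pairs A' M'\<rbrakk> \<Longrightarrow> \<exists>e. good_neighbour A' M' e"
    and e: "uncrossed A v e" "\<And>p q. \<lbrakk>(p, q) \<in> M; distinct [v, e, p, q]; X v e p q\<rbrakk> \<Longrightarrow> {p, q} = {x, y}"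
    and ord: "x \<noteq> v" "\<rho> x < \<rho> e" "\<rho> e < \<rho> y"
    and y: "\<not> X c y v x"
  shows "(\<exists>e. good_neighbour A M e) \<or> (\<exists>k\<in>A. k \<noteq> v \<and> \<rho> k < \<rho> x \<and> X c y v k \<and> \<not> X c x v k)"
proof -
  have unc: "uncrossed A p q" if "(p, q) \<in> M" for p q using M(1) that unfolding plane_pairs_def by auto
  have xy: "uncrossed A x y" using unc M(2) uncrossed_sym by blast
  then have inA: "x \<in> A" "y \<in> A" "e \<in> A" using e(1) unfolding uncrossed_def by auto
  then have inW: "x \<in> W" "y \<in> W" "e \<in> W" using A by auto
  have vx: "\<rho> v < \<rho> x" using v_first inW ord by auto
  define A' where "A' = {w \<in> A. \<rho> w \<le> \<rho> x}"
  define M' where "M' = {(p, q) \<in> M. p \<in> A' \<and> q \<in> A'}"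
  have "A' \<subset> A" "v \<in> A'" "A' \<noteq> {v}" "M' \<subseteq> M" using inA A ord vx unfolding A'_def M'_def by force+
  moreover have "plane_pairs A' M'"
    using M(1) unfolding plane_pairs_def M'_def uncrossed_def A'_def by fast
  ultimately obtain k where k: "good_neighbour A' M' k" using IH by blast
  then have kA: "k \<in> A" "k \<noteq> v" "\<rho> k \<le> \<rho> x" and kA': "k \<in> A'" unfolding good_neighbour_def uncrossed_def A'_def by auto
  have kfree: "\<not> X c b v k" if "b \<in> A" "b \<noteq> v" "b \<noteq> k" "\<rho> b \<le> \<rho> x" for b
    using k that unfolding good_neighbour_def uncrossed_def A'_def by auto
  have kM: "\<not> X v k p q" if "(p, q) \<in> M'" "distinct [v, k, p, q]" for p q
    using k that unfolding good_neighbour_def by auto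
  have nonM: "\<not> X p q r s" if "(p, q) \<in> M" "(r, s) \<in> M" "distinct [p, q, r, s]" for p q r s
    using M(1) that unfolding plane_pairs_def by auto
  have kW: "k \<in> W" using kA A by auto
  show ?thesis
  proof (cases "uncrossed A v k")
    case True
    have "\<not> X v k p q" if pq: "(p, q) \<in> M" "distinct [v, k, p, q]" for p q
    proof
      assume cr: "X v k p q"
      have side: "(\<rho> p < \<rho> k) \<noteq> (\<rho> q < \<rho> k)"
        using uncrossed_cross_iff[OF A(1) True unc[OF pq(1)] pq(2)] cr by simp
      have contra: False if rs: "(r, s) \<in> M \<or> (s, r) \<in> M" "distinct [v, k, r, s]" "X v k r s" "\<rho> r < \<rho> k" "\<not> \<rho> s < \<rho> k" for r s
      proof -
        have rsu: "uncrossed A r s" using unc rs(1) uncrossed_sym by blast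
        then have rsA: "r \<in> A" "s \<in> A" unfolding uncrossed_def by auto
        have "\<not> (r \<in> A' \<and> s \<in> A')"
        proof
          assume "r \<in> A' \<and> s \<in> A'"
          then have "(r, s) \<in> M' \<or> (s, r) \<in> M'" using rs(1) unfolding M'_def by auto
          then show False using kM[of r s] kM[of s r] rs(2,3) swap3[of v k r s] by auto
        qed
        then have s: "\<rho> x < \<rho> s" using rsA rs(4) kA(3) unfolding A'_def by auto
        have r: "\<rho> r < \<rho> x" using rs(4) kA(3) by simp
        have rne: "r \<noteq> x" "r \<noteq> y" "r \<noteq> e" "s \<noteq> x" using r s ord by auto
        show False
        proof (cases "\<rho> s < \<rho> y \<and> s \<noteq> y")
          case True
          \<comment> \<open>Now \<open>rs\<close> and \<open>xy\<close> alternate in the rotation, so they would be crossing members of \<open>M\<close>.\<close>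
          have d: "distinct [r, s, x, y]" using rne True rs(2) ord by auto
          have "separated (\<rho> r) (\<rho> s) (\<rho> x) (\<rho> y)" using r s True ord unfolding separated_def by auto
          then have "X r s x y" using formula[of r s x y] d rsA inA A(1) rsu xy unfolding uncrossed_def by auto
          moreover have "\<not> X r s x y" using rs(1) M(2) nonM[of r s x y] nonM[of r s y x] nonM[of s r x y] nonM[of s r y x] d
            swap1[of r s x y] swap1[of r s y x] swap3[of r s x y] swap3[of s r x y] by auto
          ultimately show False by simp
        next
          case False
          \<comment> \<open>Now \<open>rs\<close> separates \<open>v\<close> from \<open>e\<close>, but \<open>xy\<close> is the only member of \<open>M\<close> that crosses \<open>ve\<close>.\<close>
          then have "\<rho> e < \<rho> s" using ord by auto
          then have d: "distinct [v, e, r, s]" using rne rs(2) e(1) unfolding uncrossed_def by auto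
          have X: "X v e r s" using uncrossed_cross_iff[OF A(1) e(1) rsu d] \<open>\<rho> e < \<rho> s\<close> r ord by auto
          have d': "distinct [v, e, s, r]" using d by auto
          have "{r, s} = {x, y} \<or> {s, r} = {x, y}"
            using e(2)[OF _ d X] e(2)[OF _ d' X[unfolded swap3[of v e r s]]] rs(1) by blast
          then show False using rne by (metis doubleton_eq_iff)
        qed
      qed
      show False using contra[of p q] contra[of q p] pq cr side swap3 by (cases "\<rho> p < \<rho> k") auto
    qed
    then have "good_neighbour A M k" using True unfolding good_neighbour_def by auto
    then show ?thesis by blast
  next
    case False
    then obtain b where b: "b \<in> A" "b \<noteq> v" "b \<noteq> k" "X c b v k" using kA A(2) unfolding uncrossed_def by auto
    then have bx: "\<rho> x < \<rho> b" using kfree[of b] by force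
    have bW: "b \<in> W" using b A by auto
    have Hve: "w = e \<or> w = v \<or> \<not> X c w v e" and Hxy: "w = x \<or> w = y \<or> \<not> X c w x y" if "w \<in> A" for w
      using e(1) xy that unfolding uncrossed_def by auto
    have kx: "k \<noteq> x"
    proof
      assume "k = x"
      then have "\<not> X c b v x"
        using no_far_blocker[of x e y b] inW bW vx ord bx y Hve[OF inA(1)] Hve[OF inA(2)] Hve[OF b(1)]
          Hxy[OF A(2)] Hxy[OF inA(3)] Hxy[OF b(1)] b by auto
      then show False using b \<open>k = x\<close> by simp
    qed
    then have klt: "\<rho> k < \<rho> x" using kA(3) inj_\<rho> kW inW by (metis inj_onD order_le_less)
    have xk: "\<not> X c x v k" using kfree[of x] inA ord kx by auto
    have "X c y v k"
    proof (rule ccontr)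
      assume yk: "\<not> X c y v k"
      have yne: "y \<noteq> v" "y \<noteq> k" "y \<noteq> x" using ord klt vx by auto
      have vk: "\<not> X v k x y" using yne formula_from[of k x y] kW inW kA ord klt kx vx xk yk Hxy[OF A(2)] Hxy[OF kA(1)] by auto
      have sep: "separated (\<rho> v) (\<rho> x) (\<rho> k) (\<rho> b)"
        using v_first[OF kW kA(2)] vx klt bx unfolding separated_def by auto
      have "distinct [v, e, x, y]" using yne ord e(1) unfolding uncrossed_def by auto
      then have vexy: "X v e x y" using uncrossed_cross_iff[OF A(1) e(1) xy] ord by auto
      have "v \<noteq> e" "e \<noteq> x" "e \<noteq> y" "e \<noteq> k" "x \<noteq> k" using ord klt e(1) unfolding uncrossed_def by auto
      then have d5: "distinct [v, e, x, y, k]" using yne ord(1) kA(2) by auto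
      have b3: "b \<notin> {v, x, k}" using b bx by auto
      have "\<not> X c b v k"
        by (rule quadrilateral[OF v_in inW(3,1,2) kW bW d5 b3 vexy _ _ _ _ _ _ vk xk sep])
           (use d5 b3 Hve[OF inA(1)] Hve[OF kA(1)] Hve[OF b(1)] Hxy[OF A(2)] Hxy[OF kA(1)] Hxy[OF b(1)] in auto)
      then show False using b by simp
    qed
    then show ?thesis using kA(1,2) klt xk by blast
  qed
qed

text \<open>
  Induction on the sizes of \<open>A\<close> and \<open>M\<close>. Leave out a member of
  \<open>M\<close>; the edge \<open>ve\<close> found for the rest may cross that member
  \<open>xy\<close>. The sectors on the two sides of \<open>xy\<close> then give vertices
  \<open>k\<close> and \<open>k'\<close> such that \<open>vk\<close> comes from the side of
  \<open>y\<close> and \<open>vk'\<close> from the side of \<open>x\<close>. These two edges would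
  have to block each other's ends, which is impossible.
\<close>

lemma good_neighbour_exists:
  assumes "A \<subseteq> W" "v \<in> A" "A \<noteq> {v}" "finite M" "plane_pairs A M"
  shows "\<exists>e. good_neighbour A M e"
  using assms
proof (induction "card A + card M" arbitrary: A M rule: less_induct)
  case less
  have finA: "finite A" using less.prems finite_W finite_subset by blast
  show ?case
  proof (cases "M = {}")
    case True
    obtain e where "uncrossed A v e" using uncrossed_neighbour_exists[OF less.prems(1-3)] by blast
    then show ?thesis using True unfolding good_neighbour_def by blast
  next
    case False
    then obtain p q where pq: "(p, q) \<in> M" by fast
    have pl: "plane_pairs A (M - {(p, q)})" using less.prems(5) unfolding plane_pairs_def by blast
    have "card (M - {(p, q)}) < card M" by (rule card_Diff1_less[OF less.prems(4) pq])
    then obtain e where e: "good_neighbour A (M - {(p, q)}) e"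
      using less.hyps[of A "M - {(p, q)}"] less.prems(1-4) pl by auto
    show ?thesis
    proof (cases "distinct [v, e, p, q] \<and> X v e p q")
      case False
      then have "good_neighbour A M e" using e unfolding good_neighbour_def by blast
      then show ?thesis by blast
    next
      case True
      have ue: "uncrossed A v e" using e unfolding good_neighbour_def by blast
      have upq: "uncrossed A p q" using less.prems(5) pq unfolding plane_pairs_def by blast
      have side: "(\<rho> p < \<rho> e) \<noteq> (\<rho> q < \<rho> e)"
        using uncrossed_cross_iff[OF less.prems(1) ue upq] True by blast
      have inA: "p \<in> A" "q \<in> A" "e \<in> A" using upq ue unfolding uncrossed_def by auto
      then have inW: "p \<in> W" "q \<in> W" "e \<in> W" using less.prems(1) by auto
      have ne: "\<rho> p \<noteq> \<rho> e" "\<rho> q \<noteq> \<rho> e" using inj_\<rho> inW True by (auto dest: inj_onD)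
      obtain x y where xy: "(x, y) \<in> M \<or> (y, x) \<in> M" "{x, y} = {p, q}" "\<rho> x < \<rho> e" "\<rho> e < \<rho> y"
      proof (cases "\<rho> p < \<rho> e")
        case True
        then show thesis using that[of p q] pq side ne by auto
      next
        case False
        then show thesis using that[of q p] pq side ne by auto
      qed
      have only: "{r, s} = {x, y}" if "(r, s) \<in> M" "distinct [v, e, r, s]" "X v e r s" for r s
      proof -
        have "(r, s) \<notin> M - {(p, q)}" using e that(2,3) unfolding good_neighbour_def by blast
        then show ?thesis using that(1) xy(2) by blast
      qed
      have xyA: "x \<in> A" "y \<in> A" "x \<noteq> v" "y \<noteq> v" "x \<noteq> y" using xy(2-4) inA True by (auto simp: doubleton_eq_iff)
      have xyW: "x \<in> W" "y \<in> W" using xyA less.prems(1) by auto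
      have only': "{r, s} = {y, x}" if "(r, s) \<in> M" "distinct [v, e, r, s]" "X v e r s" for r s
        using only[OF that] by (simp add: insert_commute)
      have uxy: "uncrossed A x y" using upq xy(2) uncrossed_sym by (metis doubleton_eq_iff)
      then have vxy: "\<not> X c v x y" "\<not> X c v y x"
        using less.prems(2) xyA swap3[of c v x y] unfolding uncrossed_def by auto
      have IH: "\<exists>e. good_neighbour A' M' e" if "A' \<subset> A" "v \<in> A'" "A' \<noteq> {v}" "M' \<subseteq> M" "plane_pairs A' M'" for A' M'
      proof (rule less.hyps)
        show "card A' + card M' < card A + card M"
          using psubset_card_mono[OF finA that(1)] card_mono[OF less.prems(4) that(4)] by simp
        show "A' \<subseteq> W" using that(1) less.prems(1) by blast
        show "finite M'" using that(4) less.prems(4) finite_subset by blast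
      qed (use that in auto)
      obtain \<rho>' where \<rho>': "crossing_pattern_from c W X \<rho>' v"
        "\<And>p q. \<lbrakk>p \<in> W - {v}; q \<in> W - {v}\<rbrakk> \<Longrightarrow> \<rho>' p < \<rho>' q \<longleftrightarrow> \<rho> q < \<rho> p"
        using reverse_order by blast
      interpret R: crossing_pattern_from c W X \<rho>' v by (rule \<rho>'(1))
      have ev: "e \<noteq> v" using True by auto
      have ord': "\<rho>' y < \<rho>' e" "\<rho>' e < \<rho>' x" "\<rho>' y < \<rho>' x" using \<rho>'(2)[of y e] \<rho>'(2)[of e x] \<rho>'(2)[of y x] xyW xyA inW ev xy(3,4) by auto
      have xly: "\<rho> x < \<rho> y" using xy by simp
      \<comment> \<open>Two mirror images of the same argument: the second one reads the rotation backwards.\<close>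
      have left: "(\<exists>e. good_neighbour A M e) \<or> (\<exists>k\<in>A. k \<noteq> v \<and> \<rho> k < \<rho> x \<and> X c y v k \<and> \<not> X c x v k)" if "\<not> X c y v x"
        by (rule neighbour_or_outside_blocker[OF less.prems(1,2,5) xy(1) IH ue only xyA(3) xy(3,4) that])
      have right: "(\<exists>e. good_neighbour A M e) \<or> (\<exists>k\<in>A. k \<noteq> v \<and> \<rho>' k < \<rho>' y \<and> X c x v k \<and> \<not> X c y v k)" if "\<not> X c x v y"
        by (rule R.neighbour_or_outside_blocker[OF less.prems(1,2,5) _ IH ue only' xyA(4) ord'(1,2) that]) (use xy(1) in blast)
      have left_block: "\<not> X c x v y" if k: "k \<in> A" "k \<noteq> v" "\<rho> k < \<rho> x" "X c y v k" "\<not> X c x v k" for k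
        using opposite_block[of x y k] xyW k less.prems(1) vxy(1) xly xyA by auto
      have right_block: "\<not> X c y v x" if k: "k \<in> A" "k \<noteq> v" "\<rho>' k < \<rho>' y" "X c x v k" "\<not> X c y v k" for k
        using R.opposite_block[of y x k] xyW k less.prems(1) vxy(2) ord'(3) xyA by auto
      show ?thesis
      proof (cases "X c y v x")
        case True
        then have "\<not> X c x v y" using not_both_block[of v y x] v_in xyW xyA by auto
        then show ?thesis using right right_block True by blast
      next
        case False
        show ?thesis
        proof (rule ccontr)
          assume no: "\<not> ?thesis"
          then obtain k where k: "k \<in> A" "k \<noteq> v" "\<rho> k < \<rho> x" "X c y v k" "\<not> X c x v k" using left[OF False] by blast
          then obtain k' where k': "k' \<in> A" "k' \<noteq> v" "\<rho>' k' < \<rho>' y" "X c x v k'" "\<not> X c y v k'"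
            using right[OF left_block[OF k]] no by blast
          have W: "k \<in> W" "k' \<in> W" using k k' less.prems(1) by auto
          have yk': "\<rho> y < \<rho> k'" using \<rho>'(2)[of k' y] k' W xyW xyA by auto
          have d: "distinct [v, y, k, x, k']" "distinct [v, x, k', y, k]" using k k' xyA xly yk' by auto
          have v1: "\<rho> v < \<rho> x" "\<rho> v < \<rho> y" "\<rho> v < \<rho> k" "\<rho> v < \<rho> k'" using v_first xyW W xyA k k' by auto
          \<comment> \<open>The blockers interlock in both directions, so \<open>k\<close> and \<open>k'\<close> would block each other.\<close>
          have sep: "separated (\<rho> v) (\<rho> y) (\<rho> x) (\<rho> k')" "separated (\<rho> v) (\<rho> x) (\<rho> y) (\<rho> k)"
            using v1 k(3) xly yk' unfolding separated_def by auto
          have "X c k' v k"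
            by (rule interlocked_blockers[OF v_in xyW(2) W(1) xyW(1) W(2) d(1) k(4) k'(4) k'(5) k(5) sep(1)])
          moreover have "X c k v k'"
            by (rule interlocked_blockers[OF v_in xyW(1) W(2) xyW(2) W(1) d(2) k'(4) k(4) k(5) k'(5) sep(2)])
          moreover have "distinct [v, k, k']" using d by auto
          ultimately show False using not_both_block[OF v_in W] by blast
        qed
      qed
    qed
  qed
qed

end

context crossing_pattern
begin

definition vertex_disjoint :: "('a \<times> 'a) set \<Rightarrow> bool" where
  "vertex_disjoint M \<longleftrightarrow> (\<forall>p q r s. (p, q) \<in> M \<longrightarrow> (r, s) \<in> M \<longrightarrow> (p, q) \<noteq> (r, s) \<longrightarrow> {p, q} \<inter> {r, s} = {})"

lemma neighbour_avoiding_plane_pairs: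
  assumes "v \<in> W" "W \<noteq> {v}" "finite M" "plane_pairs W M"
  obtains e where "uncrossed W v e" "\<And>p q. \<lbrakk>(p, q) \<in> M; distinct [v, e, p, q]\<rbrakk> \<Longrightarrow> \<not> X v e p q"
proof -
  obtain \<rho>' where \<rho>': "crossing_pattern c W X \<rho>'" "\<And>w. w \<in> W - {v} \<Longrightarrow> \<rho>' v < \<rho>' w"
    using rotate_to_front[OF assms(1)] by blast
  interpret R: crossing_pattern_from c W X \<rho>' v
    unfolding crossing_pattern_from_def crossing_pattern_from_axioms_def using \<rho>' assms(1) by auto
  obtain e where "R.good_neighbour W M e" using R.good_neighbour_exists[OF order_refl assms] by blast
  then show thesis using that unfolding R.good_neighbour_def by blast
qed

text \<open>
  Take a largest plane matching \<open>M\<close> of uncrossed edges. If it has fewer than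
  \<open>m\<close> edges, then every vertex off \<open>M\<close> has an uncrossed edge that crosses
  no edge of \<open>M\<close>, and by maximality this edge ends at one of the fewer than
  \<open>2m\<close> ends of \<open>M\<close>. One of these ends is hit at least
  \<open>4m\<^sup>2\<close> times.
\<close>

lemma matching_or_star:
  assumes m: "m \<ge> 1" and card: "card W \<ge> 12 * m ^ 3"
  shows "(\<exists>M. finite M \<and> card M = m \<and> plane_pairs W M \<and> vertex_disjoint M) \<or>
    (\<exists>u\<in>W. \<exists>Q. Q \<subseteq> W - {u} \<and> card Q \<ge> 4 * m ^ 2 \<and> (\<forall>q\<in>Q. uncrossed W u q))"
proof -
  define F where "F = {M. M \<subseteq> W \<times> W \<and> plane_pairs W M \<and> vertex_disjoint M}"
  have finF: "finite F" unfolding F_def by (rule finite_subset[of _ "Pow (W \<times> W)"]) (use finite_W in auto)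
  have "{} \<in> F" unfolding F_def plane_pairs_def vertex_disjoint_def by auto
  then have "Max (card ` F) \<in> card ` F" using finF by (intro Max_in) auto
  then obtain M where M: "M \<in> F" "card M = Max (card ` F)" by auto
  have Mmax: "card M' \<le> card M" if "M' \<in> F" for M' using finF that M(2) by auto
  have finM: "finite M" using M(1) finite_W finite_subset[of M "W \<times> W"] unfolding F_def by auto
  have MW: "M \<subseteq> W \<times> W" "plane_pairs W M" "vertex_disjoint M" using M(1) unfolding F_def by auto
  show ?thesis
  proof (cases "card M \<ge> m")
    case True
    then obtain M' where "M' \<subseteq> M" "card M' = m" "finite M'" using obtain_subset_with_card_n[of m M] by metis
    moreover have "plane_pairs W M'" "vertex_disjoint M'"
      using MW(2,3) subsetD[OF \<open>M' \<subseteq> M\<close>] unfolding plane_pairs_def vertex_disjoint_def by metis+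
    ultimately show ?thesis by blast
  next
    case False
    define U where "U = fst ` M \<union> snd ` M"
    have cU: "card U \<le> 2 * m - 2"
    proof -
      have "card U \<le> card (fst ` M) + card (snd ` M)" unfolding U_def by (rule card_Un_le)
      also have "\<dots> \<le> card M + card M" by (intro add_mono card_image_le finM)
      finally show ?thesis using False by simp
    qed
    have UW: "U \<subseteq> W" "finite U" using MW(1) finM unfolding U_def by auto
    have m3: "12 * m ^ 3 \<ge> 12 * m" using m by (simp add: power3_eq_cube)
    have ex: "\<exists>e\<in>U. uncrossed W v e" if v: "v \<in> W - U" for v
    proof -
      have "W \<noteq> {v}" using card m3 m by auto
      then obtain e where e: "uncrossed W v e" "\<And>p q. \<lbrakk>(p, q) \<in> M; distinct [v, e, p, q]\<rbrakk> \<Longrightarrow> \<not> X v e p q"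
        using neighbour_avoiding_plane_pairs[of v M] v finM MW(2) by blast
      have "e \<in> U"
      proof (rule ccontr)
        assume eU: "e \<notin> U"
        have eW: "e \<in> W" "e \<noteq> v" using e(1) unfolding uncrossed_def by auto
        have off: "p \<noteq> v" "p \<noteq> e" "q \<noteq> v" "q \<noteq> e" if "(p, q) \<in> M" for p q
          using that v eU unfolding U_def by (auto simp: image_iff)
        have 1: "\<not> X v e p q" "\<not> X p q v e" if "(p, q) \<in> M" for p q
        proof -
          have "p \<noteq> q" using MW(2) that unfolding plane_pairs_def uncrossed_def by auto
          then show "\<not> X v e p q" using e(2)[OF that] off[OF that] eW by auto
          then show "\<not> X p q v e" using swap2[of v e p q] by simp
        qed
        have "plane_pairs W (insert (v, e) M)"
          using MW(2) e(1) 1 unfolding plane_pairs_def by auto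
        moreover have "vertex_disjoint (insert (v, e) M)"
          unfolding vertex_disjoint_def
        proof (intro allI impI)
          fix p q r s
          assume a: "(p, q) \<in> insert (v, e) M" "(r, s) \<in> insert (v, e) M" "(p, q) \<noteq> (r, s)"
          have "{p, q} \<inter> {r, s} = {}" if "(p, q) \<in> M" "(r, s) \<in> M"
            using MW(3) that a(3) unfolding vertex_disjoint_def by metis
          then show "{p, q} \<inter> {r, s} = {}" using a off[of p q] off[of r s] by auto
        qed
        ultimately have "insert (v, e) M \<in> F" using MW(1) v eW unfolding F_def by auto
        moreover have "(v, e) \<notin> M" using off by blast
        ultimately show False using Mmax[of "insert (v, e) M"] finM by simp
      qed
      then show ?thesis using e(1) by blast
    qed
    then obtain f where f: "\<And>v. v \<in> W - U \<Longrightarrow> f v \<in> U \<and> uncrossed W v (f v)" by metis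
    have cWU: "card (W - U) \<ge> 12 * m ^ 3 - (2 * m - 2)"
      using card cU card_Diff_subset[OF UW(2,1)] by linarith
    have "\<exists>u\<in>U. card {v \<in> W - U. f v = u} \<ge> 4 * m ^ 2"
    proof (rule ccontr)
      assume "\<not> ?thesis"
      then have small: "card {v \<in> W - U. f v = u} \<le> 4 * m ^ 2" if "u \<in> U" for u using that by fastforce
      have "W - U \<subseteq> (\<Union>u\<in>U. {v \<in> W - U. f v = u})" using f by auto
      then have "card (W - U) \<le> card (\<Union>u\<in>U. {v \<in> W - U. f v = u})"
        using UW(2) finite_W by (intro card_mono) auto
      also have "\<dots> \<le> (\<Sum>u\<in>U. card {v \<in> W - U. f v = u})" by (rule card_UN_le[OF UW(2)])
      also have "\<dots> \<le> (\<Sum>u\<in>U. 4 * m ^ 2)" by (rule sum_mono) (use small in auto)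
      also have "\<dots> = card U * (4 * m ^ 2)" by simp
      also have "\<dots> \<le> (2 * m - 2) * (4 * m ^ 2)" by (rule mult_right_mono[OF cU]) simp
      also have "\<dots> \<le> 8 * m ^ 3" by (simp add: power3_eq_cube power2_eq_square diff_mult_distrib)
      finally show False using cWU m3 m by linarith
    qed
    then obtain u where u: "u \<in> U" "card {v \<in> W - U. f v = u} \<ge> 4 * m ^ 2" by blast
    have "{v \<in> W - U. f v = u} \<subseteq> W - {u}" "\<forall>q\<in>{v \<in> W - U. f v = u}. uncrossed W u q" 
      using u(1) f uncrossed_sym by auto
    then show ?thesis using u UW(1) by blast
  qed
qed

end

section \<open>Chains and antichains in a plane double star\<close>

text \<open>
  Mirsky's theorem, the dual of Dilworth's, by peeling off minimal elements: these form an antichain,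
  and a chain in the rest can be extended below its least element \<open>d\<close>. The height
  function \<open>h\<close> excludes cycles.
\<close>

lemma chain_with_least:
  assumes "finite Q" and trans: "\<And>a b d. \<lbrakk>a \<in> Q; b \<in> Q; d \<in> Q; R a b; R b d\<rbrakk> \<Longrightarrow> R a d"
    and anti: "\<And>S. \<lbrakk>S \<subseteq> Q; \<forall>a\<in>S. \<forall>b\<in>S. \<not> R a b\<rbrakk> \<Longrightarrow> card S \<le> s" and card: "r * s < card Q"
    and wf: "\<And>a b. \<lbrakk>a \<in> Q; b \<in> Q; R a b\<rbrakk> \<Longrightarrow> h a < (h b :: real)"
  shows "\<exists>C d. C \<subseteq> Q \<and> card C = Suc r \<and> d \<in> C \<and> (\<forall>a\<in>C. a = d \<or> R d a) \<and> (\<forall>a\<in>C. \<forall>b\<in>C. a = b \<or> R a b \<or> R b a)"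
  using assms
proof (induction r arbitrary: Q)
  case 0
  then obtain d where "d \<in> Q" by (metis card.empty ex_in_conv mult_0 not_less_zero)
  then show ?case by (intro exI[of _ "{d}"] exI[of _ d]) auto
next
  case (Suc r)
  define N where "N = {b \<in> Q. \<forall>a\<in>Q. \<not> R a b}"
  have NQ: "N \<subseteq> Q" unfolding N_def by auto
  have "card N \<le> s" by (rule Suc.prems(3)) (auto simp: N_def)
  moreover have "card (Q - N) = card Q - card N" using NQ Suc.prems(1) finite_subset by (intro card_Diff_subset) auto
  ultimately have "r * s < card (Q - N)" using Suc.prems(4) by simp
  then have "\<exists>C d. C \<subseteq> Q - N \<and> card C = Suc r \<and> d \<in> C \<and> (\<forall>a\<in>C. a = d \<or> R d a) \<and> (\<forall>a\<in>C. \<forall>b\<in>C. a = b \<or> R a b \<or> R b a)"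
  proof (intro Suc.IH)
    show "finite (Q - N)" using Suc.prems(1) by simp
    show "R a d" if "a \<in> Q - N" "b \<in> Q - N" "d \<in> Q - N" "R a b" "R b d" for a b d
      using Suc.prems(2)[of a b d] that by simp
    show "card S \<le> s" if "S \<subseteq> Q - N" "\<forall>a\<in>S. \<forall>b\<in>S. \<not> R a b" for S
      by (rule Suc.prems(3)[OF _ that(2)]) (use that(1) in auto)
    show "h a < h b" if "a \<in> Q - N" "b \<in> Q - N" "R a b" for a b
      using Suc.prems(5)[of a b] that by simp
  qed
  then obtain C d where C: "C \<subseteq> Q - N" "card C = Suc r" "d \<in> C" "\<forall>a\<in>C. a = d \<or> R d a" "\<forall>a\<in>C. \<forall>b\<in>C. a = b \<or> R a b \<or> R b a"
    by (elim exE conjE) (rule that)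
  have "d \<in> Q" "d \<notin> N" using C(1,3) by auto
  then obtain a where a: "a \<in> Q" "R a d" unfolding N_def by blast
  have CQ: "b \<in> Q" if "b \<in> C" for b using C(1) that by blast
  have Ra: "R a b" if "b \<in> C" for b
  proof (cases "b = d")
    case False
    then have "R d b" using C(4) that by blast
    then show ?thesis using Suc.prems(2)[OF a(1) CQ[OF C(3)] CQ[OF that] a(2)] by blast
  qed (use a(2) in simp)
  have "a \<notin> C" using Ra[of a] Suc.prems(5)[of a a] a(1) by auto
  moreover have "finite C" using C(1) Suc.prems(1) finite_subset by blast
  ultimately have "card (insert a C) = Suc (Suc r)" using C(2) by simp
  moreover have "insert a C \<subseteq> Q" using a(1) CQ by blast
  moreover have "\<forall>b\<in>insert a C. b = a \<or> R a b" using Ra by blast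
  moreover have "\<forall>b\<in>insert a C. \<forall>b'\<in>insert a C. b = b' \<or> R b b' \<or> R b' b" using Ra C(5) by blast
  ultimately show ?case by blast
qed

lemma increasing_enumeration:
  fixes \<rho> :: "'a \<Rightarrow> real"
  assumes "finite S" "inj_on \<rho> S" "card S = n"
  obtains q where "\<And>i. i < n \<Longrightarrow> q i \<in> S" "\<And>i j. i < j \<Longrightarrow> j < n \<Longrightarrow> \<rho> (q i) < \<rho> (q j)"
proof -
  define xs where "xs = sorted_list_of_set (\<rho> ` S)"
  have len: "length xs = n" unfolding xs_def using assms by (simp add: card_image)
  have set: "set xs = \<rho> ` S" unfolding xs_def using assms by simp
  have sorted: "sorted_wrt (<) xs" unfolding xs_def by simp
  define q where "q i = inv_into S \<rho> (xs ! i)" for i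
  have mem: "xs ! i \<in> \<rho> ` S" if "i < n" for i using nth_mem[of i xs] that len set by auto
  show thesis
  proof (rule that)
    show "q i \<in> S" if "i < n" for i unfolding q_def by (rule inv_into_into[OF mem[OF that]])
    fix i j assume ij: "i < j" "j < n"
    have "\<rho> (q i) = xs ! i" "\<rho> (q j) = xs ! j" unfolding q_def using mem ij by (auto intro: f_inv_into_f)
    then show "\<rho> (q i) < \<rho> (q j)" using sorted_wrt_nth_less[OF sorted ij(1)] ij len by simp
  qed
qed

context crossing_pattern
begin

lemma at_most_one:
  assumes "p \<in> insert c W" "q \<in> insert c W" "r \<in> insert c W" "s \<in> insert c W" "distinct [p, q, r, s]"
  shows "\<not> (X p q r s \<and> X p r q s)" "\<not> (X p q r s \<and> X p s q r)" "\<not> (X p r q s \<and> X p s q r)"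
proof -
  have 1: "X p q r s \<Longrightarrow> \<not> X p s q r" using one_crossing[OF assms] swap2[of q r p s] by simp
  have "distinct [q, p, r, s]" "distinct [p, r, q, s]" using assms(5) by auto
  then have 2: "X q p r s \<Longrightarrow> \<not> X p r q s" and 3: "X p r q s \<Longrightarrow> \<not> X r q p s"
    using one_crossing[of q p r s] one_crossing[of p r q s] assms by auto
  show "\<not> (X p q r s \<and> X p r q s)" using 2 swap1[of p q r s] by blast
  show "\<not> (X p q r s \<and> X p s q r)" using 1 by blast
  show "\<not> (X p r q s \<and> X p s q r)" using 3 swap1[of r q p s] swap2[of q r p s] by auto
qed

end

context crossing_pattern_from
begin

text \<open>
  For uncrossed neighbours \<open>i\<close>, \<open>j\<close>, \<open>k\<close> of \<open>v\<close>
  the stars at \<open>c\<close> and \<open>v\<close> form a plane graph, and crossings with the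
  edges at \<open>v\<close> are determined by crossings with the edges at \<open>c\<close> and with
  \<open>cv\<close>. The last six facts say that each of the two complete graphs on four vertices
  has at most one crossing.
\<close>

lemma star_triple:
  assumes W: "i \<in> W" "j \<in> W" "k \<in> W" and ord: "\<rho> v < \<rho> i" "\<rho> i < \<rho> j" "\<rho> j < \<rho> k"
    and U: "uncrossed W v i" "uncrossed W v j" "uncrossed W v k"
  shows "X v j i k \<longleftrightarrow> X c v i k = X c j i k" "X v i j k \<longleftrightarrow> X c v j k \<noteq> X c i j k" "X v k i j \<longleftrightarrow> X c v i j \<noteq> X c k i j"
    "\<not> (X c i j k \<and> X c j i k)" "\<not> (X c i j k \<and> X c k i j)" "\<not> (X c j i k \<and> X c k i j)"
    "\<not> (X v i j k \<and> X v j i k)" "\<not> (X v i j k \<and> X v k i j)" "\<not> (X v j i k \<and> X v k i j)"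
proof -
  have d: "distinct [v, j, i, k]" "distinct [v, i, j, k]" "distinct [v, k, i, j]" using ord by auto
  have n: "\<not> X c w v u" if "u \<in> {i, j, k}" "w \<in> W" "w \<noteq> v" "w \<noteq> u" for u w
    using U that unfolding uncrossed_def by auto
  show "X v j i k \<longleftrightarrow> X c v i k = X c j i k" using formula_from[OF W(2,1,3) d(1)] n[of j i] n[of j k] W d ord by auto
  show "X v i j k \<longleftrightarrow> X c v j k \<noteq> X c i j k" using formula_from[OF W d(2)] n[of i j] n[of i k] W d ord by auto
  show "X v k i j \<longleftrightarrow> X c v i j \<noteq> X c k i j" using formula_from[OF W(3,1,2) d(3)] n[of k i] n[of k j] W d ord by auto
  have W': "v \<in> insert c W" "i \<in> insert c W" "j \<in> insert c W" "k \<in> insert c W" "c \<in> insert c W" using W v_in by auto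
  have dc: "distinct [c, i, j, k]" using W c_notin d by auto
  show "\<not> (X c i j k \<and> X c j i k)" "\<not> (X c i j k \<and> X c k i j)" "\<not> (X c j i k \<and> X c k i j)"
    using at_most_one[OF W'(5,2,3,4) dc] by auto
  show "\<not> (X v i j k \<and> X v j i k)" "\<not> (X v i j k \<and> X v k i j)" "\<not> (X v j i k \<and> X v k i j)"
    using at_most_one[OF W'(1,2,3,4) d(2)] by auto
qed

lemma formula_ordered:
  assumes "i \<in> W" "j \<in> W" "k \<in> W" "l \<in> W" "\<rho> i < \<rho> j" "\<rho> j < \<rho> k" "\<rho> k < \<rho> l"
  shows "X i j k l \<longleftrightarrow> X c k i j \<noteq> (X c l i j \<noteq> (X c i k l \<noteq> X c j k l))"
    "X i k j l \<longleftrightarrow> \<not> (X c j i k \<noteq> (X c l i k \<noteq> (X c i j l \<noteq> X c k j l)))"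
proof -
  have d: "distinct [i, j, k, l]" "distinct [i, k, j, l]" using assms by auto
  have "\<not> separated (\<rho> i) (\<rho> j) (\<rho> k) (\<rho> l)" "separated (\<rho> i) (\<rho> k) (\<rho> j) (\<rho> l)"
    using assms(5-7) unfolding separated_def by auto
  then show "X i j k l \<longleftrightarrow> X c k i j \<noteq> (X c l i j \<noteq> (X c i k l \<noteq> X c j k l))"
    "X i k j l \<longleftrightarrow> \<not> (X c j i k \<noteq> (X c l i k \<noteq> (X c i j l \<noteq> X c k j l)))"
    using formula[OF assms(1-4) d(1)] formula[OF assms(1,3,2,4) d(2)] by auto
qed

text \<open>
  When \<open>cv\<close> is crossed by none of the edges, each triple \<open>i\<close>,
  \<open>j\<close>, \<open>k\<close> leaves only one possible crossing with the edges at
  \<open>c\<close>, the one with the middle vertex; so all terms of the crossing formula vanish.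
\<close>

lemma antichain_consecutive_disjoint:
  assumes W: "i \<in> W" "j \<in> W" "k \<in> W" "l \<in> W" and ord: "\<rho> v < \<rho> i" "\<rho> i < \<rho> j" "\<rho> j < \<rho> k" "\<rho> k < \<rho> l"
    and U: "uncrossed W v i" "uncrossed W v j" "uncrossed W v k" "uncrossed W v l"
    and n: "\<not> X c v i j" "\<not> X c v i k" "\<not> X c v i l" "\<not> X c v j k" "\<not> X c v j l" "\<not> X c v k l"
  shows "\<not> X i j k l"
proof -
  have v: "\<rho> v < \<rho> j" using ord by simp
  have il: "\<rho> i < \<rho> k" "\<rho> j < \<rho> l" using ord by auto
  note t1 = star_triple[OF W(1,2,3) ord(1,2,3) U(1,2,3)] and t2 = star_triple[OF W(1,2,4) ord(1,2) il(2) U(1,2,4)]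
   and t3 = star_triple[OF W(1,3,4) ord(1) il(1) ord(4) U(1,3,4)] and t4 = star_triple[OF W(2,3,4) v ord(3,4) U(2,3,4)]
  have "\<not> X c k i j" using t1 n by blast
  moreover have "\<not> X c l i j" using t2 n by blast
  moreover have "\<not> X c i k l" using t3 n by blast
  moreover have "\<not> X c j k l" using t4 n by blast
  ultimately show ?thesis using formula_ordered(1)[OF W ord(2-4)] by blast
qed

text \<open>
  When \<open>cv\<close> is crossed by all edges, every edge winds around \<open>c\<close> and for
  \<open>i < j < k\<close> exactly one of the crossings of \<open>jk\<close> with \<open>ci\<close>
  and of \<open>ij\<close> with \<open>ck\<close> occurs. If \<open>ik\<close> and \<open>jl\<close>
  crossed, the formula would make \<open>ci\<close> cross exactly one of \<open>jl\<close> and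
  \<open>kl\<close>. This contradicts the corner rule for the edges \<open>kc\<close> and
  \<open>ij\<close>, or, if these do not cross, for \<open>kv\<close> and \<open>ij\<close>.
\<close>

lemma chain_alternating_disjoint:
  assumes W: "i \<in> W" "j \<in> W" "k \<in> W" "l \<in> W" and ord: "\<rho> v < \<rho> i" "\<rho> i < \<rho> j" "\<rho> j < \<rho> k" "\<rho> k < \<rho> l"
    and U: "uncrossed W v i" "uncrossed W v j" "uncrossed W v k" "uncrossed W v l"
    and n: "X c v i j" "X c v i k" "X c v i l" "X c v j k" "X c v j l" "X c v k l"
  shows "\<not> X i k j l"
proof
  assume X: "X i k j l"
  have v: "\<rho> v < \<rho> j" using ord by simp
  have il: "\<rho> i < \<rho> k" "\<rho> j < \<rho> l" using ord by auto
  note t1 = star_triple[OF W(1,2,3) ord(1,2,3) U(1,2,3)] and t2 = star_triple[OF W(1,2,4) ord(1,2) il(2) U(1,2,4)]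
   and t3 = star_triple[OF W(1,3,4) ord(1) il(1) ord(4) U(1,3,4)] and t4 = star_triple[OF W(2,3,4) v ord(3,4) U(2,3,4)]
  have d: "distinct [i, j, k, l]" "distinct [i, k, j, l]" "v \<notin> {i, j, k, l}" "c \<notin> {v, i, j, k, l}"
    using ord W v_in c_notin by auto
  have W': "v \<in> insert c W" "i \<in> insert c W" "j \<in> insert c W" "k \<in> insert c W" "l \<in> insert c W" "c \<in> insert c W" using W v_in by auto
  have b1: "\<not> X c j i k" "X c i j k \<noteq> X c k i j" using t1 n by blast+
  have b2: "\<not> X c j i l" "X c i j l \<noteq> X c l i j" using t2 n by blast+
  have b3: "\<not> X c k i l" "X c i k l \<noteq> X c l i k" using t3 n by blast+
  have b4: "\<not> X c k j l" "X c j k l \<noteq> X c l j k" using t4 n by blast+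
  have diff: "X c i j l \<noteq> X c i k l" using formula_ordered(2)[OF W ord(2-4)] X b1 b2 b3 b4 by blast
  have "\<not> X i j k l" using at_most_one(1)[OF W'(2-5) d(1)] X by blast
  then have kl: "\<not> X k l j i" using swap2[of k l j i] swap1[of j i k l] by simp
  have dk: "distinct [c, k, j, i, l]" "distinct [v, k, j, i, l]" using d by auto
  show False
  proof (cases "X c k i j")
    case True
    then have "X c k j i" using swap3 by metis
    moreover have "\<not> X j l c k" using b4(1) swap2 by metis
    ultimately have "X k l c i = X j l c i" using corner[OF W'(6,4,3,2,5) dk(1)] kl by blast
    then show False using diff swap2 by metis
  next
    case False
    then have "X v k j i" using t1(3) n(1) swap3[of v k j i] by blast
    moreover have "\<not> X v k j l" using t4(1) n(5) b4(1) by blast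
    then have "\<not> X j l v k" using swap2[of j l v k] by simp
    ultimately have "X k l v i = X j l v i" using corner[OF W'(1,4,3,2,5) dk(2)] kl by blast
    then have "X v i k l = X v i j l" using swap2 by metis
    then show False using t2(2) t3(2) n(5,6) diff by blast
  qed
qed

text \<open>
  On the uncrossed neighbours of \<open>v\<close>, ordered by the rotation, the relation that
  \<open>cv\<close> crosses \<open>ab\<close> is transitive. Among \<open>4m\<^sup>2\<close> of them
  there is a chain or an antichain of size \<open>2m\<close>. In an antichain the pairs of
  consecutive vertices are disjoint, in a chain the pairs at distance \<open>m\<close>.
\<close>

lemma disjoint_pairs_in_star:
  assumes m: "m \<ge> 1" and Q: "Q \<subseteq> W - {v}" "card Q \<ge> 4 * m ^ 2" "\<And>q. q \<in> Q \<Longrightarrow> uncrossed W v q"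
  shows "\<exists>a b. (\<forall>i<m. a i \<in> W \<and> b i \<in> W \<and> a i \<noteq> b i) \<and>
    (\<forall>i<m. \<forall>j<m. i \<noteq> j \<longrightarrow> distinct [a i, b i, a j, b j] \<and> \<not> X (a i) (b i) (a j) (b j))"
proof -
  let ?R = "\<lambda>a b. \<rho> a < \<rho> b \<and> X c v a b"
  have QW: "q \<in> W" "q \<noteq> v" "\<rho> v < \<rho> q" if "q \<in> Q" for q using Q(1) that v_first by auto
  have finQ: "finite Q" using Q(1) finite_W finite_subset by blast
  have trans: "?R a d" if "a \<in> Q" "b \<in> Q" "d \<in> Q" "?R a b" "?R b d" for a b d
  proof -
    have o: "\<rho> a < \<rho> b" "\<rho> b < \<rho> d" using that by auto
    note t = star_triple[OF QW(1)[OF that(1)] QW(1)[OF that(2)] QW(1)[OF that(3)] QW(3)[OF that(1)] o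
        Q(3)[OF that(1)] Q(3)[OF that(2)] Q(3)[OF that(3)]]
    have "X c v a d" using t that(4,5) by blast
    then show ?thesis using o by simp
  qed
  obtain S where S: "S \<subseteq> Q" "card S = 2 * m" and
    hom: "(\<forall>a\<in>S. \<forall>b\<in>S. \<not> ?R a b) \<or> (\<forall>a\<in>S. \<forall>b\<in>S. a = b \<or> ?R a b \<or> ?R b a)"
  proof (cases "\<exists>S\<subseteq>Q. card S \<ge> 2 * m \<and> (\<forall>a\<in>S. \<forall>b\<in>S. \<not> ?R a b)")
    case True
    then obtain S where S: "S \<subseteq> Q" "card S \<ge> 2 * m" "\<forall>a\<in>S. \<forall>b\<in>S. \<not> ?R a b" by blast
    then obtain S' where "S' \<subseteq> S" "card S' = 2 * m" using obtain_subset_with_card_n[of "2 * m" S] by metis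
    then show thesis using that[of S'] S by blast
  next
    case False
    have "\<exists>C d. C \<subseteq> Q \<and> card C = Suc (2 * m - 1) \<and> d \<in> C \<and> (\<forall>a\<in>C. a = d \<or> ?R d a) \<and> (\<forall>a\<in>C. \<forall>b\<in>C. a = b \<or> ?R a b \<or> ?R b a)"
    proof (rule chain_with_least[where s = "2 * m - 1" and h = \<rho>])
      show "\<And>S. \<lbrakk>S \<subseteq> Q; \<forall>a\<in>S. \<forall>b\<in>S. \<not> ?R a b\<rbrakk> \<Longrightarrow> card S \<le> 2 * m - 1" using False by fastforce
      have "(2 * m - 1) * (2 * m - 1) < (2 * m) * (2 * m)" using m by (intro mult_strict_mono) auto
      also have "\<dots> = 4 * m ^ 2" by (simp add: power2_eq_square)
      finally show "(2 * m - 1) * (2 * m - 1) < card Q" using Q(2) by simp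
      show "finite Q" by (rule finQ)
      show "?R a d" if "a \<in> Q" "b \<in> Q" "d \<in> Q" "?R a b" "?R b d" for a b d by (rule trans[OF that])
      show "\<rho> a < \<rho> b" if "?R a b" for a b using that by (rule conjunct1)
    qed
    then obtain C d where "C \<subseteq> Q" "card C = Suc (2 * m - 1)" "\<forall>a\<in>C. \<forall>b\<in>C. a = b \<or> ?R a b \<or> ?R b a"
      by (elim exE conjE) (rule that)
    then show thesis using that[of C] m by simp
  qed
  have finS: "finite S" using S(1) finQ finite_subset by blast
  have injS: "inj_on \<rho> S" by (rule inj_on_subset[OF inj_\<rho>]) (use S(1) Q(1) in auto)
  obtain q where q: "\<And>i. i < 2 * m \<Longrightarrow> q i \<in> S" "\<And>i j. i < j \<Longrightarrow> j < 2 * m \<Longrightarrow> \<rho> (q i) < \<rho> (q j)"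
    using increasing_enumeration[OF finS injS S(2)] by blast
  have qQ: "q i \<in> Q" if "i < 2 * m" for i using q(1) S(1) that by blast
  have qW: "q i \<in> W" "\<rho> v < \<rho> (q i)" "uncrossed W v (q i)" if "i < 2 * m" for i using qQ[OF that] QW Q(3) by auto
  have qne: "q i \<noteq> q j" if "i < 2 * m" "j < 2 * m" "i \<noteq> j" for i j
    using q(2)[of i j] q(2)[of j i] that by (metis less_irrefl nat_neq_iff)
  from hom show ?thesis
  proof
    assume none: "\<forall>a\<in>S. \<forall>b\<in>S. \<not> ?R a b"
    have nX: "\<not> X c v (q i) (q j)" if "i < j" "j < 2 * m" for i j using none q(1)[of i] q(1)[of j] q(2)[OF that] that by auto
    have dis: "\<not> X (q (2*i)) (q (2*i+1)) (q (2*j)) (q (2*j+1))" if "i < j" "j < m" for i j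
      by (rule antichain_consecutive_disjoint) (rule qW q(2) nX; use that in simp)+
    show ?thesis
    proof (rule exI[of _ "\<lambda>i. q (2*i)"], rule exI[of _ "\<lambda>i. q (2*i+1)"], intro conjI allI impI)
      fix i j assume ij: "i < m" "j < m" "i \<noteq> j"
      show "distinct [q (2*i), q (2*i+1), q (2*j), q (2*j+1)]" using ij qne by (auto; presburger)
      show "\<not> X (q (2*i)) (q (2*i+1)) (q (2*j)) (q (2*j+1))"
        using dis[of i j] dis[of j i] ij swap2 by (metis linorder_neqE_nat)
    next
      fix i assume "i < m"
      then have "2 * i < 2 * m" "2 * i + 1 < 2 * m" "2 * i \<noteq> 2 * i + 1" by auto
      then show "q (2*i) \<in> W" "q (2*i+1) \<in> W" "q (2*i) \<noteq> q (2*i+1)" by (blast intro: qW(1), blast intro: qW(1), rule qne)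
    qed
  next
    assume all: "\<forall>a\<in>S. \<forall>b\<in>S. a = b \<or> ?R a b \<or> ?R b a"
    have pX: "X c v (q i) (q j)" if "i < j" "j < 2 * m" for i j
    proof -
      have "q i \<in> S" "q j \<in> S" "\<rho> (q i) < \<rho> (q j)" using q that by auto
      then show ?thesis using all by fastforce
    qed
    have dis: "\<not> X (q i) (q (i+m)) (q j) (q (j+m))" if "i < j" "j < m" for i j
      by (rule chain_alternating_disjoint) (rule qW q(2) pX; use that in simp)+
    show ?thesis
    proof (rule exI[of _ q], rule exI[of _ "\<lambda>i. q (i+m)"], intro conjI allI impI)
      fix i j assume ij: "i < m" "j < m" "i \<noteq> j"
      show "distinct [q i, q (i+m), q j, q (j+m)]" using ij qne by auto
      show "\<not> X (q i) (q (i+m)) (q j) (q (j+m))"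
        using dis[of i j] dis[of j i] ij swap2 by (metis linorder_neqE_nat)
    next
      fix i assume "i < m"
      then have "i < 2 * m" "i + m < 2 * m" "i \<noteq> i + m" by auto
      then show "q i \<in> W" "q (i+m) \<in> W" "q i \<noteq> q (i+m)" by (blast intro: qW(1), blast intro: qW(1), rule qne)
    qed
  qed
qed

end

context crossing_pattern
begin

lemma disjoint_pairs:
  assumes m: "m \<ge> 1" and card: "card W \<ge> 12 * m ^ 3"
  shows "\<exists>a b. (\<forall>i<m. a i \<in> W \<and> b i \<in> W \<and> a i \<noteq> b i) \<and>
    (\<forall>i<m. \<forall>j<m. i \<noteq> j \<longrightarrow> distinct [a i, b i, a j, b j] \<and> \<not> X (a i) (b i) (a j) (b j))"
  using matching_or_star[OF assms]
proof
  assume "\<exists>M. finite M \<and> card M = m \<and> plane_pairs W M \<and> vertex_disjoint M"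
  then obtain M where M: "finite M" "card M = m" "plane_pairs W M" "vertex_disjoint M" by blast
  obtain f where f: "bij_betw f {..<m} M" using ex_bij_betw_nat_finite[OF M(1)] M(2) by (auto simp: atLeast0LessThan)
  have fM: "(fst (f i), snd (f i)) \<in> M" if "i < m" for i using f that unfolding bij_betw_def by auto
  have fne: "f i \<noteq> f j" if "i < m" "j < m" "i \<noteq> j" for i j using f that unfolding bij_betw_def by (auto dest: inj_onD)
  have unc: "uncrossed W (fst (f i)) (snd (f i))" if "i < m" for i using M(3) fM[OF that] unfolding plane_pairs_def by blast
  show ?thesis
  proof (rule exI[of _ "fst \<circ> f"], rule exI[of _ "snd \<circ> f"], intro conjI allI impI)
    fix i assume "i < m"
    then show "(fst \<circ> f) i \<in> W" "(snd \<circ> f) i \<in> W" "(fst \<circ> f) i \<noteq> (snd \<circ> f) i"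
      using unc unfolding uncrossed_def by auto
  next
    fix i j assume ij: "i < m" "j < m" "i \<noteq> j"
    have "(fst (f i), snd (f i)) \<noteq> (fst (f j), snd (f j))" using fne[OF ij] by simp
    then have "{fst (f i), snd (f i)} \<inter> {fst (f j), snd (f j)} = {}"
      using M(4) fM[OF ij(1)] fM[OF ij(2)] unfolding vertex_disjoint_def by blast
    then show d: "distinct [(fst \<circ> f) i, (snd \<circ> f) i, (fst \<circ> f) j, (snd \<circ> f) j]"
      using unc[OF ij(1)] unc[OF ij(2)] unfolding uncrossed_def by auto
    then show "\<not> X ((fst \<circ> f) i) ((snd \<circ> f) i) ((fst \<circ> f) j) ((snd \<circ> f) j)"
      using M(3) fM[OF ij(1)] fM[OF ij(2)] unfolding plane_pairs_def by fastforce
  qed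
next
  assume "\<exists>u\<in>W. \<exists>Q. Q \<subseteq> W - {u} \<and> card Q \<ge> 4 * m ^ 2 \<and> (\<forall>q\<in>Q. uncrossed W u q)"
  then obtain u Q where u: "u \<in> W" and Q: "Q \<subseteq> W - {u}" "card Q \<ge> 4 * m ^ 2" "\<forall>q\<in>Q. uncrossed W u q" by blast
  obtain \<rho>' where \<rho>': "crossing_pattern c W X \<rho>'" "\<And>w. w \<in> W - {u} \<Longrightarrow> \<rho>' u < \<rho>' w"
    using rotate_to_front[OF u] by blast
  interpret R: crossing_pattern_from c W X \<rho>' u
    unfolding crossing_pattern_from_def crossing_pattern_from_axioms_def using \<rho>' u by auto
  show ?thesis using R.disjoint_pairs_in_star[OF m Q(1,2)] Q(3) by blast
qed

end

section \<open>Disjoint edges\<close>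

context complete_simple_topological_graph
begin

lemma crossing_pattern_at_vertex:
  assumes c: "c \<in> V" "good_radius c \<epsilon>"
  shows "crossing_pattern c (V - {c}) cross (rotation c \<epsilon>)"
proof
  have ins: "insert c (V - {c}) = V" using c by auto
  show "finite (V - {c})" "c \<notin> V - {c}" using finite_vertices by auto
  show "inj_on (rotation c \<epsilon>) (V - {c})" by (rule star_of_edges(3)[OF c])
  show "cross p q r s = cross q p r s" "cross p q r s = cross r s p q" for p q r s
    by (rule cross_commute1, rule cross_commute2)
  show "\<not> cross q r p s" if "p \<in> insert c (V - {c})" "q \<in> insert c (V - {c})" "r \<in> insert c (V - {c})"
      "s \<in> insert c (V - {c})" "distinct [p, q, r, s]" "cross p q r s" for p q r s
    using no_two_crossings that unfolding ins by blast
  show "cross q t p s = cross r t p s" if "p \<in> insert c (V - {c})" "q \<in> insert c (V - {c})" "r \<in> insert c (V - {c})"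
      "s \<in> insert c (V - {c})" "t \<in> insert c (V - {c})" "distinct [p, q, r, s, t]" "cross p q r s" "\<not> cross q t r s" "\<not> cross r t p q" for p q r s t
    using corner_rule[of p q r s t] that unfolding ins by blast
  show "cross c j v z" if "v \<in> V - {c}" "z \<in> V - {c}" "k \<in> V - {c}" "l \<in> V - {c}" "j \<in> V - {c}" "distinct [v, z, k, l]" "j \<notin> {v, z, l}"
      "cross c z v k" "cross c l v z" "cross c j v l" "j = k \<or> \<not> cross c j v k" "\<not> cross c l v k" for v z k l j
    by (rule blocker_transitivity[of c v z k l j]) (use that c in auto)
  show "cross c w v k" if "v \<in> V - {c}" "z \<in> V - {c}" "k \<in> V - {c}" "x \<in> V - {c}" "w \<in> V - {c}" "distinct [v, z, k, x, w]"
      "cross c z v k" "cross c x v w" "\<not> cross c z v w" "\<not> cross c x v k"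
      "separated (rotation c \<epsilon> v) (rotation c \<epsilon> z) (rotation c \<epsilon> x) (rotation c \<epsilon> w)" for v z k x w
    by (rule interlocked_blockers_rule[OF c, of v z k x w]) (use that in auto)
  show "\<not> cross c b v k" if "v \<in> V - {c}" "e \<in> V - {c}" "x \<in> V - {c}" "y \<in> V - {c}" "k \<in> V - {c}" "b \<in> V - {c}"
      "distinct [v, e, x, y, k]" "b \<notin> {v, x, k}" "cross v e x y" "\<not> cross c v x y" "\<not> cross c x v e" "\<not> cross c k v e"
      "\<not> cross c k x y" "b = e \<or> \<not> cross c b v e" "b = y \<or> \<not> cross c b x y" "\<not> cross v k x y" "\<not> cross c x v k"
      "separated (rotation c \<epsilon> v) (rotation c \<epsilon> x) (rotation c \<epsilon> k) (rotation c \<epsilon> b)" for v e x y k b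
    by (rule quadrilateral_rule[OF c, of v e x y k b]) (use that in auto)
  show "cross p q r s \<longleftrightarrow> (separated (rotation c \<epsilon> p) (rotation c \<epsilon> q) (rotation c \<epsilon> r) (rotation c \<epsilon> s)
      \<noteq> (cross c r p q \<noteq> (cross c s p q \<noteq> (cross c p r s \<noteq> cross c q r s))))"
    if "p \<in> V - {c}" "q \<in> V - {c}" "r \<in> V - {c}" "s \<in> V - {c}" "distinct [p, q, r, s]" for p q r s
    by (rule cross_formula[OF c]) (use that in auto)
qed

lemma disjoint_edges_exist:
  assumes m: "m \<ge> 1" and card: "card V > 12 * m ^ 3"
  shows "\<exists>F\<subseteq>E. finite F \<and> pairwise disjoint_edges F \<and> card F = m"
proof -
  obtain c where c: "c \<in> V" using card by (metis card.empty ex_in_conv not_less_zero)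
  obtain \<epsilon> where "good_radius c \<epsilon>" using good_radius_exists[OF c] .
  then interpret P: crossing_pattern c "V - {c}" cross "rotation c \<epsilon>" by (rule crossing_pattern_at_vertex[OF c])
  have "card (V - {c}) \<ge> 12 * m ^ 3" using card c finite_vertices by simp
  then obtain a b where ab: "\<forall>i<m. a i \<in> V - {c} \<and> b i \<in> V - {c} \<and> a i \<noteq> b i"
    "\<forall>i<m. \<forall>j<m. i \<noteq> j \<longrightarrow> distinct [a i, b i, a j, b j] \<and> \<not> cross (a i) (b i) (a j) (b j)"
    using P.disjoint_pairs[OF m] by blast
  have e: "edge (a i) (b i) \<in> E" "edge_ends (edge (a i) (b i)) = {a i, b i}" if "i < m" for i
    using edge_in[of "a i" "b i"] ab(1) that by auto
  have dis: "disjoint_edges (edge (a i) (b i)) (edge (a j) (b j))" if "i < m" "j < m" "i \<noteq> j" for i j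
    using ab(2) that e unfolding disjoint_edges_def cross_def by auto
  have "inj_on (\<lambda>i. edge (a i) (b i)) {..<m}"
  proof (rule inj_onI)
    fix i j assume ij: "i \<in> {..<m}" "j \<in> {..<m}" "edge (a i) (b i) = edge (a j) (b j)"
    then have "{a i, b i} = {a j, b j}" using e by (metis lessThan_iff)
    show "i = j"
    proof (rule ccontr)
      assume "i \<noteq> j"
      then have "distinct [a i, b i, a j, b j]" using ab(2) ij(1,2) by auto
      then show False using \<open>{a i, b i} = {a j, b j}\<close> by (auto simp: doubleton_eq_iff)
    qed
  qed
  then have "card ((\<lambda>i. edge (a i) (b i)) ` {..<m}) = m" by (simp add: card_image)
  moreover have "pairwise disjoint_edges ((\<lambda>i. edge (a i) (b i)) ` {..<m})"
  proof (rule pairwiseI)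
    fix x y assume "x \<in> (\<lambda>i. edge (a i) (b i)) ` {..<m}" "y \<in> (\<lambda>i. edge (a i) (b i)) ` {..<m}" "x \<noteq> y"
    then obtain i j where "i < m" "j < m" "x = edge (a i) (b i)" "y = edge (a j) (b j)" "i \<noteq> j" by auto
    then show "disjoint_edges x y" using dis by simp
  qed
  ultimately show ?thesis using e by (intro exI[of _ "(\<lambda>i. edge (a i) (b i)) ` {..<m}"]) auto
qed

end

theorem theorem1p1:
  "\<exists>(c::real) (n\<^sub>0::nat). c > 0 \<and>
     (\<forall>n \<ge> n\<^sub>0. \<forall>V E. complete_simple_topological_graph V E \<and> card V = n \<longrightarrow>
        (\<exists>F \<subseteq> E. finite F \<and> pairwise disjoint_edges F \<and> real (card F) \<ge> c * real n powr (1/3)))"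
proof (rule exI[of _ "(1/24) powr (1/3) / 2"], rule exI[of _ 24], intro conjI strip)
  show "(1/24) powr (1/3) / 2 > (0::real)" by simp
  fix n :: nat and V E
  assume n: "n \<ge> 24" and G: "complete_simple_topological_graph V E \<and> card V = n"
  interpret complete_simple_topological_graph V E using G by blast
  \<comment> \<open>With 24 in place of 12 the bound \<open>12 * m ^ 3 < n\<close> is strict, which leaves room for the vertex \<open>c\<close>.\<close>
  define t where "t = (real n / 24) powr (1/3)"
  define m where "m = nat \<lfloor>t\<rfloor>"
  have t1: "t \<ge> 1" unfolding t_def using n by (intro ge_one_powr_ge_zero) auto
  have m: "m \<ge> 1" "real m \<le> t" "t - 1 < real m" using t1 unfolding m_def by linarith+
  have mt: "t / 2 \<le> real m" using m(1,3) by simp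
  have "real m ^ 3 \<le> t ^ 3" using m by (intro power_mono) auto
  also have "t ^ 3 = real n / 24"
    unfolding t_def using n by (simp add: powr_powr flip: powr_realpow)
  finally have "real (12 * m ^ 3) < real n" using n by simp
  then have "card V > 12 * m ^ 3" using G by (simp only: of_nat_less_iff)
  then obtain F where F: "F \<subseteq> E" "finite F" "pairwise disjoint_edges F" "card F = m"
    using disjoint_edges_exist[OF m(1)] by blast
  have "t = (1/24 * real n) powr (1/3)" unfolding t_def by simp
  also have "\<dots> = (1/24) powr (1/3) * real n powr (1/3)" by (rule powr_mult)
  finally have "(1/24) powr (1/3) / 2 * real n powr (1/3) = t / 2" by simp
  then show "\<exists>F \<subseteq> E. finite F \<and> pairwise disjoint_edges F \<and> real (card F) \<ge> (1/24) powr (1/3) / 2 * real n powr (1/3)"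
    using F mt by auto
qed

end
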